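(* Let $p,m,k$ be positive integers with $k\le\min(p,m)$ and let $\phi:M_p\to M_m$ be a linear map. Then the following are equivalent: (i) $\phi:\mathrm{OMIN}_k(M_p)\to M_m$ is completely positive. (ii) $\phi$ is $k$-partially entanglement breaking. (iii) $\phi:M_p\to\mathrm{OMAX}_k(M_m)$ is completely positive. (iv) There exist a positive integer $q$, completely positive maps $\psi_l:M_p\to M_k$ and matrices $M_l\in M_{m,k}$, $1\le l\le q$, such that $\phi(X)=\sum_{l=1}^q M_l\psi_l(X)M_l^*$ for all $X\in M_p$. (v) There exist a positive integer $s$ and matrices $A_l\in M_{p,m}$, $1\le l\le s$, each of rank at most $k$, such that $\phi(X)=\sum_{l=1}^s A_l^*XA_l$ for all $X\in M_p$. (vi) $\phi:\mathrm{OMIN}_k(M_p)\to\mathrm{OMAX}_k(M_m)$ is completely positive.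
   Context: $M_{n,m}$ denotes complex $n\times m$ matrices and $M_n=M_{n,n}$. $M_n$ is regarded as an operator system with unit $I_n$ and its usual matrix cones $M_r(M_n)^+$ (positive semidefinite matrices in $M_r(M_n)\cong M_{rn}$). A linear map $\phi:V\to W$ induces $\phi^{(n)}:M_n(V)\to M_n(W)$, $\phi^{(n)}((v_{ij}))=(\phi(v_{ij}))$; between spaces with given matrix cones, $\phi$ is $k$-positive if $\phi^{(k)}$ maps the positive cone of level $k$ into the positive cone of level $k$, and completely positive if this holds at every level. For an operator system $\mathcal S$ with unit $e$ and natural cones $M_n(\mathcal S)^+$, let $S_k(\mathcal S)$ be the set of unital $k$-positive linear maps $\mathcal S\to M_k$. $\mathrm{OMIN}_k(\mathcal S)$ is the operator system on $\mathcal S$ with unit $e$ and matrix cones $C_n^{k\text{-}min}(\mathcal S)=\{(a_{ij})\in M_n(\mathcal S): (\phi(a_{ij}))\ge 0 \text{ for all }\phi\in S_k(\mathcal S)\}$. $\mathrm{OMAX}_k(\mathcal S)$ is the operator system on $\mathcal S$ with unit $e$ and matrix cones $C_n^{k\text{-}max}(\mathcal S)=\{A\in M_n(\mathcal S): r(e\otimes I_n)+A\in D_n^{k\text{-}max}(\mathcal S)\text{ for all } r>0\}$, where $D_n^{k\text{-}max}(\mathcal S)=\{ADA^*: A\in M_{n,qk},\ D=\mathrm{diag}(D_1,\dots,D_q),\ D_l\in M_k(\mathcal S)^+,\ q\in\mathbb N\}$. A state on $M_n\otimes M_m$ is a positive linear functional $s$ with $s(I_n\otimes I_m)=1$. Its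 density matrix is $\rho_s=(s(E_{ij}\otimes E_{kl}))=\sum s(E_{ij}\otimes E_{kl})E_{ij}\otimes E_{kl}$, where $E_{ij}$, $E_{kl}$ are the matrix units of $M_n$, $M_m$. The Schmidt rank of $U\in\mathbb C^n\otimes\mathbb C^m$ is the least number of elementary tensors whose sum is $U$. The Schmidt number of $\rho_s$ is the least $k$ such that $\rho_s$ is a finite sum of matrices $UU^*$ with $U\in\mathbb C^n\otimes\mathbb C^m$ of Schmidt rank at most $k$. The state $s$ is $k$-separable if the Schmidt number of $\rho_s$ is at most $k$. A linear map $\phi:M_p\to M_m$ is $k$-partially entanglement breaking if $s\circ\phi^{(n)}:M_n\otimes M_p\to\mathbb C$ (with $M_n(M_p)\cong M_n\otimes M_p$) is a $k$-separable state for every state $s:M_n\otimes M_m\to\mathbb C$, for all $n\in\mathbb N$.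
   Formalization: In (ii), the functional s∘φ^(n) is required only to be positive with density matrix of Schmidt number at most k, not to have value 1 at the identity; with normalization, φ = 0 satisfies (i) and (iii)–(vi) but not (ii). *)

theory Defs
  imports
    "Jordan_Normal_Form.DL_Rank"
    "Jordan_Normal_Form.Schur_Decomposition"
begin

section \<open>Operator systems and matrix cones\<close>

text \<open>The data of an operator system that the constructions below use: the complex vector space
  (\<^term>\<open>mult\<close> and \<^term>\<open>one\<close>, inherited from the HOL-Algebra module record, play no role),
  the order unit \<open>e\<close>, and the cones \<open>M_n(S)^+\<close> for every level \<open>n\<close>.
  The involution does not enter. An element of \<open>M_n(S)\<close> is an \<open>n \<times> n\<close> matrix with
  entries in the carrier of \<open>S\<close>; in particular an element of \<open>M_n(M_d)\<close> is a
  matrix of matrices, of type \<^typ>\<open>complex mat mat\<close>.\<close>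

record 'v op_sys = "(complex, 'v) module" +
  ord_unit :: 'v
  pos_cone :: "nat \<Rightarrow> 'v mat set"

definition mats :: "nat \<Rightarrow> 'v op_sys \<Rightarrow> 'v mat set" where
  "mats n S = {A \<in> carrier_mat n n. elements_mat A \<subseteq> carrier S}"

definition mats_add :: "'v op_sys \<Rightarrow> 'v mat \<Rightarrow> 'v mat \<Rightarrow> 'v mat" where
  "mats_add S A B = mat (dim_row A) (dim_col A) (\<lambda>ij. A $$ ij \<oplus>\<^bsub>S\<^esub> B $$ ij)"

definition mats_smult :: "'v op_sys \<Rightarrow> complex \<Rightarrow> 'v mat \<Rightarrow> 'v mat" where
  "mats_smult S c A = map_mat (\<lambda>v. c \<odot>\<^bsub>S\<^esub> v) A"

text \<open>The elementary tensor of \<open>A \<in> M_n\<close> and \<open>v \<in> S\<close>, as the element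
  \<open>(a_ij v)\<close> of \<open>M_n(S)\<close>.\<close>

definition mat_tensor :: "'v op_sys \<Rightarrow> complex mat \<Rightarrow> 'v \<Rightarrow> 'v mat" where
  "mat_tensor S A v = map_mat (\<lambda>c. c \<odot>\<^bsub>S\<^esub> v) A"

text \<open>\<open>A D A^*\<close> for a scalar matrix \<open>A\<close> and a square matrix \<open>D\<close> over \<open>S\<close>.\<close>

definition mats_conj :: "'v op_sys \<Rightarrow> complex mat \<Rightarrow> 'v mat \<Rightarrow> 'v mat" where
  "mats_conj S A D = mat (dim_row A) (dim_row A) (\<lambda>(i, j).
     \<Oplus>\<^bsub>S\<^esub>a\<in>{..<dim_col A}. \<Oplus>\<^bsub>S\<^esub>b\<in>{..<dim_col A}. (A $$ (i, a) * cnj (A $$ (j, b))) \<odot>\<^bsub>S\<^esub> D $$ (a, b))"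

text \<open>\<open>diag(D_0, \<dots>, D_(q-1))\<close> with \<open>k \<times> k\<close> blocks.\<close>

definition mats_diag :: "'v op_sys \<Rightarrow> nat \<Rightarrow> nat \<Rightarrow> (nat \<Rightarrow> 'v mat) \<Rightarrow> 'v mat" where
  "mats_diag S k q D = mat (q * k) (q * k) (\<lambda>(i, j).
     if i div k = j div k then D (i div k) $$ (i mod k, j mod k) else \<zero>\<^bsub>S\<^esub>)"

text \<open>The induced map \<open>\<phi>^(n)\<close> is \<^term>\<open>map_mat \<phi>\<close>.\<close>

definition k_positive :: "nat \<Rightarrow> 'v op_sys \<Rightarrow> 'w op_sys \<Rightarrow> ('v \<Rightarrow> 'w) \<Rightarrow> bool" where
  "k_positive k S T \<phi> \<longleftrightarrow> \<phi> \<in> LinearCombinations.module_hom class_ring S T \<and>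
     (\<forall>A \<in> pos_cone S k. map_mat \<phi> A \<in> pos_cone T k)"

definition completely_positive :: "'v op_sys \<Rightarrow> 'w op_sys \<Rightarrow> ('v \<Rightarrow> 'w) \<Rightarrow> bool" where
  "completely_positive S T \<phi> \<longleftrightarrow> \<phi> \<in> LinearCombinations.module_hom class_ring S T \<and>
     (\<forall>n>0. \<forall>A \<in> pos_cone S n. map_mat \<phi> A \<in> pos_cone T n)"


section \<open>The operator system of complex matrices\<close>

definition psd_mats :: "nat \<Rightarrow> complex mat set" where
  "psd_mats N = {A \<in> carrier_mat N N. \<forall>v \<in> carrier_vec N. 0 \<le> (A *\<^sub>v v) \<bullet>c v}"

text \<open>The identification of \<open>M_n(M_d)\<close> with \<open>M_(n d)\<close>: entry \<open>(k, l)\<close> of block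
  \<open>(i, j)\<close> becomes entry \<open>(i d + k, j d + l)\<close>.\<close>

definition flatten_mat :: "nat \<Rightarrow> nat \<Rightarrow> complex mat mat \<Rightarrow> complex mat" where
  "flatten_mat n d A = mat (n * d) (n * d) (\<lambda>(a, b).
     A $$ (a div d, b div d) $$ (a mod d, b mod d))"

definition mat_sys :: "nat \<Rightarrow> complex mat op_sys" where
  "mat_sys d = module.extend (module_mat TYPE(complex) d d)
     (op_sys.fields (1\<^sub>m d)
       (\<lambda>n. {A \<in> carrier_mat n n. elements_mat A \<subseteq> carrier_mat d d \<and> flatten_mat n d A \<in> psd_mats (n * d)}))"

lemma mat_sys_simps [simp]:
  "carrier (mat_sys d) = carrier_mat d d"
  "zero (mat_sys d) = 0\<^sub>m d d"
  "add (mat_sys d) = (+)"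
  "module.smult (mat_sys d) = (\<cdot>\<^sub>m)"
  "ord_unit (mat_sys d) = 1\<^sub>m d"
  "pos_cone (mat_sys d) n = {A \<in> mats n (mat_sys d). flatten_mat n d A \<in> psd_mats (n * d)}"
  unfolding mat_sys_def mats_def module_mat_def
  by (auto simp: module.defs op_sys.defs)


section \<open>The k-minimal and k-maximal operator systems\<close>

definition unital_kpos_maps :: "nat \<Rightarrow> 'v op_sys \<Rightarrow> ('v \<Rightarrow> complex mat) set" where
  "unital_kpos_maps k S = {\<phi>. k_positive k S (mat_sys k) \<phi> \<and> \<phi> (ord_unit S) = 1\<^sub>m k}"

definition OMIN :: "nat \<Rightarrow> 'v op_sys \<Rightarrow> 'v op_sys" where
  "OMIN k S = S\<lparr>pos_cone := \<lambda>n.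
     {A \<in> mats n S. \<forall>\<phi> \<in> unital_kpos_maps k S. map_mat \<phi> A \<in> pos_cone (mat_sys k) n}\<rparr>"

definition D_max :: "nat \<Rightarrow> 'v op_sys \<Rightarrow> nat \<Rightarrow> 'v mat set" where
  "D_max k S n = {mats_conj S A (mats_diag S k q D) | A D q.
     0 < q \<and> A \<in> carrier_mat n (q * k) \<and> (\<forall>l<q. D l \<in> pos_cone S k)}"

definition OMAX :: "nat \<Rightarrow> 'v op_sys \<Rightarrow> 'v op_sys" where
  "OMAX k S = S\<lparr>pos_cone := \<lambda>n.
     {A \<in> mats n S. \<forall>r::real. 0 < r \<longrightarrow>
        mats_add S (mats_smult S (complex_of_real r) (mat_tensor S (1\<^sub>m n) (ord_unit S))) A \<in> D_max k S n}\<rparr>"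


section \<open>States, Schmidt number and partially entanglement breaking maps\<close>

text \<open>\<open>M_n \<otimes> M_m\<close> is rendered as \<open>M_n(M_m)\<close>.\<close>

definition positive_functional :: "nat \<Rightarrow> nat \<Rightarrow> (complex mat mat \<Rightarrow> complex) \<Rightarrow> bool" where
  "positive_functional n m s \<longleftrightarrow>
     (\<forall>A \<in> mats n (mat_sys m). \<forall>B \<in> mats n (mat_sys m). s (mats_add (mat_sys m) A B) = s A + s B) \<and>
     (\<forall>c. \<forall>A \<in> mats n (mat_sys m). s (mats_smult (mat_sys m) c A) = c * s A) \<and>
     (\<forall>A \<in> pos_cone (mat_sys m) n. 0 \<le> s A)"

definition is_state :: "nat \<Rightarrow> nat \<Rightarrow> (complex mat mat \<Rightarrow> complex) \<Rightarrow> bool" where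
  "is_state n m s \<longleftrightarrow> positive_functional n m s \<and> s (mat_tensor (mat_sys m) (1\<^sub>m n) (1\<^sub>m m)) = 1"

definition unit_mat :: "nat \<Rightarrow> nat \<Rightarrow> nat \<Rightarrow> complex mat" where
  "unit_mat n i j = mat n n (\<lambda>ab. if ab = (i, j) then 1 else 0)"

definition density_mat :: "nat \<Rightarrow> nat \<Rightarrow> (complex mat mat \<Rightarrow> complex) \<Rightarrow> complex mat" where
  "density_mat n m s = mat (n * m) (n * m) (\<lambda>(a, b).
     s (mat_tensor (mat_sys m) (unit_mat n (a div m) (b div m)) (unit_mat m (a mod m) (b mod m))))"

text \<open>Vectors of \<open>C^n \<otimes> C^m\<close> are vectors of dimension \<open>n m\<close>, indexed compatibly with
  \<^const>\<open>flatten_mat\<close>.\<close>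

definition vec_tensor :: "complex vec \<Rightarrow> complex vec \<Rightarrow> complex vec" where
  "vec_tensor u v = vec (dim_vec u * dim_vec v) (\<lambda>a. u $ (a div dim_vec v) * v $ (a mod dim_vec v))"

definition schmidt_rank :: "nat \<Rightarrow> nat \<Rightarrow> complex vec \<Rightarrow> nat" where
  "schmidt_rank n m U = (LEAST r. \<exists>u v.
     (\<forall>i<r. u i \<in> carrier_vec n \<and> v i \<in> carrier_vec m) \<and>
     U = finsum_vec TYPE(complex) (n * m) (\<lambda>i. vec_tensor (u i) (v i)) {..<r})"

definition rank_one_mat :: "complex vec \<Rightarrow> complex mat" where
  "rank_one_mat U = mat (dim_vec U) (dim_vec U) (\<lambda>(a, b). U $ a * cnj (U $ b))"

text \<open>Only meaningful for positive semidefinite \<open>\<rho>\<close>: otherwise \<open>\<rho>\<close> is not a sum of matrices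
  \<open>U U^*\<close> and \<^term>\<open>Least\<close> is taken over the empty set.\<close>

definition schmidt_number :: "nat \<Rightarrow> nat \<Rightarrow> complex mat \<Rightarrow> nat" where
  "schmidt_number n m \<rho> = (LEAST k. \<exists>r U.
     (\<forall>i<r. U i \<in> carrier_vec (n * m) \<and> schmidt_rank n m (U i) \<le> k) \<and>
     \<rho> = (\<Oplus>\<^bsub>module_mat TYPE(complex) (n * m) (n * m)\<^esub>i\<in>{..<r::nat}. rank_one_mat (U i)))"

text \<open>A positive functional is not required to be normalized here: for a map \<open>\<phi>\<close> that does not
  preserve the unit, \<open>s \<circ> \<phi>^(n)\<close> need not take the value 1 at the identity (for \<open>\<phi> = 0\<close> it is
  zero), so k-separability of \<open>s \<circ> \<phi>^(n)\<close> is understood up to normalization.\<close>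

definition k_separable :: "nat \<Rightarrow> nat \<Rightarrow> nat \<Rightarrow> (complex mat mat \<Rightarrow> complex) \<Rightarrow> bool" where
  "k_separable n m k s \<longleftrightarrow> positive_functional n m s \<and> schmidt_number n m (density_mat n m s) \<le> k"

definition k_PEB :: "nat \<Rightarrow> nat \<Rightarrow> nat \<Rightarrow> (complex mat \<Rightarrow> complex mat) \<Rightarrow> bool" where
  "k_PEB p m k \<phi> \<longleftrightarrow> \<phi> \<in> LinearCombinations.module_hom class_ring (mat_sys p) (mat_sys m) \<and>
     (\<forall>n>0. \<forall>s. is_state n m s \<longrightarrow> k_separable n p k (s \<circ> map_mat \<phi>))"

end

theory Submission
  imports "HOL-Analysis.Function_Topology" "HOL-Analysis.Topology_Euclidean_Space" Defs
begin

text \<open>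
  Everything is governed by one cone. Identify a linear map \<open>\<phi>\<close> with its Choi matrix
  \<open>(\<phi>(E_ab))\<close>, an operator on \<open>C^p \<otimes> C^m\<close>, and let \<open>K\<close> be the cone of finite sums of
  matrices \<open>U U\<^sup>*\<close> with \<open>U\<close> of Schmidt rank at most \<open>k\<close>. Each of the six conditions says that
  the Choi matrix of \<open>\<phi>\<close> lies in \<open>K\<close>.

  The conditions (iv) and (v) are readings of such a decomposition. A vector of
  \<open>C^p \<otimes> C^m\<close> is a \<open>p \<times> m\<close> matrix whose rank is its Schmidt rank; the vectors \<open>U_l\<close> are, up to
  conjugation, the Kraus matrices \<open>A_l\<close> of \<open>\<phi>\<close>, and a matrix of rank at most \<open>k\<close> factors
  through \<open>C^k\<close>. For (ii), the density matrix of \<open>s \<circ> \<phi>^(n)\<close> arises from that of \<open>s\<close> by applying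
  the Kraus matrices to one tensor factor, which cannot push the Schmidt rank above \<open>k\<close>;
  conversely the maximally entangled state returns the Choi matrix itself, flipped and scaled.

  The conditions with \<open>OMIN\<close> and \<open>OMAX\<close> rest on a description of the two cones. The cone of
  \<open>OMIN_k(M_p)\<close> consists of the block matrices whose quadratic form is nonnegative on vectors of
  Schmidt rank at most \<open>k\<close> (\<open>OMIN_mat_sys_iff\<close>): a \<open>k\<close>-positive map into \<open>M_k\<close> is completely positive,
  hence has a Kraus form, and the unital maps \<open>X \<mapsto> V\<^sup>* X V\<close> with \<open>V\<close> an isometry
  \<open>C^k \<rightarrow> C^p\<close> suffice to reach all these vectors because \<open>k \<le> p\<close>. The cone of \<open>OMAX_k(M_m)\<close> is the
  cone \<open>K\<close> at the respective level (\<open>OMAX_mat_sys_iff\<close>). Up to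
  transposition and interchange of the tensor factors the first cone is the dual of the second. So
  (i) says that the Choi matrix pairs nonnegatively with the dual of \<open>K\<close>, and the bipolar theorem puts
  it into \<open>K\<close>. Conversely, the Kraus matrices of a Choi matrix in \<open>K\<close> compress elements of the
  \<open>OMIN\<close> cone into the \<open>OMAX\<close> cone (\<open>compression_schmidt_cone\<close>), which is (vi) and implies (i) and (iii);
  and (iii) yields the Choi matrix as the image of a positive matrix.

  The bipolar theorem (\<open>rank_one_cone_bipolar\<close>) needs \<open>K\<close> to be closed. This is obtained as existence
  of nearest points: a Caratheodory argument bounds the number of terms of a sum, and vectors of
  Schmidt rank at most \<open>k\<close> and bounded size are the image of a compact set, since one of the two families
  in \<open>\<Sum> w_c \<otimes> e_c\<close> can be taken orthonormal and then bounds the other. The same closedness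
  absorbs the archimedeanization \<open>r(e \<otimes> I_n) + A\<close> in the definition of \<open>OMAX\<close>.

  Vectors and matrices are handled as functions on a finite index set; a block matrix in \<open>M_n(M_d)\<close>
  is a function of two indices from \<open>{..<n} \<times> {..<d}\<close>.
\<close>

section \<open>Linear systems and orthonormal families\<close>

text \<open>
  Elimination of one unknown with the help of one equation. Over the reals this supplies the linear
  relation of the Caratheodory argument, over the complex numbers the missing vectors of an
  orthonormal family.
\<close>

lemma homogeneous_system_nontrivial_solution:
  fixes M :: "'j \<Rightarrow> 'l \<Rightarrow> 'f::field"
  assumes "finite J" "finite L" "card J < card L"
  shows "\<exists>x. (\<exists>l\<in>L. x l \<noteq> 0) \<and> (\<forall>j\<in>J. (\<Sum>l\<in>L. M j l * x l) = 0)"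
  using assms
proof (induction J arbitrary: L M rule: finite_induct)
  case empty
  then have "L \<noteq> {}" by auto
  then show ?case by (intro exI[of _ "\<lambda>_. 1"]) auto
next
  case (insert j J)
  show ?case
  proof (cases "\<forall>l\<in>L. M j l = 0")
    case True
    from insert obtain x where "\<exists>l\<in>L. x l \<noteq> 0" "\<forall>i\<in>J. (\<Sum>l\<in>L. M i l * x l) = 0"
      using insert.IH[of L M] by force
    with True show ?thesis by (intro exI[of _ x]) auto
  next
    case False
    then obtain l0 where l0: "l0 \<in> L" "M j l0 \<noteq> 0" by auto
    \<comment> \<open>The system that remains after solving equation \<open>j\<close> for the unknown \<open>l0\<close>.\<close>
    define N where "N i l = M i l - M i l0 * M j l / M j l0" for i l
    have "card J < card (L - {l0})"
      using insert l0 by (simp add: card_insert_if)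
    then obtain x where x: "\<exists>l\<in>L-{l0}. x l \<noteq> 0" "\<forall>i\<in>J. (\<Sum>l\<in>L-{l0}. N i l * x l) = 0"
      using insert.IH[of "L - {l0}" N] insert.prems by auto
    define y where "y = x(l0 := - (\<Sum>l\<in>L-{l0}. M j l * x l) / M j l0)"
    have split: "(\<Sum>l\<in>L. M i l * y l) = M i l0 * y l0 + (\<Sum>l\<in>L-{l0}. M i l * x l)" for i
    proof -
      have "(\<Sum>l\<in>L-{l0}. M i l * y l) = (\<Sum>l\<in>L-{l0}. M i l * x l)"
        by (intro sum.cong) (auto simp: y_def)
      with sum.remove[OF insert.prems(1) l0(1), of "\<lambda>l. M i l * y l"] show ?thesis by simp
    qed
    have "(\<Sum>l\<in>L. M i l * y l) = 0" if "i \<in> J" for i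
    proof -
      have "(\<Sum>l\<in>L-{l0}. N i l * x l)
          = (\<Sum>l\<in>L-{l0}. M i l * x l) - M i l0 * (\<Sum>l\<in>L-{l0}. M j l * x l) / M j l0"
        by (simp add: N_def left_diff_distrib sum_subtractf sum_distrib_left sum_divide_distrib
            mult.assoc)
      with x(2) that show ?thesis
        by (simp add: split) (simp add: y_def)
    qed
    moreover have "(\<Sum>l\<in>L. M j l * y l) = 0"
      using l0 by (simp add: split) (simp add: y_def)
    moreover have "\<exists>l\<in>L. y l \<noteq> 0" using x(1) by (auto simp: y_def)
    ultimately show ?thesis by blast
  qed
qed

text \<open>
  Gram-Schmidt. A vector that depends on its predecessors is replaced by an arbitrary unit
  vector orthogonal to them, which exists as long as fewer than \<open>card I\<close> vectors have been chosen; so the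
  family always has exactly \<open>k\<close> members.
\<close>

lemma orthonormal_span:
  fixes u :: "nat \<Rightarrow> 'x \<Rightarrow> complex"
  assumes "finite I" "k \<le> card I"
  shows "\<exists>e. (\<forall>c<k. \<forall>c'<k. (\<Sum>x\<in>I. cnj (e c x) * e c' x) = (if c = c' then 1 else 0)) \<and>
             (\<forall>c<k. \<exists>s. \<forall>x\<in>I. u c x = (\<Sum>c'<k. s c' * e c' x))"
  using assms(2)
proof (induction k)
  case 0
  then show ?case by simp
next
  case (Suc k)
  then obtain e where
    on: "\<And>c c'. c < k \<Longrightarrow> c' < k \<Longrightarrow> (\<Sum>x\<in>I. cnj (e c x) * e c' x) = (if c = c' then 1 else 0)"
    and sp: "\<And>c. c < k \<Longrightarrow> \<exists>s. \<forall>x\<in>I. u c x = (\<Sum>c'<k. s c' * e c' x)"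
    by (auto simp: Suc_le_eq)
  define s where "s c = (\<Sum>x\<in>I. cnj (e c x) * u k x)" for c
  define r where "r x = u k x - (\<Sum>c<k. s c * e c x)" for x
  have r_orth: "(\<Sum>x\<in>I. cnj (e c x) * r x) = 0" if "c < k" for c
  proof -
    have "(\<Sum>x\<in>I. cnj (e c x) * (\<Sum>c'<k. s c' * e c' x))
        = (\<Sum>c'<k. s c' * (\<Sum>x\<in>I. cnj (e c x) * e c' x))"
      unfolding sum_distrib_left by (subst sum.swap) (simp add: mult.left_commute)
    also have "\<dots> = (\<Sum>c'<k. if c = c' then s c' else 0)"
      using that by (intro sum.cong) (auto simp: on)
    also have "\<dots> = s c" using that by simp
    finally show ?thesis
      by (simp add: r_def right_diff_distrib sum_subtractf s_def)
  qed
  obtain f t where f: "\<exists>x\<in>I. f x \<noteq> 0" "\<And>c. c < k \<Longrightarrow> (\<Sum>x\<in>I. cnj (e c x) * f x) = 0"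
    and uk: "\<And>x. x \<in> I \<Longrightarrow> u k x = (\<Sum>c<k. s c * e c x) + t * f x"
  proof (cases "\<forall>x\<in>I. r x = 0")
    case True
    obtain f where "\<exists>x\<in>I. f x \<noteq> 0" "\<forall>c\<in>{..<k}. (\<Sum>x\<in>I. cnj (e c x) * f x) = 0"
      using homogeneous_system_nontrivial_solution[of "{..<k}" I "\<lambda>c x. cnj (e c x)"]
        Suc.prems assms(1) by auto
    moreover have "u k x = (\<Sum>c<k. s c * e c x) + 0 * f x" if "x \<in> I" for x
      using True that by (simp add: r_def)
    ultimately show ?thesis using that[of f 0] by blast
  next
    case False
    have "u k x = (\<Sum>c<k. s c * e c x) + 1 * r x" for x by (simp add: r_def)
    with False r_orth show ?thesis using that[of r 1] by blast
  qed
  define N where "N = (\<Sum>x\<in>I. (cmod (f x))\<^sup>2)"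
  have N: "N > 0"
  proof -
    obtain x where "x \<in> I" "f x \<noteq> 0" using f(1) by blast
    then show ?thesis
      unfolding N_def using assms(1) by (intro sum_pos2[of I x]) auto
  qed
  define g where "g x = f x / complex_of_real (sqrt N)" for x
  have gg: "(\<Sum>x\<in>I. cnj (g x) * g x) = 1"
  proof -
    have "cnj (g x) * g x = complex_of_real ((cmod (f x))\<^sup>2 / N)" for x
    proof -
      have "cnj (g x) * g x = complex_of_real ((cmod (g x))\<^sup>2)"
        by (simp only: complex_norm_square mult.commute)
      also have "(cmod (g x))\<^sup>2 = (cmod (f x))\<^sup>2 / N"
        using N by (simp add: g_def norm_divide power_divide)
      finally show ?thesis .
    qed
    then have "(\<Sum>x\<in>I. cnj (g x) * g x) = complex_of_real ((\<Sum>x\<in>I. (cmod (f x))\<^sup>2) / N)"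
      by (simp add: sum_divide_distrib)
    then show ?thesis using N by (simp add: N_def)
  qed
  have eg: "(\<Sum>x\<in>I. cnj (e c x) * g x) = 0" if "c < k" for c
    using f(2)[OF that] by (simp add: g_def flip: sum_divide_distrib)
  have ge: "(\<Sum>x\<in>I. cnj (g x) * e c x) = 0" if "c < k" for c
    using arg_cong[OF eg[OF that], of cnj] by (simp add: mult.commute)
  define e' where "e' = e(k := g)"
  have "(\<Sum>x\<in>I. cnj (e' c x) * e' c' x) = (if c = c' then 1 else 0)"
    if "c < Suc k" "c' < Suc k" for c c'
    using that on[of c c'] gg eg ge by (auto simp: e'_def less_Suc_eq)
  moreover have "\<exists>s. \<forall>x\<in>I. u c x = (\<Sum>c'<Suc k. s c' * e' c' x)" if "c < Suc k" for c
  proof (cases "c = k")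
    case True
    have "\<forall>x\<in>I. u c x = (\<Sum>c'<Suc k. (s(k := t * complex_of_real (sqrt N))) c' * e' c' x)"
      using N by (auto simp: True uk e'_def g_def)
    then show ?thesis by blast
  next
    case False
    with that sp obtain s' where "\<forall>x\<in>I. u c x = (\<Sum>c'<k. s' c' * e c' x)"
      by (metis less_Suc_eq)
    then have "\<forall>x\<in>I. u c x = (\<Sum>c'<Suc k. (s'(k := 0)) c' * e' c' x)"
      by (auto simp: e'_def)
    then show ?thesis by blast
  qed
  ultimately show ?case by blast
qed

section \<open>Quadratic forms and cones of rank one matrices\<close>

definition qform :: "'x set \<Rightarrow> ('x \<Rightarrow> 'x \<Rightarrow> complex) \<Rightarrow> ('x \<Rightarrow> complex) \<Rightarrow> complex" where
  "qform I H U = (\<Sum>x\<in>I. \<Sum>y\<in>I. cnj (U x) * H x y * U y)"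

text \<open>
  Only the values on \<open>I \<times> I\<close> are constrained, so membership is a property of the matrix and not of
  the function that represents it.
\<close>

definition rank_one_cone :: "'x set \<Rightarrow> ('x \<Rightarrow> complex) set \<Rightarrow> ('x \<Rightarrow> 'x \<Rightarrow> complex) set" where
  "rank_one_cone I T = {H. \<exists>(r::nat) U. (\<forall>l<r. U l \<in> T) \<and>
     (\<forall>x\<in>I. \<forall>y\<in>I. H x y = (\<Sum>l<r. U l x * cnj (U l y)))}"

lemma rank_one_coneI:
  fixes r :: nat
  assumes "\<And>l. l < r \<Longrightarrow> U l \<in> T"
    and "\<And>x y. x \<in> I \<Longrightarrow> y \<in> I \<Longrightarrow> H x y = (\<Sum>l<r. U l x * cnj (U l y))"
  shows "H \<in> rank_one_cone I T"
  unfolding rank_one_cone_def using assms by (intro CollectI exI[of _ r] exI[of _ U]) simp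

lemma rank_one_coneE:
  assumes "H \<in> rank_one_cone I T"
  obtains r :: nat and U where "\<And>l. l < r \<Longrightarrow> U l \<in> T"
    and "\<And>x y. x \<in> I \<Longrightarrow> y \<in> I \<Longrightarrow> H x y = (\<Sum>l<r. U l x * cnj (U l y))"
proof -
  from assms obtain r :: nat and U where *: "(\<forall>l<r. U l \<in> T) \<and>
     (\<forall>x\<in>I. \<forall>y\<in>I. H x y = (\<Sum>l<r. U l x * cnj (U l y)))"
    unfolding rank_one_cone_def by (elim CollectE exE) (rule that)
  show thesis by (rule that[of r U]) (use * in simp_all)
qed

lemma qform_cong:
  assumes "\<And>x y. x \<in> I \<Longrightarrow> y \<in> I \<Longrightarrow> G x y = H x y" "\<And>x. x \<in> I \<Longrightarrow> U x = V x"
  shows "qform I G U = qform I H V"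
  unfolding qform_def using assms by (auto intro!: sum.cong)

lemma qform_rank_one:
  "qform I (\<lambda>x y. V x * cnj (V y)) U = complex_of_real ((cmod (\<Sum>x\<in>I. cnj (V x) * U x))\<^sup>2)"
proof -
  have "qform I (\<lambda>x y. V x * cnj (V y)) U
      = cnj (\<Sum>x\<in>I. cnj (V x) * U x) * (\<Sum>y\<in>I. cnj (V y) * U y)"
    unfolding qform_def cnj_sum sum_product by (intro sum.cong) (auto simp: mult_ac)
  then show ?thesis by (simp only: complex_norm_square mult.commute)
qed

lemma qform_sum: "qform I (\<lambda>x y. \<Sum>l\<in>L. H l x y) U = (\<Sum>l\<in>L. qform I (H l) U)"
proof -
  have "qform I (\<lambda>x y. \<Sum>l\<in>L. H l x y) U = (\<Sum>x\<in>I. \<Sum>y\<in>I. \<Sum>l\<in>L. cnj (U x) * H l x y * U y)"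
    by (simp add: qform_def sum_distrib_left sum_distrib_right)
  also have "\<dots> = (\<Sum>x\<in>I. \<Sum>l\<in>L. \<Sum>y\<in>I. cnj (U x) * H l x y * U y)"
    by (intro sum.cong refl sum.swap)
  also have "\<dots> = (\<Sum>l\<in>L. \<Sum>x\<in>I. \<Sum>y\<in>I. cnj (U x) * H l x y * U y)"
    by (rule sum.swap)
  finally show ?thesis by (simp add: qform_def)
qed

lemma rank_one_cone_cong:
  assumes "G \<in> rank_one_cone I T" "\<And>x y. x \<in> I \<Longrightarrow> y \<in> I \<Longrightarrow> H x y = G x y"
  shows "H \<in> rank_one_cone I T"
proof -
  obtain r :: nat and U where "\<And>l. l < r \<Longrightarrow> U l \<in> T"
    "\<And>x y. x \<in> I \<Longrightarrow> y \<in> I \<Longrightarrow> G x y = (\<Sum>l<r. U l x * cnj (U l y))"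
    by (rule rank_one_coneE[OF assms(1)]) (rule that)
  with assms(2) show ?thesis by (intro rank_one_coneI[of r U]) simp_all
qed

lemma rank_one_cone_add:
  assumes "G \<in> rank_one_cone I T" "H \<in> rank_one_cone I T"
  shows "(\<lambda>x y. G x y + H x y) \<in> rank_one_cone I T"
proof -
  obtain r :: nat and U where U: "\<And>l. l < r \<Longrightarrow> U l \<in> T"
    "\<And>x y. x \<in> I \<Longrightarrow> y \<in> I \<Longrightarrow> G x y = (\<Sum>l<r. U l x * cnj (U l y))"
    by (rule rank_one_coneE[OF assms(1)]) (rule that)
  obtain s :: nat and V where V: "\<And>l. l < s \<Longrightarrow> V l \<in> T"
    "\<And>x y. x \<in> I \<Longrightarrow> y \<in> I \<Longrightarrow> H x y = (\<Sum>l<s. V l x * cnj (V l y))"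
    by (rule rank_one_coneE[OF assms(2)]) (rule that)
  define W where "W l = (if l < r then U l else V (l - r))" for l
  have "(\<Sum>l<r+s. W l x * cnj (W l y)) = (\<Sum>l<r. U l x * cnj (U l y)) + (\<Sum>l<s. V l x * cnj (V l y))" for x y
  proof -
    have "(\<Sum>l<r+s. W l x * cnj (W l y))
        = (\<Sum>l<r. W l x * cnj (W l y)) + (\<Sum>l<s. W (r + l) x * cnj (W (r + l) y))"
      by (induction s) (auto simp: add.assoc)
    then show ?thesis by (simp add: W_def)
  qed
  then show ?thesis using U V by (intro rank_one_coneI[of "r + s" W]) (auto simp: W_def)
qed

lemma rank_one_cone_sum:
  assumes "\<And>l. l \<in> L \<Longrightarrow> H l \<in> rank_one_cone I T"
  shows "(\<lambda>x y. \<Sum>l\<in>L. H l x y) \<in> rank_one_cone I T"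
proof -
  have zero: "(\<lambda>x y. 0) \<in> rank_one_cone I T"
    by (rule rank_one_coneI[of 0]) simp_all
  show ?thesis
  proof (cases "finite L")
    case True
    then show ?thesis using assms
      by (induction L rule: finite_induct) (auto simp: zero intro!: rank_one_cone_add)
  qed (simp add: zero)
qed

lemma rank_one_mem_cone:
  assumes "U \<in> T"
  shows "(\<lambda>x y. U x * cnj (U y)) \<in> rank_one_cone I T"
  using assms by (intro rank_one_coneI[of 1 "\<lambda>_. U"]) simp_all

lemma rank_one_cone_scale:
  assumes "H \<in> rank_one_cone I T" "0 \<le> c"
    and scale: "\<And>U c. U \<in> T \<Longrightarrow> 0 \<le> c \<Longrightarrow> (\<lambda>x. complex_of_real c * U x) \<in> T"
  shows "(\<lambda>x y. complex_of_real c * H x y) \<in> rank_one_cone I T"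
proof -
  obtain r :: nat and U where U: "\<And>l. l < r \<Longrightarrow> U l \<in> T"
    "\<And>x y. x \<in> I \<Longrightarrow> y \<in> I \<Longrightarrow> H x y = (\<Sum>l<r. U l x * cnj (U l y))"
    by (rule rank_one_coneE[OF assms(1)]) (rule that)
  have cc: "complex_of_real (sqrt c) * complex_of_real (sqrt c) = complex_of_real c"
    using assms(2) by (simp flip: of_real_mult)
  have "(complex_of_real (sqrt c) * U l x) * cnj (complex_of_real (sqrt c) * U l y)
      = complex_of_real c * (U l x * cnj (U l y))" for l x y
    by (simp add: mult_ac flip: cc)
  then have "complex_of_real c * H x y = (\<Sum>l<r. (complex_of_real (sqrt c) * U l x) *
      cnj (complex_of_real (sqrt c) * U l y))" if "x \<in> I" "y \<in> I" for x y
    by (simp only: U(2)[OF that] sum_distrib_left)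
  then show ?thesis using U(1) scale assms(2)
    by (intro rank_one_coneI[of r "\<lambda>l x. complex_of_real (sqrt c) * U l x"]) auto
qed

lemma qform_nonneg_of_rank_one_cone:
  assumes "H \<in> rank_one_cone I T"
  shows "0 \<le> qform I H U"
proof -
  obtain r :: nat and V where V: "\<And>x y. x \<in> I \<Longrightarrow> y \<in> I \<Longrightarrow> H x y = (\<Sum>l<r. V l x * cnj (V l y))"
    using assms by (auto simp: rank_one_cone_def)
  have "qform I H U = (\<Sum>l<r. qform I (\<lambda>x y. V l x * cnj (V l y)) U)"
    by (simp add: V qform_sum flip: qform_sum cong: qform_cong)
  also have "\<dots> \<ge> 0" by (intro sum_nonneg) (simp add: qform_rank_one less_eq_complex_def)
  finally show ?thesis .
qed

text \<open>
  The trivial half of duality: pairing \<open>G\<close> with \<open>U U\<^sup>*\<close> gives the value of the form of \<open>G\<close> at \<open>U\<close>.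
\<close>

lemma rank_one_cone_pairing:
  assumes P: "P \<in> rank_one_cone I T" and G: "\<And>U. U \<in> T \<Longrightarrow> 0 \<le> qform I G U"
  shows "0 \<le> Re (\<Sum>x\<in>I. \<Sum>y\<in>I. G x y * P y x)"
proof -
  obtain r :: nat and U where U: "\<And>l. l < r \<Longrightarrow> U l \<in> T"
    "\<And>x y. x \<in> I \<Longrightarrow> y \<in> I \<Longrightarrow> P x y = (\<Sum>l<r. U l x * cnj (U l y))"
    by (rule rank_one_coneE[OF P]) (rule that)
  have "(\<Sum>x\<in>I. \<Sum>y\<in>I. G x y * P y x) = (\<Sum>x\<in>I. \<Sum>y\<in>I. \<Sum>l<r. cnj (U l x) * G x y * U l y)"
    by (simp add: U(2) sum_distrib_left mult_ac)
  also have "\<dots> = (\<Sum>l<r. qform I G (U l))"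
    unfolding qform_def sum.cartesian_product
    by (rule sum.reindex_bij_witness[of _ "\<lambda>(l, x, y). (x, y, l)" "\<lambda>(x, y, l). (l, x, y)"]) auto
  finally show ?thesis
    using G U(1) by (auto simp: less_eq_complex_def intro!: sum_nonneg)
qed

lemma qform_two_point:
  assumes "finite I" "x \<in> I" "y \<in> I" "x \<noteq> y"
  shows "qform I H (\<lambda>z. if z = x then a else if z = y then b else 0)
    = cnj a * H x x * a + cnj a * H x y * b + cnj b * H y x * a + cnj b * H y y * b"
proof -
  let ?U = "\<lambda>z. if z = x then a else if z = y then b else 0"
  have *: "(\<Sum>z\<in>I. f z) = f x + f y" if "\<And>z. z \<noteq> x \<Longrightarrow> z \<noteq> y \<Longrightarrow> f z = 0" for f :: "_ \<Rightarrow> complex"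
  proof -
    have "(\<Sum>z\<in>I. f z) = (\<Sum>z\<in>{x, y}. f z)"
      using assms that by (intro sum.mono_neutral_right) auto
    then show ?thesis using assms(4) by simp
  qed
  have "qform I H ?U = (\<Sum>z\<in>I. cnj (?U z) * H z x * ?U x + cnj (?U z) * H z y * ?U y)"
    unfolding qform_def by (intro sum.cong refl *) simp
  also have "\<dots> = (cnj (?U x) * H x x * ?U x + cnj (?U x) * H x y * ?U y)
     + (cnj (?U y) * H y x * ?U x + cnj (?U y) * H y y * ?U y)"
    by (rule *) simp
  finally show ?thesis using assms(4) by simp
qed

text \<open>
  Polarization: the form takes real values at \<open>e_x + e_y\<close> and at \<open>e_x + \<i> e_y\<close>.
\<close>

lemma hermitian_of_qform_nonneg:
  assumes "finite I" and pos: "\<And>U. 0 \<le> qform I H U" and "x \<in> I" "y \<in> I"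
  shows "H y x = cnj (H x y)"
proof -
  have diag: "Im (H z z) = 0" if "z \<in> I" for z
  proof -
    have "qform I H (\<lambda>w. if w = z then 1 else 0) = (\<Sum>x\<in>I. if x = z then H z z else 0)"
      unfolding qform_def using that assms(1) by (intro sum.cong) (auto simp: if_distrib cong: if_cong)
    also have "\<dots> = H z z" using that assms(1) by simp
    finally show ?thesis using pos by (metis less_eq_complex_def zero_complex.simps(2))
  qed
  show ?thesis
  proof (cases "x = y")
    case True
    then show ?thesis using diag[OF assms(3)] by (simp add: complex_eq_iff)
  next
    case False
    note two = qform_two_point[OF assms(1,3,4) False, of H]
    have "Im (H x y + H y x) = 0"
      using pos[of "\<lambda>z. if z = x then 1 else if z = y then 1 else 0"] diag assms(3,4)
      by (simp add: two less_eq_complex_def)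
    moreover have "Re (H x y - H y x) = 0"
      using pos[of "\<lambda>z. if z = x then 1 else if z = y then \<i> else 0"] diag assms(3,4)
      by (simp add: two less_eq_complex_def)
    ultimately show ?thesis by (simp add: complex_eq_iff)
  qed
qed

text \<open>
  Otherwise the form would be negative at \<open>e_y - t (H x y) e_x\<close> for large \<open>t\<close>, as it is affine in \<open>t\<close>.
\<close>

lemma zero_row_of_zero_diagonal:
  assumes "finite I" and pos: "\<And>U. 0 \<le> qform I H U" and "x \<in> I" "y \<in> I" "H x x = 0"
  shows "H x y = 0"
proof (rule ccontr)
  assume nz: "H x y \<noteq> 0"
  with assms have "x \<noteq> y" by auto
  define h where "h = (cmod (H x y))\<^sup>2"
  have h: "h > 0" using nz by (simp add: h_def)
  have h_Re_Im: "h = Re (H x y) * Re (H x y) + Im (H x y) * Im (H x y)"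
    unfolding h_def cmod_power2 by (simp add: power2_eq_square)
  \<comment> \<open>At this parameter the form has the value \<open>-1\<close>.\<close>
  define t where "t = (Re (H y y) + 1) / (2 * h)"
  have herm: "H y x = cnj (H x y)" by (rule hermitian_of_qform_nonneg[OF assms(1-4)])
  have "0 \<le> Re (qform I H (\<lambda>z. if z = x then - complex_of_real t * H x y else if z = y then 1 else 0))"
    using pos by (simp add: less_eq_complex_def)
  also have "\<dots> = Re (H y y) - 2 * t * h"
    unfolding qform_two_point[OF assms(1,3,4) \<open>x \<noteq> y\<close>]
    by (simp add: assms(5) herm h_Re_Im algebra_simps)
  also have "\<dots> = -1" using h by (simp add: t_def field_simps)
  finally show False by simp
qed

text \<open>
  Cholesky decomposition. Splitting off \<open>V V\<^sup>*\<close>, where \<open>V\<close> is the normalized column of \<open>x\<close>, clears the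
  row and the column of \<open>x\<close> and leaves a Schur complement that is again positive semidefinite.
\<close>

lemma psd_imp_rank_one_cone:
  assumes "finite I" and pos: "\<And>U. 0 \<le> qform I H U"
  shows "H \<in> rank_one_cone I UNIV"
  using assms
proof (induction I arbitrary: H rule: finite_induct)
  case empty
  show ?case by (auto simp: rank_one_cone_def)
next
  case (insert x I)
  let ?I = "insert x I"
  have fin: "finite ?I" using insert.hyps by simp
  note herm = hermitian_of_qform_nonneg[OF fin insert.prems]
  define h where "h = Re (H x x)"
  have Hxx: "H x x = complex_of_real h"
    using herm[of x x] by (simp add: h_def complex_eq_iff)
  have h0: "h \<ge> 0"
  proof -
    have "qform ?I H (\<lambda>z. if z = x then 1 else 0) = (\<Sum>z\<in>?I. if z = x then H x x else 0)"
      unfolding qform_def using fin by (intro sum.cong) (auto simp: if_distrib cong: if_cong)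
    also have "\<dots> = H x x" using fin by simp
    finally show ?thesis using insert.prems[of "\<lambda>z. if z = x then 1 else 0"]
      by (simp add: h_def less_eq_complex_def)
  qed
  \<comment> \<open>If the diagonal entry vanishes, so does the whole column, and nothing has to be split off.\<close>
  define V where "V y = (if h = 0 then 0 else H y x / complex_of_real (sqrt h))" for y
  have col: "H y x = V y * cnj (V x)" if "y \<in> ?I" for y
  proof (cases "h = 0")
    case True
    then have "H x y = 0"
      using zero_row_of_zero_diagonal[OF fin insert.prems, of x y] that Hxx by simp
    then show ?thesis using herm[of x y] that True by (simp add: V_def)
  next
    case False
    have "complex_of_real (sqrt h) * complex_of_real (sqrt h) = complex_of_real h"
      using h0 by (simp flip: of_real_mult)
    then show ?thesis using False by (simp add: V_def Hxx)
  qed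
  have row: "H x y = V x * cnj (V y)" if "y \<in> ?I" for y
    using col[OF that] herm[of y x] that by (simp add: mult.commute)
  define G where "G y z = H y z - V y * cnj (V z)" for y z
  have "0 \<le> qform I G U" for U
  proof -
    define b where "b = (\<Sum>y\<in>I. cnj (V y) * U y)"
    \<comment> \<open>The value at \<open>x\<close> is chosen so that the extended vector is orthogonal to \<open>V\<close>.\<close>
    define W where "W = U(x := (if h = 0 then 0 else - b / cnj (V x)))"
    have Vx: "V x \<noteq> 0" if "h \<noteq> 0"
      using that by (simp add: V_def Hxx)
    have V0: "V y = 0" if "h = 0" for y using that by (simp add: V_def)
    have WI: "W y = U y" if "y \<in> I" for y using that insert.hyps by (auto simp: W_def)
    have orth: "(\<Sum>y\<in>?I. cnj (V y) * W y) = 0"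
    proof -
      have "(\<Sum>y\<in>?I. cnj (V y) * W y) = cnj (V x) * W x + b"
        using insert.hyps by (simp add: b_def WI)
      then show ?thesis using Vx by (cases "h = 0") (auto simp: W_def b_def V0)
    qed
    have "qform ?I H W = qform ?I (\<lambda>y z. G y z + V y * cnj (V z)) W"
      by (simp add: G_def)
    also have "\<dots> = qform ?I G W + qform ?I (\<lambda>y z. V y * cnj (V z)) W"
      by (simp add: qform_def algebra_simps sum.distrib)
    also have "qform ?I (\<lambda>y z. V y * cnj (V z)) W = 0"
      by (simp add: qform_rank_one orth)
    also have "qform ?I G W = qform I G W"
      using insert.hyps col row by (simp add: qform_def G_def)
    also have "\<dots> = qform I G U" by (intro qform_cong) (auto simp: WI)
    finally show ?thesis using insert.prems[of W] by simp
  qed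
  from insert.IH[OF this] obtain r :: nat and Z where
    Z: "\<And>y z. y \<in> I \<Longrightarrow> z \<in> I \<Longrightarrow> G y z = (\<Sum>l<r. Z l y * cnj (Z l z))"
    by (rule rank_one_coneE) (rule that)
  define Z' where "Z' l = (if l < r then (Z l)(x := 0) else V)" for l
  have "H y z = (\<Sum>l<Suc r. Z' l y * cnj (Z' l z))" if "y \<in> ?I" "z \<in> ?I" for y z
  proof (cases "y = x \<or> z = x")
    case True
    then show ?thesis using row col that by (auto simp: Z'_def)
  next
    case False
    with that Z[of y z] show ?thesis by (simp add: Z'_def G_def algebra_simps)
  qed
  then show ?case by (intro rank_one_coneI[of "Suc r" Z']) simp_all
qed

section \<open>Closedness and duality of cones of rank one matrices\<close>

text \<open>
  Matrices on \<open>I\<close> have \<open>2 (card I)^2\<close> real coordinates. Among more terms than that there is a real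
  linear relation; moving along it while all weights stay nonnegative makes one weight vanish.
\<close>

lemma caratheodory_rank_one_cone:
  assumes "finite I" and "H \<in> rank_one_cone I T" and zero: "(\<lambda>_. 0) \<in> T"
    and scale: "\<And>U c. U \<in> T \<Longrightarrow> 0 \<le> c \<Longrightarrow> (\<lambda>x. complex_of_real c * U x) \<in> T"
  shows "\<exists>U. (\<forall>l<2 * (card I)\<^sup>2. U l \<in> T) \<and>
     (\<forall>x\<in>I. \<forall>y\<in>I. H x y = (\<Sum>l<2 * (card I)\<^sup>2. U l x * cnj (U l y)))"
proof -
  define N where "N = 2 * (card I)\<^sup>2"
  define P where "P r \<longleftrightarrow> (\<exists>U. (\<forall>l<r. U l \<in> T) \<and>
     (\<forall>x\<in>I. \<forall>y\<in>I. H x y = (\<Sum>l<r. U l x * cnj (U l y))))" for r :: nat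
  have reduce: "P r" if Pr: "P (Suc r)" and Nr: "N < Suc r" for r
  proof -
    obtain U where UT: "\<And>l. l < Suc r \<Longrightarrow> U l \<in> T" and
      U: "\<And>x y. x \<in> I \<Longrightarrow> y \<in> I \<Longrightarrow> H x y = (\<Sum>l<Suc r. U l x * cnj (U l y))"
      using Pr unfolding P_def by blast
    \<comment> \<open>The real coordinates of a matrix: real and imaginary part of each entry.\<close>
    define J where "J = (I \<times> I) \<times> {False, True}"
    define M where "M j l = (case j of ((x, y), b) \<Rightarrow>
       (if b then Re else Im) (U l x * cnj (U l y)))" for j l
    have "finite J" "card J < card {..<Suc r}"
      using assms(1) Nr by (simp_all add: J_def card_cartesian_product N_def power2_eq_square)
    then obtain a where a: "\<exists>l\<in>{..<Suc r}. a l \<noteq> 0" "\<forall>j\<in>J. (\<Sum>l<Suc r. M j l * a l) = 0"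
      using homogeneous_system_nontrivial_solution[of J "{..<Suc r}" M] by auto
    obtain b where b: "\<exists>l<Suc r. b l > (0::real)" "\<forall>j\<in>J. (\<Sum>l<Suc r. M j l * b l) = 0"
    proof (cases "\<exists>l<Suc r. a l > 0")
      case True
      with a that[of a] show ?thesis by blast
    next
      case False
      with a(1) have "\<exists>l<Suc r. - a l > 0" by force
      moreover have "\<forall>j\<in>J. (\<Sum>l<Suc r. M j l * - a l) = 0"
        using a(2) by (simp add: sum_negf)
      ultimately show ?thesis using that[of "\<lambda>l. - a l"] by blast
    qed
    obtain l0 where l0: "l0 < Suc r" "\<And>l. l < Suc r \<Longrightarrow> b l \<le> b l0"
    proof -
      have fin: "finite (b ` {..<Suc r})" and ne: "b ` {..<Suc r} \<noteq> {}" by auto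
      obtain l0 where "l0 < Suc r" "Max (b ` {..<Suc r}) = b l0" using Max_in[OF fin ne] by blast
      with Max_ge[OF fin] show ?thesis by (intro that[of l0]) simp_all
    qed
    have bl0: "b l0 > 0" using b(1) l0(2) by (meson less_le_trans)
    \<comment> \<open>The new weights: nonnegative since \<open>b l0\<close> is maximal, and zero at \<open>l0\<close>.\<close>
    define t where "t l = 1 - b l / b l0" for l
    have t0: "t l \<ge> 0" if "l < Suc r" for l
      using l0(2)[OF that] bl0 by (simp add: t_def)
    define W where "W l x = complex_of_real (sqrt (t l)) * U l x" for l x
    have WT: "W l \<in> T" if "l < Suc r" for l
      using scale[OF UT[OF that], of "sqrt (t l)"] t0[OF that] by (simp add: W_def[abs_def])
    have W: "H x y = (\<Sum>l<Suc r. W l x * cnj (W l y))" if "x \<in> I" "y \<in> I" for x y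
    proof -
      have re: "(\<Sum>l<Suc r. Re (U l x * cnj (U l y)) * b l) = 0"
        using b(2)[rule_format, of "((x, y), True)"] that by (simp add: J_def M_def)
      have im: "(\<Sum>l<Suc r. Im (U l x * cnj (U l y)) * b l) = 0"
        using b(2)[rule_format, of "((x, y), False)"] that by (simp add: J_def M_def)
      have "(\<Sum>l<Suc r. complex_of_real (b l) * (U l x * cnj (U l y))) = 0"
        unfolding complex_eq_iff Re_sum Im_sum using re im
        by (simp add: mult.commute del: sum.lessThan_Suc)
      then have z: "(\<Sum>l<Suc r. complex_of_real (b l) * (U l x * cnj (U l y)) / complex_of_real (b l0)) = 0"
        unfolding sum_divide_distrib[symmetric] by simp
      have "W l x * cnj (W l y) = U l x * cnj (U l y)
          - complex_of_real (b l) * (U l x * cnj (U l y)) / complex_of_real (b l0)"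
        if "l < Suc r" for l
      proof -
        have "complex_of_real (sqrt (t l)) * complex_of_real (sqrt (t l)) = complex_of_real (t l)"
          using t0[OF that] by (simp flip: of_real_mult)
        then have "W l x * cnj (W l y) = complex_of_real (t l) * (U l x * cnj (U l y))"
          by (simp add: W_def mult.assoc mult.left_commute)
        then show ?thesis by (simp add: t_def left_diff_distrib)
      qed
      then have "(\<Sum>l<Suc r. W l x * cnj (W l y)) = (\<Sum>l<Suc r. U l x * cnj (U l y)
          - complex_of_real (b l) * (U l x * cnj (U l y)) / complex_of_real (b l0))"
        by (intro sum.cong) auto
      also have "\<dots> = H x y" unfolding sum_subtractf z U[OF that] by simp
      finally show ?thesis ..
    qed
    have W0: "W l0 x = 0" for x using bl0 by (simp add: W_def t_def)
    define W' where "W' = W(l0 := W r)"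
    have "W' l \<in> T" if "l < r" for l using WT[of l] WT[of r] that by (simp add: W'_def)
    moreover have "H x y = (\<Sum>l<r. W' l x * cnj (W' l y))" if "x \<in> I" "y \<in> I" for x y
    proof (cases "l0 = r")
      case True
      then show ?thesis unfolding W[OF that] using W0 by (simp add: W'_def)
    next
      case False
      with l0(1) have "l0 < r" by simp
      then have "(\<Sum>l<r. W' l x * cnj (W' l y))
         = W' l0 x * cnj (W' l0 y) + (\<Sum>l\<in>{..<r}-{l0}. W' l x * cnj (W' l y))"
        by (simp add: sum.remove)
      also have "(\<Sum>l\<in>{..<r}-{l0}. W' l x * cnj (W' l y)) = (\<Sum>l\<in>{..<r}-{l0}. W l x * cnj (W l y))"
        by (intro sum.cong) (auto simp: W'_def)
      also have "\<dots> = (\<Sum>l<r. W l x * cnj (W l y))"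
        using \<open>l0 < r\<close> by (simp add: sum.remove[of _ l0] W0)
      finally show ?thesis unfolding W[OF that] by (simp add: W'_def)
    qed
    ultimately show ?thesis unfolding P_def by (intro exI[of _ W']) simp
  qed
  have "\<exists>r. P r" using assms(2) unfolding rank_one_cone_def P_def by (rule CollectD)
  then have "P (LEAST r. P r)" by (rule LeastI_ex)
  moreover have "(LEAST r. P r) \<le> N"
  proof (rule ccontr)
    assume "\<not> (LEAST r. P r) \<le> N"
    then obtain r where r: "(LEAST r. P r) = Suc r" "N < Suc r"
      by (cases "LEAST r. P r") auto
    with reduce[of r] \<open>P (LEAST r. P r)\<close> have "P r" by simp
    with r Least_le[of P r] show False by simp
  qed
  ultimately obtain r where "P r" and r: "r \<le> N" by blast
  from \<open>P r\<close> obtain U where UT: "\<And>l. l < r \<Longrightarrow> U l \<in> T" and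
      U: "\<And>x y. x \<in> I \<Longrightarrow> y \<in> I \<Longrightarrow> H x y = (\<Sum>l<r. U l x * cnj (U l y))"
    unfolding P_def by blast
  define V where "V l = (if l < r then U l else (\<lambda>_. 0))" for l
  have "(\<Sum>l<N. V l x * cnj (V l y)) = (\<Sum>l<r. U l x * cnj (U l y))" for x y
    using r by (intro sum.mono_neutral_cong_right) (auto simp: V_def)
  then show ?thesis using UT U zero unfolding N_def[symmetric]
    by (intro exI[of _ V]) (auto simp: V_def)
qed

text \<open>
  A substitute for closedness of \<open>T\<close> which is easy to establish for sets given by a parametrization:
  the bounded members of \<open>T\<close> need not form a compact set, but they are contained, up to their values
  outside \<open>I\<close>, in a compact subset of \<open>T\<close>.
\<close>

definition compactly_parametrized :: "'x set \<Rightarrow> ('x \<Rightarrow> complex) set \<Rightarrow> bool" where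
  "compactly_parametrized I T \<longleftrightarrow> (\<forall>B. \<exists>S. compact S \<and> S \<subseteq> T \<and>
     (\<forall>U\<in>T. (\<forall>x\<in>I. cmod (U x) \<le> B) \<longrightarrow> (\<exists>V\<in>S. \<forall>x\<in>I. V x = U x)))"

text \<open>
  The squared distance in the Hilbert-Schmidt norm.
\<close>

definition dist_sq :: "'x set \<Rightarrow> ('x \<Rightarrow> 'x \<Rightarrow> complex) \<Rightarrow> ('x \<Rightarrow> 'x \<Rightarrow> complex) \<Rightarrow> real" where
  "dist_sq I G H = (\<Sum>x\<in>I. \<Sum>y\<in>I. (cmod (G x y - H x y))\<^sup>2)"

lemma dist_sq_cong:
  assumes "\<And>x y. x \<in> I \<Longrightarrow> y \<in> I \<Longrightarrow> G x y = G' x y"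
  shows "dist_sq I G H = dist_sq I G' H"
  unfolding dist_sq_def using assms by (auto intro!: sum.cong)

lemma cmod_le_dist_sq:
  assumes "finite I" "x \<in> I" "y \<in> I"
  shows "cmod (G x y - H x y) \<le> sqrt (dist_sq I G H)"
proof -
  have "(cmod (G x y - H x y))\<^sup>2 \<le> (\<Sum>y\<in>I. (cmod (G x y - H x y))\<^sup>2)"
    using assms by (intro member_le_sum) auto
  also have "\<dots> \<le> dist_sq I G H"
    unfolding dist_sq_def using assms
    by (intro member_le_sum[of x I "\<lambda>x. \<Sum>y\<in>I. (cmod (G x y - H x y))\<^sup>2"]) (auto intro: sum_nonneg)
  finally show ?thesis by (simp add: real_le_rsqrt)
qed

lemma compact_PiE_UNIV:
  fixes S :: "'b::topological_space set"
  assumes "compact S"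
  shows "compact (PiE (UNIV :: 'a set) (\<lambda>_. S))"
proof -
  have "compactin (product_topology (\<lambda>_. euclidean) (UNIV :: 'a set)) (PiE UNIV (\<lambda>_. S))"
    using assms by (simp add: compactin_PiE)
  then show ?thesis by (simp add: euclidean_product_topology)
qed

text \<open>
  By the Caratheodory argument every member of the cone is a sum of a fixed number of terms. The
  diagonal of \<open>Q\<close> dominates the entries of the vectors that occur in \<open>Q\<close>, so only bounded vectors
  compete with the zero matrix for being near to \<open>H\<close>; these range over a compact space of families
  of vectors, on which the distance attains its minimum.
\<close>

lemma exists_nearest_point_rank_one_cone:
  assumes fin: "finite I" and zero: "(\<lambda>_. 0) \<in> T"
    and scale: "\<And>U c. U \<in> T \<Longrightarrow> 0 \<le> c \<Longrightarrow> (\<lambda>x. complex_of_real c * U x) \<in> T"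
    and comp: "compactly_parametrized I T"
  shows "\<exists>P\<in>rank_one_cone I T. \<forall>Q\<in>rank_one_cone I T. dist_sq I P H \<le> dist_sq I Q H"
proof -
  define N where "N = 2 * (card I)\<^sup>2"
  define X where "X U x y = (\<Sum>l<N. U l x * cnj (U l y))" for U :: "nat \<Rightarrow> 'a \<Rightarrow> complex" and x y
  define R where "R = dist_sq I (\<lambda>_ _. 0) H"
  \<comment> \<open>A point at least as near to \<open>H\<close> as \<open>0\<close> has entries of modulus at most \<open>2 sqrt R\<close>.\<close>
  define B where "B = sqrt (2 * sqrt R)"
  obtain S where S: "compact S" "S \<subseteq> T"
    "\<And>U. U \<in> T \<Longrightarrow> (\<forall>x\<in>I. cmod (U x) \<le> B) \<Longrightarrow> \<exists>V\<in>S. \<forall>x\<in>I. V x = U x"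
    using comp unfolding compactly_parametrized_def by metis
  define K where "K = PiE (UNIV :: nat set) (\<lambda>_. S)"
  have K: "compact K" unfolding K_def by (rule compact_PiE_UNIV[OF S(1)])
  have R0: "R \<ge> 0" unfolding R_def dist_sq_def by (intro sum_nonneg) auto
  then have B0: "B \<ge> 0" by (simp add: B_def)
  obtain z where z: "z \<in> S" "\<And>x. x \<in> I \<Longrightarrow> z x = 0" using S(3)[OF zero] B0 by auto
  have Kz: "(\<lambda>_. z) \<in> K" using z by (simp add: K_def PiE_def)
  have coord: "continuous_on K (\<lambda>U. U l x)" for l x
    by (rule continuous_on_product_then_coordinatewise[OF
        continuous_on_product_then_coordinatewise[OF continuous_on_id]])
  have "continuous_on K (\<lambda>U. dist_sq I (X U) H)"
    unfolding dist_sq_def X_def by (intro continuous_intros coord)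
  then obtain U0 where U0: "U0 \<in> K" "\<And>U. U \<in> K \<Longrightarrow> dist_sq I (X U0) H \<le> dist_sq I (X U) H"
    using continuous_attains_inf[OF K] Kz by blast
  have XK: "X U0 \<in> rank_one_cone I T"
    using U0(1) S(2) by (intro rank_one_coneI[of N U0]) (auto simp: K_def X_def)
  have "dist_sq I (X U0) H \<le> dist_sq I Q H" if Q: "Q \<in> rank_one_cone I T" for Q
  proof (cases "dist_sq I Q H \<le> R")
    case False
    have "dist_sq I (X U0) H \<le> dist_sq I (X (\<lambda>_. z)) H" by (rule U0(2)[OF Kz])
    also have "\<dots> = R" unfolding R_def by (intro dist_sq_cong) (simp add: X_def z)
    finally show ?thesis using False by simp
  next
    case True
    obtain U where U: "\<And>l. l < N \<Longrightarrow> U l \<in> T"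
      "\<And>x y. x \<in> I \<Longrightarrow> y \<in> I \<Longrightarrow> Q x y = X U x y"
      using caratheodory_rank_one_cone[OF fin Q zero scale] unfolding N_def X_def by blast
    have bound: "cmod (U l x) \<le> B" if "l < N" "x \<in> I" for l x
    proof -
      have "(cmod (U l x))\<^sup>2 \<le> (\<Sum>l<N. (cmod (U l x))\<^sup>2)"
        using that by (intro member_le_sum) auto
      also have "\<dots> = cmod (Q x x)"
      proof -
        have "Q x x = complex_of_real (\<Sum>l<N. (cmod (U l x))\<^sup>2)"
          unfolding U(2)[OF that(2) that(2)] X_def of_real_sum complex_norm_square ..
        then show ?thesis by (simp add: sum_nonneg del: of_real_sum)
      qed
      also have "\<dots> \<le> cmod (Q x x - H x x) + cmod (0 - H x x)"
        using norm_triangle_ineq4[of "Q x x - H x x" "0 - H x x"] by simp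
      also have "\<dots> \<le> sqrt R + sqrt R"
        using cmod_le_dist_sq[OF fin that(2) that(2), of Q H] True
          cmod_le_dist_sq[OF fin that(2) that(2), of "\<lambda>_ _. 0" H]
        unfolding R_def[symmetric] by (meson add_mono order_trans real_sqrt_le_mono)
      finally show ?thesis unfolding B_def by (intro real_le_rsqrt) simp
    qed
    have "\<forall>l. \<exists>v\<in>S. l < N \<longrightarrow> (\<forall>x\<in>I. v x = U l x)"
      using S(3)[OF U(1)] bound z(1) by metis
    then obtain V where V: "\<And>l. V l \<in> S" "\<And>l x. l < N \<Longrightarrow> x \<in> I \<Longrightarrow> V l x = U l x" by metis
    have "dist_sq I (X U0) H \<le> dist_sq I (X V) H"
      using V(1) by (intro U0(2)) (simp add: K_def PiE_def)
    also have "\<dots> = dist_sq I Q H"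
      by (intro dist_sq_cong) (simp add: U X_def V)
    finally show ?thesis .
  qed
  with XK show ?thesis by blast
qed

text \<open>
  The first order condition at a minimum: the derivative of the squared distance in an admissible
  direction \<open>Q\<close> is not negative.
\<close>

lemma dist_sq_variation:
  assumes "\<And>t. 0 < t \<Longrightarrow> t < 1 \<Longrightarrow>
      dist_sq I P H \<le> dist_sq I (\<lambda>x y. P x y + complex_of_real t * Q x y) H"
  shows "0 \<le> (\<Sum>x\<in>I. \<Sum>y\<in>I. Re ((P x y - H x y) * cnj (Q x y)))"
proof -
  define a where "a = (\<Sum>x\<in>I. \<Sum>y\<in>I. Re ((P x y - H x y) * cnj (Q x y)))"
  define b where "b = (\<Sum>x\<in>I. \<Sum>y\<in>I. (cmod (Q x y))\<^sup>2)"
  have b0: "b \<ge> 0" unfolding b_def by (intro sum_nonneg) auto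
  have expand: "(cmod (z + complex_of_real t * w))\<^sup>2
      = (cmod z)\<^sup>2 + (2 * t * Re (z * cnj w) + t\<^sup>2 * (cmod w)\<^sup>2)" for z w :: complex and t
    unfolding cmod_power2 by (simp add: power2_eq_square algebra_simps)
  have "dist_sq I (\<lambda>x y. P x y + complex_of_real t * Q x y) H
      = dist_sq I P H + (2 * t * a + t\<^sup>2 * b)" for t
    unfolding dist_sq_def a_def b_def sum_distrib_left sum.distrib[symmetric] expand[symmetric]
    by (simp add: algebra_simps)
  with assms have var: "0 \<le> 2 * t * a + t\<^sup>2 * b" if "0 < t" "t < 1" for t
    using that by fastforce
  have "0 \<le> a"
  proof (rule ccontr)
    assume a: "\<not> 0 \<le> a"
    define t where "t = min (1/2) (- a / (b + 1))"
    have t: "0 < t" "t < 1" using a b0 by (auto simp: t_def field_simps)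
    have "t * (b + 1) \<le> - a"
    proof -
      have "t \<le> - a / (b + 1)" by (simp add: t_def)
      then show ?thesis using b0 by (simp add: pos_le_divide_eq del: divide_minus_left)
    qed
    then have "t * b < - 2 * a" using a t b0 by (simp add: algebra_simps)
    then have "t * (2 * a + t * b) < 0" using t by (intro mult_pos_neg) auto
    with var[OF t] show False by (simp add: power2_eq_square algebra_simps)
  qed
  then show ?thesis by (simp add: a_def)
qed

text \<open>
  Let \<open>P\<close> be the point of the cone nearest to \<open>H\<close> and \<open>G = P - H\<close>. Varying \<open>P\<close> in the directions
  \<open>U U\<^sup>*\<close> shows that \<open>G\<close> is nonnegative on \<open>T\<close>, whence \<open>\<langle>G, H\<rangle> \<ge> 0\<close> by assumption, and
  shrinking \<open>P\<close> shows \<open>\<langle>G, P\<rangle> \<le> 0\<close>. Therefore \<open>\<langle>G, G\<rangle> \<le> 0\<close>.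
\<close>

lemma rank_one_cone_bipolar:
  assumes fin: "finite I" and zero: "(\<lambda>_. 0) \<in> T"
    and scale: "\<And>U c. U \<in> T \<Longrightarrow> 0 \<le> c \<Longrightarrow> (\<lambda>x. complex_of_real c * U x) \<in> T"
    and comp: "compactly_parametrized I T"
    and herm: "\<And>x y. x \<in> I \<Longrightarrow> y \<in> I \<Longrightarrow> H y x = cnj (H x y)"
    and dual: "\<And>G. (\<And>x y. x \<in> I \<Longrightarrow> y \<in> I \<Longrightarrow> G y x = cnj (G x y)) \<Longrightarrow>
        (\<And>U. U \<in> T \<Longrightarrow> 0 \<le> qform I G U) \<Longrightarrow> 0 \<le> Re (\<Sum>x\<in>I. \<Sum>y\<in>I. G x y * H y x)"
  shows "H \<in> rank_one_cone I T"
proof -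
  obtain P where P: "P \<in> rank_one_cone I T"
    "\<And>Q. Q \<in> rank_one_cone I T \<Longrightarrow> dist_sq I P H \<le> dist_sq I Q H"
    using exists_nearest_point_rank_one_cone[OF fin zero scale comp] by blast
  define G where "G x y = P x y - H x y" for x y
  have Pherm: "P y x = cnj (P x y)" if "x \<in> I" "y \<in> I" for x y
    using hermitian_of_qform_nonneg[OF fin qform_nonneg_of_rank_one_cone[OF P(1)] that] .
  have Gherm: "G y x = cnj (G x y)" if "x \<in> I" "y \<in> I" for x y
    using Pherm[OF that] herm[OF that] by (simp add: G_def)
  have "0 \<le> qform I G U" if "U \<in> T" for U
  proof -
    have "0 \<le> (\<Sum>x\<in>I. \<Sum>y\<in>I. Re ((P x y - H x y) * cnj (U x * cnj (U y))))"
      by (intro dist_sq_variation P(2) rank_one_cone_add[OF P(1)] rank_one_cone_scale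
          rank_one_mem_cone that scale) auto
    also have "\<dots> = Re (qform I G U)"
      unfolding qform_def Re_sum G_def by (intro sum.cong refl arg_cong[of _ _ Re]) simp
    finally have "0 \<le> Re (qform I G U)" .
    moreover have "cnj (qform I G U) = qform I G U"
    proof -
      have "cnj (qform I G U) = (\<Sum>x\<in>I. \<Sum>y\<in>I. cnj (U y) * G y x * U x)"
        unfolding qform_def cnj_sum by (intro sum.cong refl) (simp add: mult_ac flip: Gherm)
      also have "\<dots> = qform I G U" unfolding qform_def by (rule sum.swap)
      finally show ?thesis .
    qed
    ultimately show ?thesis by (simp add: less_eq_complex_def complex_eq_iff)
  qed
  from dual[OF Gherm this] have GH: "0 \<le> (\<Sum>x\<in>I. \<Sum>y\<in>I. Re (G x y * cnj (H x y)))"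
    by (simp flip: herm)
  have "0 \<le> (\<Sum>x\<in>I. \<Sum>y\<in>I. Re ((P x y - H x y) * cnj (- P x y)))"
  proof (rule dist_sq_variation[OF P(2)])
    fix t :: real assume t: "0 < t" "t < 1"
    have "(\<lambda>x y. complex_of_real (1 - t) * P x y) \<in> rank_one_cone I T"
      using t by (intro rank_one_cone_scale P(1) scale) auto
    then show "(\<lambda>x y. P x y + complex_of_real t * - P x y) \<in> rank_one_cone I T"
      by (simp add: algebra_simps)
  qed
  then have GP: "(\<Sum>x\<in>I. \<Sum>y\<in>I. Re (G x y * cnj (P x y))) \<le> 0"
    by (simp only: G_def complex_cnj_minus mult_minus_right uminus_complex.sel sum_negf neg_0_le_iff_le)
  have "dist_sq I P H = (\<Sum>x\<in>I. \<Sum>y\<in>I. Re (G x y * cnj (G x y)))"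
    unfolding dist_sq_def G_def by (intro sum.cong refl) (simp only: complex_norm_square[symmetric] Re_complex_of_real)
  also have "\<dots> = (\<Sum>x\<in>I. \<Sum>y\<in>I. Re (G x y * cnj (P x y))) - (\<Sum>x\<in>I. \<Sum>y\<in>I. Re (G x y * cnj (H x y)))"
    unfolding sum_subtractf[symmetric] by (intro sum.cong refl) (simp add: G_def algebra_simps)
  finally have "sqrt (dist_sq I P H) \<le> 0" using GP GH by simp
  then have "H x y = P x y" if "x \<in> I" "y \<in> I" for x y
    using order_trans[OF cmod_le_dist_sq[OF fin that, of P H], of 0] by simp
  with P(1) show ?thesis by (rule rank_one_cone_cong)
qed

section \<open>Vectors of bounded Schmidt rank\<close>

text \<open>
  Terms may vanish, so that the bound \<open>k\<close> need not be attained; the relation to the least number of terms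
  is \<open>schmidt_rank_le_iff\<close>.
\<close>

definition schmidt_le :: "nat \<Rightarrow> nat \<Rightarrow> nat \<Rightarrow> (nat \<times> nat \<Rightarrow> complex) set" where
  "schmidt_le n d k = {U. \<exists>u v. \<forall>i<n. \<forall>a<d. U (i, a) = (\<Sum>c<k. u c i * v c a)}"

abbreviation ix :: "nat \<Rightarrow> nat \<Rightarrow> (nat \<times> nat) set" where
  "ix n d \<equiv> {..<n} \<times> {..<d}"

lemma sum_ix: "(\<Sum>x\<in>ix n d. f x) = (\<Sum>i<n. \<Sum>a<d. f (i, a))"
  by (simp add: sum.cartesian_product split_def)

text \<open>
  The form at the (unnormalized) maximally entangled vector \<open>\<Sum> e_i \<otimes> e_i\<close>.
\<close>

lemma qform_diagonal_vector:
  "qform (ix n n) H (\<lambda>(i, a). if i = a then 1 else 0) = (\<Sum>i<n. \<Sum>j<n. H (i, i) (j, j))"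
proof -
  have "qform (ix n n) H (\<lambda>(i, a). if i = a then 1 else 0)
    = (\<Sum>i<n. \<Sum>a<n. \<Sum>j<n. \<Sum>b<n. if a = i then if b = j then H (i, i) (j, j) else 0 else 0)"
    unfolding qform_def sum_ix by (intro sum.cong refl) auto
  also have "\<dots> = (\<Sum>i<n. \<Sum>a<n. if a = i then \<Sum>j<n. H (i, i) (j, j) else 0)"
    by (intro sum.cong refl) simp
  also have "\<dots> = (\<Sum>i<n. \<Sum>j<n. H (i, i) (j, j))" by simp
  finally show ?thesis .
qed

lemma schmidt_leI:
  assumes "\<And>i a. i < n \<Longrightarrow> a < d \<Longrightarrow> U (i, a) = (\<Sum>c<k. u c i * v c a)"
  shows "U \<in> schmidt_le n d k"
  unfolding schmidt_le_def using assms by (intro CollectI exI[of _ u] exI[of _ v]) simp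

lemma schmidt_leE:
  assumes "U \<in> schmidt_le n d k"
  obtains u v where "\<And>i a. i < n \<Longrightarrow> a < d \<Longrightarrow> U (i, a) = (\<Sum>c<k. u c i * v c a)"
proof -
  from assms obtain u v where *: "\<forall>i<n. \<forall>a<d. U (i, a) = (\<Sum>c<k. u c i * v c a)"
    unfolding schmidt_le_def by (elim CollectE exE) (rule that)
  show thesis by (rule that[of u v]) (use * in simp)
qed

lemma schmidt_le_zero: "(\<lambda>_. 0) \<in> schmidt_le n d k"
  by (rule schmidt_leI[where u = "\<lambda>_ _. 0" and v = "\<lambda>_ _. 0"]) simp

lemma schmidt_le_scale:
  assumes "U \<in> schmidt_le n d k"
  shows "(\<lambda>x. z * U x) \<in> schmidt_le n d k"
proof -
  obtain u v where "\<And>i a. i < n \<Longrightarrow> a < d \<Longrightarrow> U (i, a) = (\<Sum>c<k. u c i * v c a)"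
    by (rule schmidt_leE[OF assms]) (rule that)
  then show ?thesis
    by (intro schmidt_leI[where u = "\<lambda>c i. z * u c i" and v = v]) (simp add: sum_distrib_left mult.assoc)
qed

lemma schmidt_le_cnj:
  assumes "U \<in> schmidt_le n d k"
  shows "(\<lambda>x. cnj (U x)) \<in> schmidt_le n d k"
proof -
  obtain u v where "\<And>i a. i < n \<Longrightarrow> a < d \<Longrightarrow> U (i, a) = (\<Sum>c<k. u c i * v c a)"
    by (rule schmidt_leE[OF assms]) (rule that)
  then show ?thesis
    by (intro schmidt_leI[where u = "\<lambda>c i. cnj (u c i)" and v = "\<lambda>c a. cnj (v c a)"]) simp
qed

lemma schmidt_le_swap:
  assumes "U \<in> schmidt_le n d k"
  shows "(\<lambda>x. U (prod.swap x)) \<in> schmidt_le d n k"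
proof -
  obtain u v where "\<And>i a. i < n \<Longrightarrow> a < d \<Longrightarrow> U (i, a) = (\<Sum>c<k. u c i * v c a)"
    by (rule schmidt_leE[OF assms]) (rule that)
  then show ?thesis
    by (intro schmidt_leI[where u = v and v = u]) (simp add: mult.commute)
qed

lemma schmidt_le_mono:
  assumes "U \<in> schmidt_le n d k" "k \<le> k'"
  shows "U \<in> schmidt_le n d k'"
proof -
  obtain u v where *: "\<And>i a. i < n \<Longrightarrow> a < d \<Longrightarrow> U (i, a) = (\<Sum>c<k. u c i * v c a)"
    by (rule schmidt_leE[OF assms(1)]) (rule that)
  have "(\<Sum>c<k'. (if c < k then u c i else 0) * v c a) = (\<Sum>c<k. u c i * v c a)" for i a
    using assms(2) by (intro sum.mono_neutral_cong_right) auto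
  with * show ?thesis
    by (intro schmidt_leI[where u = "\<lambda>c i. if c < k then u c i else 0" and v = v]) simp
qed

lemma schmidt_le_full: "U \<in> schmidt_le n d n"
  by (rule schmidt_leI[where u = "\<lambda>c i. if c = i then 1 else 0" and v = "\<lambda>c a. U (c, a)"])
    (simp add: if_distrib[of "\<lambda>x. x * _"] cong: if_cong)

text \<open>
  A linear map on one tensor factor whose matrix has rank at most \<open>k\<close> factors through a
  \<open>k\<close>-dimensional space, whatever the vector \<open>W\<close> is.
\<close>

lemma schmidt_le_map_right:
  assumes "A \<in> schmidt_le d m k"
  shows "(\<lambda>(i, a). \<Sum>c<m. A (a, c) * W (i, c)) \<in> schmidt_le n d k"
proof -
  obtain u v where *: "\<And>i a. i < d \<Longrightarrow> a < m \<Longrightarrow> A (i, a) = (\<Sum>c<k. u c i * v c a)"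
    by (rule schmidt_leE[OF assms]) (rule that)
  have "(\<Sum>c<m. A (a, c) * W (i, c)) = (\<Sum>e<k. (\<Sum>c<m. v e c * W (i, c)) * u e a)" if "a < d" for i a
  proof -
    have "(\<Sum>c<m. A (a, c) * W (i, c)) = (\<Sum>c<m. \<Sum>e<k. v e c * W (i, c) * u e a)"
      using * that by (simp add: sum_distrib_left mult_ac)
    also have "\<dots> = (\<Sum>e<k. \<Sum>c<m. v e c * W (i, c) * u e a)" by (rule sum.swap)
    finally show ?thesis by (simp add: sum_distrib_right)
  qed
  then show ?thesis
    by (intro schmidt_leI[where u = "\<lambda>e i. \<Sum>c<m. v e c * W (i, c)" and v = u]) simp
qed

lemma schmidt_le_orthonormal:
  assumes "U \<in> schmidt_le n d k" "k \<le> d"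
  obtains w e where "\<And>c c'. c < k \<Longrightarrow> c' < k \<Longrightarrow> (\<Sum>a<d. cnj (e c a) * e c' a) = (if c = c' then 1 else 0)"
    and "\<And>i a. i < n \<Longrightarrow> a < d \<Longrightarrow> U (i, a) = (\<Sum>c<k. w c i * e c a)"
proof -
  obtain u v where U: "\<And>i a. i < n \<Longrightarrow> a < d \<Longrightarrow> U (i, a) = (\<Sum>c<k. u c i * v c a)"
    by (rule schmidt_leE[OF assms(1)]) (rule that)
  have "\<exists>e. (\<forall>c<k. \<forall>c'<k. (\<Sum>a\<in>{..<d}. cnj (e c a) * e c' a) = (if c = c' then 1 else 0)) \<and>
             (\<forall>c<k. \<exists>s. \<forall>a\<in>{..<d}. v c a = (\<Sum>c'<k. s c' * e c' a))"
    by (rule orthonormal_span) (use assms(2) in auto)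
  then obtain e where on: "\<forall>c<k. \<forall>c'<k. (\<Sum>a<d. cnj (e c a) * e c' a) = (if c = c' then 1 else 0)"
    and sp: "\<forall>c<k. \<exists>s. \<forall>a\<in>{..<d}. v c a = (\<Sum>c'<k. s c' * e c' a)"
    by blast
  obtain s where s: "\<And>c a. c < k \<Longrightarrow> a < d \<Longrightarrow> v c a = (\<Sum>c'<k. s c c' * e c' a)"
    using sp by (metis lessThan_iff)
  show thesis
  proof (rule that[of e "\<lambda>c' i. \<Sum>c<k. u c i * s c c'"])
    show "(\<Sum>a<d. cnj (e c a) * e c' a) = (if c = c' then 1 else 0)" if "c < k" "c' < k" for c c'
      using on that by blast
    show "U (i, a) = (\<Sum>c'<k. (\<Sum>c<k. u c i * s c c') * e c' a)" if "i < n" "a < d" for i a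
    proof -
      have "U (i, a) = (\<Sum>c<k. \<Sum>c'<k. u c i * s c c' * e c' a)"
        unfolding U[OF that] using s that(2) by (simp add: sum_distrib_left mult.assoc)
      also have "\<dots> = (\<Sum>c'<k. \<Sum>c<k. u c i * s c c' * e c' a)" by (rule sum.swap)
      finally show ?thesis by (simp add: sum_distrib_right)
    qed
  qed
qed

text \<open>
  In \<open>\<Sum> w_c \<otimes> e_c\<close> with \<open>e\<close> orthonormal the entries of \<open>e\<close> are at most \<open>1\<close> and \<open>w_c\<close>, being obtained
  from \<open>U\<close> by inner products with \<open>e_c\<close>, is bounded in terms of \<open>U\<close>. The compact set is the image of a
  cube under \<open>(w, e) \<mapsto> \<Sum> w_c \<otimes> e_c\<close>, with no condition of orthonormality; the two families are
  stored in one function, told apart by a Boolean.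
\<close>

lemma schmidt_le_compactly_parametrized:
  assumes "k \<le> d"
  shows "compactly_parametrized (ix n d) (schmidt_le n d k)"
  unfolding compactly_parametrized_def
proof
  fix B :: real
  define B' where "B' = 1 + real d * \<bar>B\<bar>"
  define K where "K = PiE (UNIV :: (bool \<times> nat \<times> nat) set) (\<lambda>_. cball (0::complex) B')"
  define g where "g w = (\<lambda>(i, a). \<Sum>c<k. w (False, c, i) * w (True, c, a))"
    for w :: "bool \<times> nat \<times> nat \<Rightarrow> complex"
  have K: "compact K" unfolding K_def by (intro compact_PiE_UNIV compact_cball)
  have coord: "continuous_on K (\<lambda>w. w j)" for j
    by (rule continuous_on_product_then_coordinatewise[OF continuous_on_id])
  have "continuous_on K g"
  proof (rule continuous_on_coordinatewise_then_product)
    fix x show "continuous_on K (\<lambda>w. g w x)"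
      unfolding g_def by (cases x) (simp, intro continuous_intros coord)
  qed
  with K have "compact (g ` K)" by (rule compact_continuous_image[rotated])
  moreover have "g ` K \<subseteq> schmidt_le n d k"
  proof (rule image_subsetI)
    fix w show "g w \<in> schmidt_le n d k"
      by (rule schmidt_leI[where u = "\<lambda>c i. w (False, c, i)" and v = "\<lambda>c a. w (True, c, a)"]) (simp add: g_def)
  qed
  moreover have "\<exists>V\<in>g ` K. \<forall>x\<in>ix n d. V x = U x"
    if UT: "U \<in> schmidt_le n d k" and bound: "\<forall>x\<in>ix n d. cmod (U x) \<le> B" for U
  proof -
    obtain u e where on: "\<And>c c'. c < k \<Longrightarrow> c' < k \<Longrightarrow>
        (\<Sum>a<d. cnj (e c a) * e c' a) = (if c = c' then 1 else 0)"
      and U: "\<And>i a. i < n \<Longrightarrow> a < d \<Longrightarrow> U (i, a) = (\<Sum>c<k. u c i * e c a)"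
      by (rule schmidt_le_orthonormal[OF UT assms]) (rule that)
    have e1: "cmod (e c a) \<le> 1" if "c < k" "a < d" for c a
    proof -
      have "(cmod (e c a))\<^sup>2 \<le> (\<Sum>a<d. (cmod (e c a))\<^sup>2)"
        using that by (intro member_le_sum) auto
      also have "complex_of_real \<dots> = (\<Sum>a<d. cnj (e c a) * e c a)"
        unfolding of_real_sum complex_norm_square by (simp add: mult.commute)
      then have "(\<Sum>a<d. (cmod (e c a))\<^sup>2) = 1"
        using on[OF that(1) that(1)] by (metis of_real_eq_1_iff)
      finally show ?thesis using abs_square_le_1[of "cmod (e c a)"] by simp
    qed
    have u: "u c i = (\<Sum>a<d. cnj (e c a) * U (i, a))" if "c < k" "i < n" for c i
    proof -
      have "(\<Sum>a<d. cnj (e c a) * U (i, a)) = (\<Sum>a<d. \<Sum>c'<k. u c' i * (cnj (e c a) * e c' a))"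
        using that by (simp add: U sum_distrib_left mult_ac)
      also have "\<dots> = (\<Sum>c'<k. u c' i * (\<Sum>a<d. cnj (e c a) * e c' a))"
        by (subst sum.swap) (simp add: sum_distrib_left)
      also have "\<dots> = (\<Sum>c'<k. if c = c' then u c' i else 0)"
        using that by (intro sum.cong) (auto simp: on)
      finally show ?thesis using that by simp
    qed
    have uB: "cmod (u c i) \<le> B'" if "c < k" "i < n" for c i
    proof -
      have "cmod (u c i) \<le> (\<Sum>a<d. cmod (cnj (e c a) * U (i, a)))"
        unfolding u[OF that] by (rule norm_sum)
      also have "\<dots> \<le> (\<Sum>a<d. 1 * \<bar>B\<bar>)"
      proof (intro sum_mono)
        fix a assume "a \<in> {..<d}"
        with bound that(2) have "cmod (U (i, a)) \<le> B" by simp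
        then have "cmod (U (i, a)) \<le> \<bar>B\<bar>" by simp
        with e1[OF that(1)] \<open>a \<in> {..<d}\<close> show "cmod (cnj (e c a) * U (i, a)) \<le> 1 * \<bar>B\<bar>"
          unfolding norm_mult by (intro mult_mono) auto
      qed
      finally show ?thesis by (simp add: B'_def)
    qed
    define w where "w = (\<lambda>(b, c, j). if c < k then
        if b then if j < d then e c j else 0 else if j < n then u c j else 0 else 0)"
    have B'0: "B' \<ge> 1" by (simp add: B'_def)
    have "w \<in> K"
      using uB order_trans[OF e1 B'0] B'0 by (auto simp: K_def w_def PiE_def split: prod.splits)
    moreover have "g w x = U x" if "x \<in> ix n d" for x
      using that U by (auto simp: g_def w_def)
    ultimately show ?thesis by blast
  qed
  ultimately show "\<exists>S. compact S \<and> S \<subseteq> schmidt_le n d k \<and> (\<forall>U\<in>schmidt_le n d k.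
      (\<forall>x\<in>ix n d. cmod (U x) \<le> B) \<longrightarrow> (\<exists>V\<in>S. \<forall>x\<in>ix n d. V x = U x))"
    by (intro exI[of _ "g ` K"]) simp
qed

lemma rank_one_cone_schmidt_swap:
  assumes "H \<in> rank_one_cone (ix n d) (schmidt_le n d k)"
  shows "(\<lambda>x y. H (prod.swap x) (prod.swap y)) \<in> rank_one_cone (ix d n) (schmidt_le d n k)"
proof -
  obtain r :: nat and U where *: "\<And>l. l < r \<Longrightarrow> U l \<in> schmidt_le n d k"
    "\<And>x y. x \<in> ix n d \<Longrightarrow> y \<in> ix n d \<Longrightarrow> H x y = (\<Sum>l<r. U l x * cnj (U l y))"
    by (rule rank_one_coneE[OF assms]) (rule that)
  show ?thesis
    by (rule rank_one_coneI[of r "\<lambda>l x. U l (prod.swap x)"])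
      (use * in \<open>auto intro: schmidt_le_swap\<close>)
qed

text \<open>
  The hypothesis \<open>k \<le> m\<close> makes room for \<open>k\<close> orthonormal vectors in the second factor.
\<close>

lemma schmidt_cone_bipolar:
  assumes "k \<le> m"
    and herm: "\<And>x y. x \<in> ix n m \<Longrightarrow> y \<in> ix n m \<Longrightarrow> H y x = cnj (H x y)"
    and dual: "\<And>G. (\<And>x y. x \<in> ix n m \<Longrightarrow> y \<in> ix n m \<Longrightarrow> G y x = cnj (G x y)) \<Longrightarrow>
        (\<And>U. U \<in> schmidt_le n m k \<Longrightarrow> 0 \<le> qform (ix n m) G U) \<Longrightarrow>
        0 \<le> Re (\<Sum>x\<in>ix n m. \<Sum>y\<in>ix n m. G x y * H y x)"
  shows "H \<in> rank_one_cone (ix n m) (schmidt_le n m k)"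
proof (rule rank_one_cone_bipolar)
  show "finite (ix n m)" by simp
  show "compactly_parametrized (ix n m) (schmidt_le n m k)"
    by (rule schmidt_le_compactly_parametrized[OF assms(1)])
qed (rule schmidt_le_zero, erule schmidt_le_scale, rule herm, assumption+, rule dual)

text \<open>
  A sum of \<open>k\<close> matrices of rank at most one.
\<close>

lemma rank_le_if_factorization:
  fixes A :: "complex mat"
  assumes "A \<in> carrier_mat p m" and "\<And>a c. a < p \<Longrightarrow> c < m \<Longrightarrow> A $$ (a, c) = (\<Sum>e<k. u e a * w e c)"
  shows "vec_space.rank p A \<le> k"
  using assms
proof (induction k arbitrary: A)
  case 0
  then have "A = 0\<^sub>m p m" by (intro eq_matI) auto
  then show ?case using vec_space.rank_0I[of p m] by simp
next
  case (Suc k)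
  define B C where "B = Matrix.mat p m (\<lambda>(a, c). \<Sum>e<k. u e a * w e c)"
    and "C = Matrix.mat p m (\<lambda>(a, c). u k a * w k c)"
  have BC: "B \<in> carrier_mat p m" "C \<in> carrier_mat p m" by (simp_all add: B_def C_def)
  have "A = B + C" using Suc.prems by (intro eq_matI) (auto simp: B_def C_def)
  moreover have "vec_space.rank p B \<le> k" by (rule Suc.IH[OF BC(1)]) (simp add: B_def)
  moreover have "vec_space.rank p C \<le> 1"
    by (rule vec_space.rank_le_1_product_entries[OF BC(2), of "u k" "w k"]) (simp add: C_def)
  ultimately show ?case using vec_space.rank_subadditive[OF BC] by simp
qed

text \<open>
  A maximal independent set of columns has at most \<open>k\<close> members, and all columns are combinations of
  them.
\<close>

lemma factorization_if_rank_le: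
  fixes A :: "complex mat"
  assumes A: "A \<in> carrier_mat p m" and rank: "vec_space.rank p A \<le> k"
  shows "(\<lambda>(a, c). A $$ (a, c)) \<in> schmidt_le p m k"
proof -
  interpret vec_space "TYPE(complex)" p .
  define P where "P T \<longleftrightarrow> T \<subseteq> set (cols A) \<and> lin_indpt T" for T
  have colsA: "set (cols A) \<subseteq> carrier_vec p" using cols_dim A by blast
  have "P {}" unfolding P_def
    using fin_dim finite_basis_exists subset_li_is_li unfolding basis_def by (metis empty_subsetI)
  then obtain S where S: "finite S" "maximal S P"
    using maximal_exists_superset[of "set (cols A)" P "{}"] by (auto simp: P_def)
  have SP: "S \<subseteq> set (cols A)" "lin_indpt S" using S(2) by (auto simp: maximal_def P_def)
  have Sc: "S \<subseteq> carrier_vec p" using SP(1) colsA by blast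
  have card: "card S \<le> k"
    using rank rank_card_indpt[OF A, of S] S(2) unfolding P_def[abs_def] by simp
  have "\<exists>f. col A c = lincomb f S" if c: "c < m" for c
  proof -
    have cc: "col A c \<in> set (cols A)" using c A by (auto simp: cols_def)
    then have ccar: "col A c \<in> carrier_vec p" using colsA by blast
    have "col A c \<in> span S"
    proof (rule ccontr)
      assume nin: "col A c \<notin> span S"
      then have "lin_indpt (S \<union> {col A c})"
        using SP(2) Sc ccar lin_dep_iff_in_span by (metis carrier_vec_def module_vec_simps(3) span_mem)
      then have "P (insert (col A c) S)" using SP(1) cc by (simp add: P_def)
      then have "insert (col A c) S = S" using S(2) unfolding maximal_def by (metis subset_insertI)
      then have "col A c \<in> S" by blast
      with nin show False using Sc span_mem by simp
    qed
    then have "\<exists>f. lincomb f S = col A c" using finite_in_span[OF S(1)] Sc by auto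
    then show ?thesis by metis
  qed
  then obtain f where f: "\<And>c. c < m \<Longrightarrow> col A c = lincomb (f c) S" by metis
  obtain g where g: "bij_betw g {..<card S} S"
    using S(1) by (metis ex_bij_betw_nat_finite lessThan_atLeast0)
  have "A $$ (a, c) = (\<Sum>e<card S. vec_index (g e) a * f c (g e))" if "a < p" "c < m" for a c
  proof -
    have "A $$ (a, c) = vec_index (col A c) a" using that A by simp
    also have "\<dots> = (\<Sum>x\<in>S. f c x * vec_index x a)"
      unfolding f[OF that(2)] by (rule lincomb_index[OF that(1) Sc])
    also have "\<dots> = (\<Sum>e<card S. f c (g e) * vec_index (g e) a)"
      by (rule sum.reindex_bij_betw[OF g, symmetric])
    finally show ?thesis by (simp add: mult.commute)
  qed
  then have "(\<lambda>(a, c). A $$ (a, c)) \<in> schmidt_le p m (card S)"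
    by (intro schmidt_leI[where u = "\<lambda>e. vec_index (g e)" and v = "\<lambda>e c. f c (g e)"]) simp
  then show ?thesis using card by (rule schmidt_le_mono)
qed

section \<open>Block matrices and their flattened form\<close>

text \<open>
  Stated for an arbitrary record over matrices, so as to apply to the finite sums of both
  \<open>mat_sys\<close> and \<open>module_mat\<close>.
\<close>

lemma finsum_mat:
  fixes R :: "('a :: comm_monoid_add mat, 'b) ring_scheme"
  assumes R: "carrier R = carrier_mat nr nc" "zero R = 0\<^sub>m nr nc" "add R = (+)"
    and "finite L" "\<And>l. l \<in> L \<Longrightarrow> f l \<in> carrier_mat nr nc"
  shows finsum_mat_closed: "finsum R f L \<in> carrier_mat nr nc"
    and finsum_mat_index: "i < nr \<Longrightarrow> j < nc \<Longrightarrow> finsum R f L $$ (i, j) = (\<Sum>l\<in>L. f l $$ (i, j))"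
proof -
  interpret abelian_monoid R
    by (rule abelian_monoidI) (auto simp: R intro: comm_add_mat assoc_add_mat)
  have "finsum R f L \<in> carrier_mat nr nc \<and>
    (i < nr \<longrightarrow> j < nc \<longrightarrow> finsum R f L $$ (i, j) = (\<Sum>l\<in>L. f l $$ (i, j)))"
    using assms(4,5)
  proof (induction L rule: finite_induct)
    case empty
    then show ?case by (simp add: finsum_empty R)
  next
    case (insert l L)
    then have "finsum R f (insert l L) = f l + finsum R f L"
      by (subst finsum_insert) (auto simp: R)
    with insert show ?case by auto
  qed
  then show "finsum R f L \<in> carrier_mat nr nc"
    and "i < nr \<Longrightarrow> j < nc \<Longrightarrow> finsum R f L $$ (i, j) = (\<Sum>l\<in>L. f l $$ (i, j))" by auto
qed

lemma mats_mat_sys_iff: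
  "A \<in> mats n (mat_sys d) \<longleftrightarrow>
     A \<in> carrier_mat n n \<and> (\<forall>i<n. \<forall>j<n. A $$ (i, j) \<in> carrier_mat d d)"
  unfolding mats_def elements_mat_def by (auto simp: subset_iff) (metis atLeastLessThan_iff image_eqI zero_le)

definition blk :: "complex mat mat \<Rightarrow> nat \<times> nat \<Rightarrow> nat \<times> nat \<Rightarrow> complex" where
  "blk A x y = A $$ (fst x, fst y) $$ (snd x, snd y)"

lemma mats_eqI:
  assumes "A \<in> mats n (mat_sys d)" "B \<in> mats n (mat_sys d)"
    and "\<And>x y. x \<in> ix n d \<Longrightarrow> y \<in> ix n d \<Longrightarrow> blk A x y = blk B x y"
  shows "A = B"
proof (rule eq_matI)
  fix i j assume "i < dim_row B" "j < dim_col B"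
  then have ij: "i < n" "j < n" using assms(2) by (auto simp: mats_mat_sys_iff)
  then have AB: "A $$ (i, j) \<in> carrier_mat d d" "B $$ (i, j) \<in> carrier_mat d d"
    using assms(1,2) by (auto simp: mats_mat_sys_iff)
  show "A $$ (i, j) = B $$ (i, j)"
  proof (rule eq_matI)
    fix a b assume "a < dim_row (B $$ (i, j))" "b < dim_col (B $$ (i, j))"
    then have "a < d" "b < d" using AB by auto
    then show "A $$ (i, j) $$ (a, b) = B $$ (i, j) $$ (a, b)"
      using assms(3)[of "(i, a)" "(j, b)"] ij by (simp add: blk_def)
  qed (use AB in simp_all)
qed (use assms(1,2) in \<open>auto simp: mats_mat_sys_iff\<close>)

definition mat_of_blk :: "nat \<Rightarrow> nat \<Rightarrow> (nat \<times> nat \<Rightarrow> nat \<times> nat \<Rightarrow> complex) \<Rightarrow> complex mat mat" where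
  "mat_of_blk n d H = Matrix.mat n n (\<lambda>(i, j). Matrix.mat d d (\<lambda>(a, b). H (i, a) (j, b)))"

lemma mat_of_blk_mats: "mat_of_blk n d H \<in> mats n (mat_sys d)"
  by (simp add: mats_mat_sys_iff mat_of_blk_def)

lemma blk_mat_of_blk:
  assumes "x \<in> ix n d" "y \<in> ix n d"
  shows "blk (mat_of_blk n d H) x y = H x y"
  using assms by (cases x; cases y) (simp add: blk_def mat_of_blk_def)

lemma pair_index_less:
  fixes i n a d :: nat
  assumes "i < n" "a < d"
  shows "i * d + a < n * d"
proof -
  have "i * d + a < Suc i * d" using assms by simp
  also have "\<dots> \<le> n * d" using assms by (intro mult_le_mono1) simp
  finally show ?thesis .
qed

lemma sum_div_mod:
  fixes f :: "nat \<times> nat \<Rightarrow> 'a::comm_monoid_add"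
  shows "(\<Sum>x<n * d. f (x div d, x mod d)) = (\<Sum>z\<in>ix n d. f z)"
proof (cases "d = 0")
  case False
  show ?thesis
    using False pair_index_less[of _ n _ d]
    by (intro sum.reindex_bij_witness[of _ "\<lambda>(i, a). i * d + a" "\<lambda>x. (x div d, x mod d)"])
      (auto simp: less_mult_imp_div_less)
qed simp

lemma div_mod_pair:
  fixes a i d :: nat
  assumes "a < d"
  shows "(i * d + a) div d = i" "(i * d + a) mod d = a"
proof -
  have "d \<noteq> 0" using assms by simp
  then show "(i * d + a) div d = i" using assms by (simp add: div_mult_self3)
  show "(i * d + a) mod d = a" using assms by simp
qed

text \<open>
  Division with remainder by \<open>d\<close> translates between the indices of the flattened matrix and pairs of
  indices.
\<close>

lemma flatten_psd_iff:
  "flatten_mat n d A \<in> psd_mats (n * d) \<longleftrightarrow> (\<forall>U. 0 \<le> qform (ix n d) (blk A) U)"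
proof -
  let ?M = "flatten_mat n d A"
  have M: "?M \<in> carrier_mat (n * d) (n * d)" by (simp add: flatten_mat_def)
  have eq: "(?M *\<^sub>v v) \<bullet>c v = qform (ix n d) (blk A) U"
    if v: "v \<in> carrier_vec (n * d)" and U: "\<And>x. x < n * d \<Longrightarrow> U (x div d, x mod d) = vec_index v x"
    for v and U :: "nat \<times> nat \<Rightarrow> complex"
  proof -
    have "(?M *\<^sub>v v) \<bullet>c v = (\<Sum>x<n * d. \<Sum>y<n * d. cnj (vec_index v x) * ?M $$ (x, y) * vec_index v y)"
      using v M unfolding scalar_prod_def
      by (auto simp: scalar_prod_def sum_distrib_right sum_distrib_left lessThan_atLeast0 mult_ac intro!: sum.cong)
    also have "\<dots> = (\<Sum>x<n * d. \<Sum>y<n * d. cnj (U (x div d, x mod d)) *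
        blk A (x div d, x mod d) (y div d, y mod d) * U (y div d, y mod d))"
      by (intro sum.cong refl) (simp add: U flatten_mat_def blk_def)
    also have "\<dots> = qform (ix n d) (blk A) U"
      unfolding qform_def
      by (subst sum_div_mod[symmetric], intro sum.cong refl, subst sum_div_mod[symmetric]) simp
    finally show ?thesis .
  qed
  show ?thesis
  proof
    assume L: "?M \<in> psd_mats (n * d)"
    show "\<forall>U. 0 \<le> qform (ix n d) (blk A) U"
    proof
      fix U :: "nat \<times> nat \<Rightarrow> complex"
      have v: "Matrix.vec (n * d) (\<lambda>x. U (x div d, x mod d)) \<in> carrier_vec (n * d)" by simp
      show "0 \<le> qform (ix n d) (blk A) U"
        using L v eq[OF v, of U] unfolding psd_mats_def by fastforce
    qed
  next
    assume R: "\<forall>U. 0 \<le> qform (ix n d) (blk A) U"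
    have "0 \<le> (?M *\<^sub>v v) \<bullet>c v" if v: "v \<in> carrier_vec (n * d)" for v
      using R eq[OF v, of "\<lambda>(i, a). vec_index v (i * d + a)"] by simp
    then show "?M \<in> psd_mats (n * d)" using M by (simp add: psd_mats_def)
  qed
qed

lemma pos_cone_mat_sys_iff:
  "A \<in> pos_cone (mat_sys d) n \<longleftrightarrow>
     A \<in> mats n (mat_sys d) \<and> (\<forall>U. 0 \<le> qform (ix n d) (blk A) U)"
  by (simp add: flatten_psd_iff)

text \<open>
  From here on the positive cones are accessed through quadratic forms only.
\<close>

declare mat_sys_simps(6) [simp del]

section \<open>Linear maps, Choi matrices and compressions\<close>

abbreviation mat_hom :: "nat \<Rightarrow> nat \<Rightarrow> (complex mat \<Rightarrow> complex mat) set" where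
  "mat_hom p m \<equiv> LinearCombinations.module_hom class_ring (mat_sys p) (mat_sys m)"

lemma mat_hom_iff:
  "\<phi> \<in> mat_hom p m \<longleftrightarrow> (\<forall>X\<in>carrier_mat p p. \<phi> X \<in> carrier_mat m m) \<and>
     (\<forall>X\<in>carrier_mat p p. \<forall>Y\<in>carrier_mat p p. \<phi> (X + Y) = \<phi> X + \<phi> Y) \<and>
     (\<forall>c. \<forall>X\<in>carrier_mat p p. \<phi> (c \<cdot>\<^sub>m X) = c \<cdot>\<^sub>m \<phi> X)"
  unfolding module_hom_def by (auto simp: class_ring_simps)

definition choi :: "nat \<Rightarrow> (complex mat \<Rightarrow> complex mat) \<Rightarrow> nat \<times> nat \<Rightarrow> nat \<times> nat \<Rightarrow> complex" where
  "choi p \<phi> x y = \<phi> (unit_mat p (fst x) (fst y)) $$ (snd x, snd y)"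

lemma unit_mat_carrier: "unit_mat p a b \<in> carrier_mat p p"
  by (simp add: unit_mat_def)

text \<open>
  By linearity, adding one entry of \<open>X\<close> after the other.
\<close>

lemma mat_hom_expand:
  assumes \<phi>: "\<phi> \<in> mat_hom p m" and X: "X \<in> carrier_mat p p" and cd: "c < m" "d < m"
  shows "\<phi> X $$ (c, d) = (\<Sum>a<p. \<Sum>b<p. X $$ (a, b) * choi p \<phi> (a, c) (b, d))"
proof -
  note hom = \<phi>[unfolded mat_hom_iff]
  define R where "R Z = Matrix.mat p p (\<lambda>z. if z \<in> Z then X $$ z else 0)" for Z
  have R: "R Z \<in> carrier_mat p p" for Z by (simp add: R_def)
  have "\<phi> (R Z) $$ (c, d) = (\<Sum>z\<in>Z. X $$ z * choi p \<phi> (fst z, c) (snd z, d))"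
    if "finite Z" "Z \<subseteq> ix p p" for Z
    using that
  proof (induction Z rule: finite_induct)
    case empty
    have "R {} = 0 \<cdot>\<^sub>m R {}" by (intro eq_matI) (auto simp: R_def)
    then have "\<phi> (R {}) = 0 \<cdot>\<^sub>m \<phi> (R {})" using hom R by metis
    moreover have "(0 \<cdot>\<^sub>m \<phi> (R {})) $$ (c, d) = 0" using hom R[of "{}"] cd by fastforce
    ultimately show ?case by simp
  next
    case (insert z Z)
    let ?E = "unit_mat p (fst z) (snd z)"
    have "R (insert z Z) = R Z + X $$ z \<cdot>\<^sub>m ?E"
      using insert by (intro eq_matI) (auto simp: R_def unit_mat_def)
    then have "\<phi> (R (insert z Z)) = \<phi> (R Z) + X $$ z \<cdot>\<^sub>m \<phi> ?E"
      using hom R[of Z] unit_mat_carrier[of p] by simp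
    moreover have "\<phi> (R Z) \<in> carrier_mat m m" "\<phi> ?E \<in> carrier_mat m m"
      using hom R[of Z] unit_mat_carrier[of p] by simp_all
    ultimately have "\<phi> (R (insert z Z)) $$ (c, d) = \<phi> (R Z) $$ (c, d) + X $$ z * \<phi> ?E $$ (c, d)"
      using cd by simp
    then show ?case using insert by (simp add: choi_def add.commute)
  qed
  from this[of "ix p p"] have "\<phi> (R (ix p p)) $$ (c, d)
      = (\<Sum>z\<in>ix p p. X $$ z * choi p \<phi> (fst z, c) (snd z, d))" by simp
  moreover have "R (ix p p) = X" using X by (intro eq_matI) (auto simp: R_def)
  ultimately show ?thesis by (simp add: sum.cartesian_product split_def)
qed

lemma map_mat_mats:
  assumes "\<phi> \<in> mat_hom p m" "X \<in> mats n (mat_sys p)"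
  shows "map_mat \<phi> X \<in> mats n (mat_sys m)"
  using assms by (auto simp: mats_mat_sys_iff mat_hom_iff)

lemma blk_map_mat:
  assumes "\<phi> \<in> mat_hom p m" "X \<in> mats n (mat_sys p)" "x \<in> ix n m" "y \<in> ix n m"
  shows "blk (map_mat \<phi> X) x y
    = (\<Sum>a<p. \<Sum>b<p. blk X (fst x, a) (fst y, b) * choi p \<phi> (a, snd x) (b, snd y))"
  using assms(2-4) mat_hom_expand[OF assms(1)] by (auto simp: blk_def mats_mat_sys_iff)

text \<open>
  With \<open>V\<close> read as a \<open>p \<times> m\<close> matrix, this is the conjugation of \<open>X\<close> by \<open>I \<otimes> V\<^sup>T\<close>.
\<close>

definition compression :: "nat \<Rightarrow> (nat \<times> nat \<Rightarrow> complex) \<Rightarrow> (nat \<times> nat \<Rightarrow> nat \<times> nat \<Rightarrow> complex) \<Rightarrow>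
    nat \<times> nat \<Rightarrow> nat \<times> nat \<Rightarrow> complex" where
  "compression p V X x y =
     (\<Sum>a<p. \<Sum>b<p. X (fst x, a) (fst y, b) * V (a, snd x) * cnj (V (b, snd y)))"

text \<open>
  The form of a conjugate \<open>B X B\<^sup>*\<close> at \<open>\<xi>\<close> is the form of \<open>X\<close> at \<open>B\<^sup>* \<xi>\<close>.
\<close>

lemma qform_compression:
  "qform (ix n m) (compression p V X) \<xi>
     = qform (ix n p) X (\<lambda>(j, b). \<Sum>d<m. cnj (V (b, d)) * \<xi> (j, d))"
proof -
  have "qform (ix n m) (compression p V X) \<xi>
    = (\<Sum>i<n. \<Sum>c<m. \<Sum>j<n. \<Sum>d<m. \<Sum>a<p. \<Sum>b<p.
        cnj (\<xi> (i, c)) * (X (i, a) (j, b) * V (a, c) * cnj (V (b, d))) * \<xi> (j, d))"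
    by (simp add: qform_def compression_def sum_ix sum_distrib_left
        sum_distrib_right)
  also have "\<dots> = (\<Sum>i<n. \<Sum>a<p. \<Sum>j<n. \<Sum>b<p. \<Sum>d<m. \<Sum>c<m.
        cnj (\<xi> (i, c)) * (X (i, a) (j, b) * V (a, c) * cnj (V (b, d))) * \<xi> (j, d))"
    unfolding sum.cartesian_product
    by (rule sum.reindex_bij_witness[of _ "\<lambda>(i, a, j, b, d, c). (i, c, j, d, a, b)"
          "\<lambda>(i, c, j, d, a, b). (i, a, j, b, d, c)"]) auto
  also have "\<dots> = qform (ix n p) X (\<lambda>(j, b). \<Sum>d<m. cnj (V (b, d)) * \<xi> (j, d))"
    by (simp add: qform_def sum_ix sum_distrib_left
        sum_distrib_right mult_ac)
  finally show ?thesis .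
qed

text \<open>
  The conjugate of \<open>W W\<^sup>*\<close> by \<open>B\<close> is \<open>(B W) (B W)\<^sup>*\<close>.
\<close>

lemma compression_rank_one_cone:
  assumes "X \<in> rank_one_cone (ix n p) S"
    and "\<And>W. W \<in> S \<Longrightarrow> (\<lambda>(i, c). \<Sum>a<p. V (a, c) * W (i, a)) \<in> T"
  shows "compression p V X \<in> rank_one_cone (ix n m) T"
proof -
  obtain r :: nat and W where W: "\<And>l. l < r \<Longrightarrow> W l \<in> S"
    "\<And>x y. x \<in> ix n p \<Longrightarrow> y \<in> ix n p \<Longrightarrow> X x y = (\<Sum>l<r. W l x * cnj (W l y))"
    by (rule rank_one_coneE[OF assms(1)]) (rule that)
  define Z where "Z l = (\<lambda>(i, c). \<Sum>a<p. V (a, c) * W l (i, a))" for l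
  show ?thesis
  proof (rule rank_one_coneI[of r Z])
    show "Z l \<in> T" if "l < r" for l using assms(2)[OF W(1)[OF that]] by (simp add: Z_def)
    fix x y assume "x \<in> ix n m" "y \<in> ix n m"
    then obtain i c j d where xy: "x = (i, c)" "y = (j, d)" "i < n" "j < n" by auto
    have "compression p V X x y
        = (\<Sum>a<p. \<Sum>b<p. \<Sum>l<r. V (a, c) * W l (i, a) * cnj (V (b, d) * W l (j, b)))"
      using xy by (simp add: compression_def W sum_distrib_left sum_distrib_right mult_ac)
    also have "\<dots> = (\<Sum>l<r. \<Sum>a<p. \<Sum>b<p. V (a, c) * W l (i, a) * cnj (V (b, d) * W l (j, b)))"
      unfolding sum.cartesian_product
      by (rule sum.reindex_bij_witness[of _ "\<lambda>(l, a, b). (a, b, l)" "\<lambda>(a, b, l). (l, a, b)"]) auto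
    also have "\<dots> = (\<Sum>l<r. Z l x * cnj (Z l y))"
      by (simp add: Z_def xy sum_product)
    finally show "compression p V X x y = (\<Sum>l<r. Z l x * cnj (Z l y))" .
  qed
qed

text \<open>
  A decomposition of the Choi matrix into rank one matrices is a Kraus form of \<open>\<phi>\<close>, at every matrix
  level at once.
\<close>

lemma blk_map_mat_kraus:
  assumes "\<phi> \<in> mat_hom p m" "X \<in> mats n (mat_sys p)" "x \<in> ix n m" "y \<in> ix n m"
    and "\<And>x y. x \<in> ix p m \<Longrightarrow> y \<in> ix p m \<Longrightarrow> choi p \<phi> x y = (\<Sum>l\<in>L. V l x * cnj (V l y))"
  shows "blk (map_mat \<phi> X) x y = (\<Sum>l\<in>L. compression p (V l) (blk X) x y)"
proof -
  have "blk (map_mat \<phi> X) x y = (\<Sum>a<p. \<Sum>b<p. \<Sum>l\<in>L.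
      blk X (fst x, a) (fst y, b) * V l (a, snd x) * cnj (V l (b, snd y)))"
    using assms(3,4) by (auto simp: blk_map_mat[OF assms(1-4)] assms(5) sum_distrib_left mult.assoc)
  also have "\<dots> = (\<Sum>l\<in>L. \<Sum>a<p. \<Sum>b<p.
      blk X (fst x, a) (fst y, b) * V l (a, snd x) * cnj (V l (b, snd y)))"
    unfolding sum.cartesian_product
    by (rule sum.reindex_bij_witness[of _ "\<lambda>(l, a, b). (a, b, l)" "\<lambda>(a, b, l). (l, a, b)"]) auto
  finally show ?thesis by (simp add: compression_def)
qed

text \<open>
  The map whose Choi matrix is \<open>V V\<^sup>*\<close>.
\<close>

definition compress_mat :: "nat \<Rightarrow> nat \<Rightarrow> (nat \<times> nat \<Rightarrow> complex) \<Rightarrow> complex mat \<Rightarrow> complex mat" where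
  "compress_mat p m V X =
     Matrix.mat m m (\<lambda>(c, d). \<Sum>a<p. \<Sum>b<p. X $$ (a, b) * V (a, c) * cnj (V (b, d)))"

lemma compress_mat_hom: "compress_mat p m V \<in> mat_hom p m"
  unfolding mat_hom_iff compress_mat_def
  by (auto simp: sum.distrib sum_distrib_left algebra_simps intro!: eq_matI)

lemma choi_compress_mat:
  assumes "x \<in> ix p m" "y \<in> ix p m"
  shows "choi p (compress_mat p m V) x y = V x * cnj (V y)"
proof -
  obtain a c b d where xy: "x = (a, c)" "y = (b, d)" "a < p" "b < p" "c < m" "d < m"
    using assms by auto
  have "choi p (compress_mat p m V) x y
      = (\<Sum>a'<p. \<Sum>b'<p. (if a' = a \<and> b' = b then 1 else 0) * V (a', c) * cnj (V (b', d)))"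
    using xy by (simp add: choi_def compress_mat_def unit_mat_def)
  also have "\<dots> = (\<Sum>a'<p. \<Sum>b'<p. if b' = b then if a' = a then V (a, c) * cnj (V (b, d)) else 0 else 0)"
    by (intro sum.cong refl) auto
  also have "\<dots> = V x * cnj (V y)" using xy by (simp add: sum.delta)
  finally show ?thesis .
qed

lemma completely_positive_compress_mat:
  "completely_positive (mat_sys p) (mat_sys m) (compress_mat p m V)"
  unfolding completely_positive_def
proof (intro conjI allI impI ballI)
  show "compress_mat p m V \<in> mat_hom p m" by (rule compress_mat_hom)
  fix n X assume X: "X \<in> pos_cone (mat_sys p) n"
  note X = X[unfolded pos_cone_mat_sys_iff]
  have "blk (map_mat (compress_mat p m V) X) x y = (\<Sum>l\<in>{()}. compression p V (blk X) x y)"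
    if "x \<in> ix n m" "y \<in> ix n m" for x y
    by (rule blk_map_mat_kraus[OF compress_mat_hom]) (use X that choi_compress_mat in auto)
  then have "qform (ix n m) (blk (map_mat (compress_mat p m V) X)) \<xi>
      = qform (ix n m) (compression p V (blk X)) \<xi>" for \<xi>
    by (intro qform_cong) auto
  then show "map_mat (compress_mat p m V) X \<in> pos_cone (mat_sys m) n"
    unfolding pos_cone_mat_sys_iff using X map_mat_mats[OF compress_mat_hom] by (simp add: qform_compression)
qed

section \<open>The cones of the k-minimal and k-maximal operator systems\<close>

lemma sum_blocks:
  fixes g :: "nat \<Rightarrow> 'a::comm_monoid_add"
  shows "(\<Sum>x<q * k. g x) = (\<Sum>l<q. \<Sum>c<k. g (l * k + c))"
  using sum_div_mod[where f = "\<lambda>z. g (fst z * k + snd z)" and n = q and d = k] by (simp add: sum_ix)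

text \<open>
  The off-diagonal zero blocks disappear once the column index of \<open>A\<close> is split into a block number and
  a position in the block.
\<close>

lemma mats_conj_diag:
  assumes A: "A \<in> carrier_mat n (q * k)" and D: "\<And>l. l < q \<Longrightarrow> D l \<in> mats k (mat_sys m)"
  shows mats_conj_diag_mats: "mats_conj (mat_sys m) A (mats_diag (mat_sys m) k q D) \<in> mats n (mat_sys m)"
    and blk_mats_conj_diag: "x \<in> ix n m \<Longrightarrow> y \<in> ix n m \<Longrightarrow>
      blk (mats_conj (mat_sys m) A (mats_diag (mat_sys m) k q D)) x y
      = (\<Sum>l<q. \<Sum>c<k. \<Sum>c'<k. A $$ (fst x, l * k + c) * cnj (A $$ (fst y, l * k + c')) *
          blk (D l) (c, snd x) (c', snd y))"
proof -
  define \<Delta> where "\<Delta> = mats_diag (mat_sys m) k q D"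
  have \<Delta>: "\<Delta> $$ (l * k + c, l' * k + c') = (if l = l' then D l $$ (c, c') else 0\<^sub>m m m)"
    if "l < q" "l' < q" "c < k" "c' < k" for l l' c c'
    using that by (simp add: \<Delta>_def mats_diag_def pair_index_less div_mod_pair)
  have \<Delta>c: "\<Delta> $$ (u, v) \<in> carrier_mat m m" if "u < q * k" "v < q * k" for u v
  proof -
    have k: "0 < k" using that by (cases k) auto
    have "u div k < q" "v div k < q" "u mod k < k" "v mod k < k"
      using that k by (auto simp: less_mult_imp_div_less)
    then have "D (u div k) $$ (u mod k, v mod k) \<in> carrier_mat m m"
      and "\<Delta> $$ (u, v) = (if u div k = v div k then D (u div k) $$ (u mod k, v mod k) else 0\<^sub>m m m)"
      using \<Delta>[of "u div k" "v div k" "u mod k" "v mod k"] D[of "u div k"]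
      by (auto simp: mats_mat_sys_iff)
    then show ?thesis by (cases "u div k = v div k") (metis, simp)
  qed
  \<comment> \<open>The inner sum of the entry \<open>(i, j)\<close> of \<open>A \<Delta> A\<^sup>*\<close>.\<close>
  define T where "T i j u = (\<Oplus>\<^bsub>mat_sys m\<^esub>v\<in>{..<q * k}. (A $$ (i, u) * cnj (A $$ (j, v))) \<cdot>\<^sub>m \<Delta> $$ (u, v))"
    for i j u
  have T: "T i j u \<in> carrier_mat m m" if "u < q * k" for i j u
    unfolding T_def by (rule finsum_mat_closed) (use \<Delta>c that in auto)
  have Tix: "T i j u $$ (a, b) = (\<Sum>v<q * k. A $$ (i, u) * cnj (A $$ (j, v)) * \<Delta> $$ (u, v) $$ (a, b))"
    if "u < q * k" "a < m" "b < m" for i j u a b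
  proof -
    have "T i j u $$ (a, b) = (\<Sum>v<q * k. ((A $$ (i, u) * cnj (A $$ (j, v))) \<cdot>\<^sub>m \<Delta> $$ (u, v)) $$ (a, b))"
      unfolding T_def by (rule finsum_mat_index) (use \<Delta>c that in auto)
    also have "\<dots> = (\<Sum>v<q * k. A $$ (i, u) * cnj (A $$ (j, v)) * \<Delta> $$ (u, v) $$ (a, b))"
    proof (intro sum.cong refl)
      fix v assume "v \<in> {..<q * k}"
      then have "\<Delta> $$ (u, v) \<in> carrier_mat m m" using \<Delta>c that by simp
      then show "((A $$ (i, u) * cnj (A $$ (j, v))) \<cdot>\<^sub>m \<Delta> $$ (u, v)) $$ (a, b)
          = A $$ (i, u) * cnj (A $$ (j, v)) * \<Delta> $$ (u, v) $$ (a, b)" using that by simp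
    qed
    finally show ?thesis .
  qed
  let ?Y = "mats_conj (mat_sys m) A \<Delta>"
  have dims: "?Y \<in> carrier_mat n n" using A by (simp add: mats_conj_def)
  have Yij: "?Y $$ (i, j) = (\<Oplus>\<^bsub>mat_sys m\<^esub>u\<in>{..<q * k}. T i j u)" if "i < n" "j < n" for i j
    using A that by (simp add: mats_conj_def T_def)
  have Yc: "?Y $$ (i, j) \<in> carrier_mat m m" if "i < n" "j < n" for i j
    unfolding Yij[OF that] by (rule finsum_mat_closed) (use T in auto)
  show "mats_conj (mat_sys m) A (mats_diag (mat_sys m) k q D) \<in> mats n (mat_sys m)"
    unfolding \<Delta>_def[symmetric] mats_mat_sys_iff using dims Yc by blast
  assume "x \<in> ix n m" "y \<in> ix n m"
  then obtain i a j b where xy: "x = (i, a)" "y = (j, b)" "i < n" "j < n" "a < m" "b < m" by auto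
  have "?Y $$ (i, j) $$ (a, b) = (\<Sum>u<q * k. T i j u $$ (a, b))"
    unfolding Yij[OF xy(3,4)] by (rule finsum_mat_index) (use T xy in auto)
  also have "\<dots> = (\<Sum>u<q * k. \<Sum>v<q * k. A $$ (i, u) * cnj (A $$ (j, v)) * \<Delta> $$ (u, v) $$ (a, b))"
    by (intro sum.cong refl Tix) (use xy in auto)
  also have "\<dots> = (\<Sum>l<q. \<Sum>c<k. \<Sum>l'<q. \<Sum>c'<k. A $$ (i, l * k + c) * cnj (A $$ (j, l' * k + c')) *
      \<Delta> $$ (l * k + c, l' * k + c') $$ (a, b))"
    by (simp only: sum_blocks)
  also have "\<dots> = (\<Sum>l<q. \<Sum>c<k. \<Sum>l'<q. if l' = l then (\<Sum>c'<k. A $$ (i, l * k + c) *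
      cnj (A $$ (j, l * k + c')) * D l $$ (c, c') $$ (a, b)) else 0)"
    using xy by (intro sum.cong refl) (auto simp: \<Delta>)
  also have "\<dots> = (\<Sum>l<q. \<Sum>c<k. \<Sum>c'<k. A $$ (i, l * k + c) *
      cnj (A $$ (j, l * k + c')) * D l $$ (c, c') $$ (a, b))"
    by (rule sum.cong[OF refl], rule sum.cong[OF refl]) simp
  finally show "blk (mats_conj (mat_sys m) A (mats_diag (mat_sys m) k q D)) x y
      = (\<Sum>l<q. \<Sum>c<k. \<Sum>c'<k. A $$ (fst x, l * k + c) * cnj (A $$ (fst y, l * k + c')) *
          blk (D l) (c, snd x) (c', snd y))"
    by (simp add: blk_def xy \<Delta>_def)
qed

lemma pos_cone_rank_one_cone:
  assumes "A \<in> pos_cone (mat_sys d) n"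
  shows "blk A \<in> rank_one_cone (ix n d) UNIV"
  using assms by (intro psd_imp_rank_one_cone) (auto simp: pos_cone_mat_sys_iff)

lemma mat_of_blk_rank_one_pos:
  "mat_of_blk n d (\<lambda>x y. V x * cnj (V y)) \<in> pos_cone (mat_sys d) n"
proof -
  have "qform (ix n d) (blk (mat_of_blk n d (\<lambda>x y. V x * cnj (V y)))) U
      = qform (ix n d) (\<lambda>x y. V x * cnj (V y)) U" for U
    by (intro qform_cong) (simp_all add: blk_mat_of_blk)
  then show ?thesis
    unfolding pos_cone_mat_sys_iff by (simp add: mat_of_blk_mats qform_rank_one less_eq_complex_def)
qed

text \<open>
  Let \<open>D_l = W W\<^sup>*\<close> be a rank one block with \<open>W \<in> C^k \<otimes> C^m\<close>. Then \<open>A D A\<^sup>*\<close> contributes \<open>U U\<^sup>*\<close>,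
  where \<open>U\<close> is the image of \<open>W\<close> under a linear map on the factor \<open>C^k\<close>; the vectors obtained in
  this way are exactly those of Schmidt rank at most \<open>k\<close>.
\<close>

lemma D_max_mat_sys_iff:
  assumes k: "0 < k"
  shows "Y \<in> D_max k (mat_sys m) n \<longleftrightarrow>
     Y \<in> mats n (mat_sys m) \<and> blk Y \<in> rank_one_cone (ix n m) (schmidt_le n m k)"
proof
  assume "Y \<in> D_max k (mat_sys m) n"
  then obtain A D q where Y: "Y = mats_conj (mat_sys m) A (mats_diag (mat_sys m) k q D)"
    and A: "A \<in> carrier_mat n (q * k)" and Dp: "\<And>l. l < q \<Longrightarrow> D l \<in> pos_cone (mat_sys m) k"
    unfolding D_max_def by blast
  have D: "D l \<in> mats k (mat_sys m)" if "l < q" for l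
    using Dp[OF that] pos_cone_mat_sys_iff by blast
  have full: "UNIV = schmidt_le k m k" using schmidt_le_full by blast
  have "(\<lambda>x y. \<Sum>l\<in>{..<q}. \<Sum>c<k. \<Sum>c'<k. A $$ (fst x, l * k + c) * cnj (A $$ (fst y, l * k + c')) *
      blk (D l) (c, snd x) (c', snd y)) \<in> rank_one_cone (ix n m) (schmidt_le n m k)"
  proof (rule rank_one_cone_sum)
    fix l assume "l \<in> {..<q}"
    then have "blk (D l) \<in> rank_one_cone (ix k m) (schmidt_le k m k)"
      using pos_cone_rank_one_cone[OF Dp] unfolding full by simp
    \<comment> \<open>Compressions act on the right factor, but \<open>A\<close> acts on the left one.\<close>
    then have sw: "(\<lambda>x y. blk (D l) (prod.swap x) (prod.swap y)) \<in> rank_one_cone (ix m k) (schmidt_le m k k)"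
      by (rule rank_one_cone_schmidt_swap)
    define V where "V = (\<lambda>(c, i). A $$ (i, l * k + c))"
    have "compression k V (\<lambda>x y. blk (D l) (prod.swap x) (prod.swap y))
        \<in> rank_one_cone (ix m n) (schmidt_le m n k)"
    proof (rule compression_rank_one_cone[OF sw])
      fix W
      show "(\<lambda>(a, i). \<Sum>c<k. V (c, i) * W (a, c)) \<in> schmidt_le m n k"
        by (rule schmidt_leI[where u = "\<lambda>c a. W (a, c)" and v = "\<lambda>c i. V (c, i)"]) (simp add: mult.commute)
    qed
    from rank_one_cone_schmidt_swap[OF this]
    show "(\<lambda>x y. \<Sum>c<k. \<Sum>c'<k. A $$ (fst x, l * k + c) * cnj (A $$ (fst y, l * k + c')) *
      blk (D l) (c, snd x) (c', snd y)) \<in> rank_one_cone (ix n m) (schmidt_le n m k)"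
      by (rule rank_one_cone_cong) (auto simp: compression_def V_def mult_ac)
  qed
  then have "blk Y \<in> rank_one_cone (ix n m) (schmidt_le n m k)"
    by (rule rank_one_cone_cong) (simp add: Y blk_mats_conj_diag[of A n q k D m, OF A D])
  then show "Y \<in> mats n (mat_sys m) \<and> blk Y \<in> rank_one_cone (ix n m) (schmidt_le n m k)"
    unfolding Y using mats_conj_diag_mats[of A n q k D m, OF A D] by blast
next
  assume Y: "Y \<in> mats n (mat_sys m) \<and> blk Y \<in> rank_one_cone (ix n m) (schmidt_le n m k)"
  then obtain r :: nat and U where U: "\<And>l. l < r \<Longrightarrow> U l \<in> schmidt_le n m k"
    "\<And>x y. x \<in> ix n m \<Longrightarrow> y \<in> ix n m \<Longrightarrow> blk Y x y = (\<Sum>l<r. U l x * cnj (U l y))"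
    by (elim conjE, elim rank_one_coneE) (rule that)
  have "\<forall>l. \<exists>u v. l < r \<longrightarrow> (\<forall>i<n. \<forall>a<m. U l (i, a) = (\<Sum>c<k. u c i * v c a))"
    using U(1) unfolding schmidt_le_def by blast
  then obtain u v where uv: "\<And>l i a. l < r \<Longrightarrow> i < n \<Longrightarrow> a < m \<Longrightarrow> U l (i, a) = (\<Sum>c<k. u l c i * v l c a)"
    by metis
  \<comment> \<open>One superfluous zero block keeps the number of blocks positive.\<close>
  define A where "A = Matrix.mat n (Suc r * k) (\<lambda>(i, x). if x div k < r then u (x div k) (x mod k) i else 0)"
  define D where "D l = mat_of_blk k m (\<lambda>x y. v l (fst x) (snd x) * cnj (v l (fst y) (snd y)))" for l
  have A: "A \<in> carrier_mat n (Suc r * k)" by (simp add: A_def)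
  have Dp: "D l \<in> pos_cone (mat_sys m) k" for l
    unfolding D_def by (rule mat_of_blk_rank_one_pos)
  then have D: "D l \<in> mats k (mat_sys m)" for l using pos_cone_mat_sys_iff by blast
  have Aix: "A $$ (i, l * k + c) = (if l < r then u l c i else 0)" if "i < n" "l < Suc r" "c < k" for i l c
  proof -
    have "l * k + c < Suc r * k" using that(2,3) by (rule pair_index_less)
    then show ?thesis using that by (simp add: A_def div_mod_pair)
  qed
  have "Y = mats_conj (mat_sys m) A (mats_diag (mat_sys m) k (Suc r) D)"
  proof (rule mats_eqI)
    show "Y \<in> mats n (mat_sys m)" using Y by blast
    show "mats_conj (mat_sys m) A (mats_diag (mat_sys m) k (Suc r) D) \<in> mats n (mat_sys m)"
      by (rule mats_conj_diag_mats[OF A D])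
    fix x y assume xy': "x \<in> ix n m" "y \<in> ix n m"
    then obtain i a j b where xy: "x = (i, a)" "y = (j, b)" "i < n" "j < n" "a < m" "b < m" by auto
    have "blk (mats_conj (mat_sys m) A (mats_diag (mat_sys m) k (Suc r) D)) x y
      = (\<Sum>l<Suc r. \<Sum>c<k. \<Sum>c'<k. (if l < r then u l c i else 0) * cnj (if l < r then u l c' j else 0) *
         (v l c a * cnj (v l c' b)))"
      unfolding blk_mats_conj_diag[OF A D xy']
      by (intro sum.cong refl) (use xy in \<open>simp add: Aix D_def blk_mat_of_blk\<close>)
    also have "\<dots> = (\<Sum>l<r. \<Sum>c<k. \<Sum>c'<k. (u l c i * v l c a) * cnj (u l c' j * v l c' b))"
      by (simp add: mult_ac)
    also have "\<dots> = (\<Sum>l<r. U l x * cnj (U l y))"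
      using xy by (simp add: uv sum_product)
    finally show "blk Y x y = blk (mats_conj (mat_sys m) A (mats_diag (mat_sys m) k (Suc r) D)) x y"
      using U(2)[OF xy'] by simp
  qed
  then show "Y \<in> D_max k (mat_sys m) n" unfolding D_max_def using A Dp by blast
qed

text \<open>
  The standard basis vectors are elementary tensors.
\<close>

lemma identity_rank_one_cone:
  assumes "0 < k" "0 \<le> r"
  shows "(\<lambda>x y. if x = y then complex_of_real r else 0) \<in> rank_one_cone (ix n m) (schmidt_le n m k)"
proof -
  define e :: "nat \<times> nat \<Rightarrow> nat \<times> nat \<Rightarrow> complex" where "e z x = (if x = z then complex_of_real (sqrt r) else 0)" for z x
  have e: "e z \<in> schmidt_le n m k" for z
  proof (rule schmidt_le_mono)
    show "e z \<in> schmidt_le n m 1"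
      by (rule schmidt_leI[where u = "\<lambda>_ i. if i = fst z then complex_of_real (sqrt r) else 0"
            and v = "\<lambda>_ a. if a = snd z then 1 else 0"]) (auto simp: e_def prod_eq_iff)
  qed (use assms in simp)
  have rr: "complex_of_real (sqrt r) * complex_of_real (sqrt r) = complex_of_real r"
    using assms(2) by (simp flip: of_real_mult)
  have "(\<lambda>x y. \<Sum>z\<in>ix n m. e z x * cnj (e z y)) \<in> rank_one_cone (ix n m) (schmidt_le n m k)"
    by (intro rank_one_cone_sum rank_one_mem_cone e)
  then show ?thesis
  proof (rule rank_one_cone_cong)
    fix x y assume "x \<in> ix n m" "y \<in> ix n m"
    have "(\<Sum>z\<in>ix n m. e z x * cnj (e z y)) = (\<Sum>z\<in>ix n m. if x = z then e x x * cnj (e x y) else 0)"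
      by (intro sum.cong) (auto simp: e_def)
    also have "\<dots> = e x x * cnj (e x y)" using \<open>x \<in> ix n m\<close> by simp
    also have "\<dots> = (if x = y then complex_of_real r else 0)" using rr by (simp add: e_def)
    finally show "(if x = y then complex_of_real r else 0) = (\<Sum>z\<in>ix n m. e z x * cnj (e z y))" ..
  qed
qed

text \<open>
  The shifts \<open>r I + Y\<close> pair nonnegatively with everything in the dual cone; letting \<open>r\<close> tend to \<open>0\<close>, so does
  \<open>Y\<close>, and the bipolar theorem applies. For this reason the passage to the archimedean closure adds
  nothing.
\<close>

lemma OMAX_mat_sys_iff:
  assumes k: "0 < k" "k \<le> m"
  shows "Y \<in> pos_cone (OMAX k (mat_sys m)) n \<longleftrightarrow>
     Y \<in> mats n (mat_sys m) \<and> blk Y \<in> rank_one_cone (ix n m) (schmidt_le n m k)"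
proof -
  define B where "B r = mats_add (mat_sys m) (mats_smult (mat_sys m) (complex_of_real r)
      (mat_tensor (mat_sys m) (1\<^sub>m n) (1\<^sub>m m))) Y" for r
  let ?C = "rank_one_cone (ix n m) (schmidt_le n m k)"
  let ?I = "\<lambda>r x y. (if x = y then complex_of_real r else 0) + blk Y x y"
  have B: "B r \<in> mats n (mat_sys m)"
    and blkB: "x \<in> ix n m \<Longrightarrow> y \<in> ix n m \<Longrightarrow> blk (B r) x y = ?I r x y"
    if Y: "Y \<in> mats n (mat_sys m)" for r x y
  proof -
    show "B r \<in> mats n (mat_sys m)"
      using Y by (auto simp: B_def mats_mat_sys_iff mats_add_def mats_smult_def mat_tensor_def)
    assume "x \<in> ix n m" "y \<in> ix n m"
    then obtain i a j b where xy: "x = (i, a)" "y = (j, b)" "i < n" "j < n" "a < m" "b < m" by auto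
    have "Y \<in> carrier_mat n n" "Y $$ (i, j) \<in> carrier_mat m m"
      using Y xy by (simp_all add: mats_mat_sys_iff)
    then show "blk (B r) x y = ?I r x y"
      using xy by (simp add: blk_def B_def mats_add_def mats_smult_def mat_tensor_def)
  qed
  have "Y \<in> pos_cone (OMAX k (mat_sys m)) n \<longleftrightarrow>
      Y \<in> mats n (mat_sys m) \<and> (\<forall>r>0. B r \<in> D_max k (mat_sys m) n)"
    by (simp add: OMAX_def B_def)
  also have "\<dots> \<longleftrightarrow> Y \<in> mats n (mat_sys m) \<and> (\<forall>r>0. ?I r \<in> ?C)"
  proof -
    have "B r \<in> D_max k (mat_sys m) n \<longleftrightarrow> ?I r \<in> ?C" if Y: "Y \<in> mats n (mat_sys m)" for r
    proof -
      have "blk (B r) \<in> ?C \<longleftrightarrow> ?I r \<in> ?C"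
      proof
        assume "blk (B r) \<in> ?C"
        then show "?I r \<in> ?C" by (rule rank_one_cone_cong) (rule blkB[OF Y, symmetric])
      next
        assume "?I r \<in> ?C"
        then show "blk (B r) \<in> ?C" by (rule rank_one_cone_cong) (rule blkB[OF Y])
      qed
      with B[OF Y] show ?thesis unfolding D_max_mat_sys_iff[OF k(1)] by simp
    qed
    then show ?thesis by blast
  qed
  also have "\<dots> \<longleftrightarrow> Y \<in> mats n (mat_sys m) \<and> blk Y \<in> ?C"
  proof (intro conj_cong refl iffI)
    assume "blk Y \<in> ?C"
    show "\<forall>r>0. ?I r \<in> ?C"
    proof (intro allI impI)
      fix r :: real assume "0 < r"
      then have "(\<lambda>x y. if x = y then complex_of_real r else 0) \<in> ?C"
        by (intro identity_rank_one_cone[OF k(1)]) simp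
      from rank_one_cone_add[OF this \<open>blk Y \<in> ?C\<close>] show "?I r \<in> ?C" .
    qed
  next
    assume shifted: "\<forall>r>0. ?I r \<in> ?C"
    show "blk Y \<in> ?C"
    proof (rule schmidt_cone_bipolar[OF k(2)])
      fix x y assume xy: "x \<in> ix n m" "y \<in> ix n m"
      have I1: "?I 1 \<in> ?C" by (rule shifted[rule_format]) simp
      have "?I 1 y x = cnj (?I 1 x y)"
        by (rule hermitian_of_qform_nonneg[where H = "?I 1" and I = "ix n m",
              OF _ qform_nonneg_of_rank_one_cone[OF I1] xy]) simp
      then show "blk Y y x = cnj (blk Y x y)" by (auto split: if_splits)
    next
      fix G :: "nat \<times> nat \<Rightarrow> nat \<times> nat \<Rightarrow> complex"
      assume G: "\<And>U. U \<in> schmidt_le n m k \<Longrightarrow> 0 \<le> qform (ix n m) G U"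
      define t s where "t = Re (\<Sum>x\<in>ix n m. G x x)"
        and "s = Re (\<Sum>x\<in>ix n m. \<Sum>y\<in>ix n m. G x y * blk Y y x)"
      have rts: "0 \<le> r * t + s" if "0 < r" for r
      proof -
        have "0 \<le> Re (\<Sum>x\<in>ix n m. \<Sum>y\<in>ix n m. G x y * ?I r y x)"
          by (rule rank_one_cone_pairing[where P = "?I r" and T = "schmidt_le n m k"])
            (rule shifted[rule_format, OF that], erule G)
        also have "(\<Sum>x\<in>ix n m. \<Sum>y\<in>ix n m. G x y * ?I r y x)
          = (\<Sum>x\<in>ix n m. (\<Sum>y\<in>ix n m. if y = x then G x x * complex_of_real r else 0)
              + (\<Sum>y\<in>ix n m. G x y * blk Y y x))"
          unfolding sum.distrib[symmetric] by (intro sum.cong refl) (auto simp: algebra_simps)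
        also have "Re \<dots> = r * t + s"
          by (simp add: sum.distrib t_def s_def sum_distrib_left mult.commute)
        finally show ?thesis .
      qed
      have "0 \<le> s"
      proof (rule ccontr)
        assume s: "\<not> 0 \<le> s"
        \<comment> \<open>So small that \<open>r t\<close> cannot compensate the negative \<open>s\<close>.\<close>
        define r where "r = - s / (2 * (\<bar>t\<bar> + 1))"
        have r: "0 < r" using s by (simp add: r_def field_simps)
        have "r * t \<le> r * (\<bar>t\<bar> + 1)" using r by (intro mult_left_mono) auto
        also have "\<dots> = - s / 2" unfolding r_def by (simp add: field_simps)
        finally show False using rts[OF r] s by simp
      qed
      then show "0 \<le> Re (\<Sum>x\<in>ix n m. \<Sum>y\<in>ix n m. G x y * blk Y y x)" by (simp add: s_def)
    qed
  qed
  finally show ?thesis .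
qed

text \<open>
  The reason why \<open>d\<close>-positive maps into \<open>M_d\<close> are completely positive. A vector \<open>\<xi>\<close> of
  \<open>C^p \<otimes> C^d\<close> has only \<open>d\<close> columns; they define a rank one element \<open>P\<close> of \<open>M_d(M_p)^+\<close>, and the form of
  the Choi matrix at \<open>\<xi>\<close> is that of \<open>\<psi>^(d)(P)\<close> at the maximally entangled vector.
\<close>

lemma choi_psd:
  assumes "k_positive d (mat_sys p) (mat_sys d) \<psi>"
  shows "0 \<le> qform (ix p d) (choi p \<psi>) \<xi>"
proof -
  have hom: "\<psi> \<in> mat_hom p d"
    and pos: "\<And>A. A \<in> pos_cone (mat_sys p) d \<Longrightarrow> map_mat \<psi> A \<in> pos_cone (mat_sys d) d"
    using assms unfolding k_positive_def by blast+
  define V where "V = (\<lambda>(c, a). cnj (\<xi> (a, c)))"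
  define P where "P = mat_of_blk d p (\<lambda>x y. V x * cnj (V y))"
  define \<Omega> :: "nat \<times> nat \<Rightarrow> complex" where "\<Omega> = (\<lambda>(c, c'). if c = c' then 1 else 0)"
  have P: "P \<in> pos_cone (mat_sys p) d" unfolding P_def by (rule mat_of_blk_rank_one_pos)
  then have Pm: "P \<in> mats d (mat_sys p)" using pos_cone_mat_sys_iff by blast
  have "qform (ix d d) (blk (map_mat \<psi> P)) \<Omega> = (\<Sum>i<d. \<Sum>j<d. blk (map_mat \<psi> P) (i, i) (j, j))"
    unfolding \<Omega>_def by (rule qform_diagonal_vector)
  also have "\<dots> = (\<Sum>i<d. \<Sum>j<d. \<Sum>a<p. \<Sum>b<p. cnj (\<xi> (a, i)) * choi p \<psi> (a, i) (b, j) * \<xi> (b, j))"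
    by (simp add: blk_map_mat[OF hom Pm]) (simp add: P_def blk_mat_of_blk V_def mult_ac)
  also have "\<dots> = qform (ix p d) (choi p \<psi>) \<xi>"
    unfolding qform_def sum_ix
    unfolding sum.cartesian_product
    by (rule sum.reindex_bij_witness[of _ "\<lambda>(a, i, b, j). (i, j, a, b)" "\<lambda>(i, j, a, b). (a, i, b, j)"]) auto
  finally show ?thesis
    using pos[OF P, unfolded pos_cone_mat_sys_iff, THEN conjunct2, rule_format, of \<Omega>] by (rule subst)
qed

lemma completely_positive_k_positive:
  assumes "completely_positive S T \<phi>" "0 < k"
  shows "k_positive k S T \<phi>"
  using assms unfolding completely_positive_def k_positive_def by blast

text \<open>
  Unital \<open>k\<close>-positive maps \<open>M_p \<rightarrow> M_k\<close> have Kraus matrices with \<open>k\<close> columns, so they test the form of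
  \<open>X\<close> only on vectors of Schmidt rank at most \<open>k\<close>. Conversely, such a vector can be written as
  \<open>\<Sum> w_c \<otimes> e_c\<close> with \<open>e\<close> orthonormal, and the compression to the span of \<open>e\<close>, which is unital by
  orthonormality, tests it.
\<close>

lemma OMIN_mat_sys_iff:
  assumes k: "k \<le> p"
  shows "X \<in> pos_cone (OMIN k (mat_sys p)) n \<longleftrightarrow>
     X \<in> mats n (mat_sys p) \<and> (\<forall>U\<in>schmidt_le n p k. 0 \<le> qform (ix n p) (blk X) U)"
proof -
  have "X \<in> pos_cone (OMIN k (mat_sys p)) n \<longleftrightarrow> X \<in> mats n (mat_sys p) \<and>
      (\<forall>\<psi>\<in>unital_kpos_maps k (mat_sys p). map_mat \<psi> X \<in> pos_cone (mat_sys k) n)"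
    by (simp add: OMIN_def)
  also have "\<dots> \<longleftrightarrow> X \<in> mats n (mat_sys p) \<and> (\<forall>U\<in>schmidt_le n p k. 0 \<le> qform (ix n p) (blk X) U)"
  proof (intro conj_cong refl iffI ballI)
    fix U assume X: "X \<in> mats n (mat_sys p)" and U: "U \<in> schmidt_le n p k"
      and all: "\<forall>\<psi>\<in>unital_kpos_maps k (mat_sys p). map_mat \<psi> X \<in> pos_cone (mat_sys k) n"
    obtain w e where on: "\<And>c c'. c < k \<Longrightarrow> c' < k \<Longrightarrow> (\<Sum>a<p. cnj (e c a) * e c' a) = (if c = c' then 1 else 0)"
      and w: "\<And>i a. i < n \<Longrightarrow> a < p \<Longrightarrow> U (i, a) = (\<Sum>c<k. w c i * e c a)"
      by (rule schmidt_le_orthonormal[OF U k]) (rule that)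
    define V where "V = (\<lambda>(a, c). cnj (e c a))"
    let ?\<psi> = "compress_mat p k V"
    have "?\<psi> (1\<^sub>m p) = 1\<^sub>m k"
    proof (rule eq_matI)
      fix c d assume "c < dim_row (1\<^sub>m k)" "d < dim_col (1\<^sub>m k)"
      then have cd: "c < k" "d < k" by auto
      have "?\<psi> (1\<^sub>m p) $$ (c, d) = (\<Sum>a<p. \<Sum>b<p. (if a = b then 1 else 0) * cnj (e c a) * e d b)"
        using cd by (simp add: compress_mat_def V_def)
      also have "\<dots> = (\<Sum>a<p. \<Sum>b<p. if b = a then cnj (e c a) * e d a else 0)"
        by (intro sum.cong refl) auto
      finally show "?\<psi> (1\<^sub>m p) $$ (c, d) = 1\<^sub>m k $$ (c, d)" using cd by (simp add: sum.delta on)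
    qed (simp_all add: compress_mat_def)
    moreover have "k_positive k (mat_sys p) (mat_sys k) ?\<psi>"
    proof (cases "k = 0")
      case True
      then show ?thesis by (auto simp: k_positive_def compress_mat_hom pos_cone_mat_sys_iff qform_def
            intro!: map_mat_mats compress_mat_hom)
    next
      case False
      then show ?thesis by (intro completely_positive_k_positive completely_positive_compress_mat) simp
    qed
    ultimately have "map_mat ?\<psi> X \<in> pos_cone (mat_sys k) n"
      using all by (simp add: unital_kpos_maps_def)
    then have "0 \<le> qform (ix n k) (blk (map_mat ?\<psi> X)) (\<lambda>(j, c). w c j)"
      unfolding pos_cone_mat_sys_iff by blast
    also have "qform (ix n k) (blk (map_mat ?\<psi> X)) (\<lambda>(j, c). w c j)
        = qform (ix n k) (compression p V (blk X)) (\<lambda>(j, c). w c j)"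
    proof (rule qform_cong)
      fix x y assume "x \<in> ix n k" "y \<in> ix n k"
      then have "blk (map_mat ?\<psi> X) x y = (\<Sum>l\<in>{()}. compression p V (blk X) x y)"
        by (intro blk_map_mat_kraus[OF compress_mat_hom X]) (auto simp: choi_compress_mat)
      then show "blk (map_mat ?\<psi> X) x y = compression p V (blk X) x y" by simp
    qed simp
    also have "\<dots> = qform (ix n p) (blk X) (\<lambda>(j, b). \<Sum>c<k. cnj (V (b, c)) * w c j)"
      by (simp add: qform_compression)
    also have "\<dots> = qform (ix n p) (blk X) U"
      by (rule qform_cong) (auto simp: w V_def mult.commute)
    finally show "0 \<le> qform (ix n p) (blk X) U" .
  next
    fix \<psi> assume X: "X \<in> mats n (mat_sys p)" and nonneg: "\<forall>U\<in>schmidt_le n p k. 0 \<le> qform (ix n p) (blk X) U"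
      and "\<psi> \<in> unital_kpos_maps k (mat_sys p)"
    then have kp: "k_positive k (mat_sys p) (mat_sys k) \<psi>" by (simp add: unital_kpos_maps_def)
    then have hom: "\<psi> \<in> mat_hom p k" by (simp add: k_positive_def)
    have "choi p \<psi> \<in> rank_one_cone (ix p k) UNIV"
      by (intro psd_imp_rank_one_cone choi_psd[OF kp]) auto
    then obtain r :: nat and V where
      V: "\<And>x y. x \<in> ix p k \<Longrightarrow> y \<in> ix p k \<Longrightarrow> choi p \<psi> x y = (\<Sum>l<r. V l x * cnj (V l y))"
      by (auto elim: rank_one_coneE)
    have "0 \<le> qform (ix n k) (blk (map_mat \<psi> X)) \<xi>" for \<xi>
    proof -
      have "qform (ix n k) (blk (map_mat \<psi> X)) \<xi>
          = qform (ix n k) (\<lambda>x y. \<Sum>l<r. compression p (V l) (blk X) x y) \<xi>"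
        by (rule qform_cong) (simp_all add: blk_map_mat_kraus[OF hom X _ _ V])
      also have "\<dots> = (\<Sum>l<r. qform (ix n p) (blk X) (\<lambda>(j, b). \<Sum>d<k. cnj (V l (b, d)) * \<xi> (j, d)))"
        by (simp add: qform_sum qform_compression)
      also have "\<dots> \<ge> 0"
      proof (rule sum_nonneg)
        fix l
        have "V l \<in> schmidt_le p k k"
          using schmidt_le_swap[OF schmidt_le_full[of "\<lambda>x. V l (prod.swap x)" k p]] by simp
        then have "(\<lambda>(j, b). \<Sum>d<k. cnj (V l (b, d)) * \<xi> (j, d)) \<in> schmidt_le n p k"
          by (intro schmidt_le_map_right schmidt_le_cnj)
        then show "0 \<le> qform (ix n p) (blk X) (\<lambda>(j, b). \<Sum>d<k. cnj (V l (b, d)) * \<xi> (j, d))"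
          using nonneg by blast
      qed
      finally show ?thesis .
    qed
    then show "map_mat \<psi> X \<in> pos_cone (mat_sys k) n"
      unfolding pos_cone_mat_sys_iff using map_mat_mats[OF hom X] by blast
  qed
  finally show ?thesis .
qed

section \<open>States and partially entanglement breaking maps\<close>

definition unit_blk :: "nat \<Rightarrow> nat \<Rightarrow> nat \<times> nat \<Rightarrow> nat \<times> nat \<Rightarrow> complex mat mat" where
  "unit_blk n d x y = mat_of_blk n d (\<lambda>x' y'. if x' = x \<and> y' = y then 1 else 0)"

lemma unit_blk_mats: "unit_blk n d x y \<in> mats n (mat_sys d)"
  unfolding unit_blk_def by (rule mat_of_blk_mats)

lemma mat_tensor_unit_mats:
  "mat_tensor (mat_sys d) (unit_mat n i j) (unit_mat d a b) = unit_blk n d (i, a) (j, b)"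
  by (intro eq_matI) (auto simp: mat_tensor_def unit_mat_def unit_blk_def mat_of_blk_def intro!: eq_matI)

lemma positive_functional_expand:
  assumes s: "positive_functional n d s" and A: "A \<in> mats n (mat_sys d)"
  shows "s A = (\<Sum>x\<in>ix n d. \<Sum>y\<in>ix n d. blk A x y * s (unit_blk n d x y))"
proof -
  have add: "s (mats_add (mat_sys d) A B) = s A + s B"
    if "A \<in> mats n (mat_sys d)" "B \<in> mats n (mat_sys d)" for A B
    using s that unfolding positive_functional_def by blast
  have smult: "s (mats_smult (mat_sys d) c A) = c * s A" if "A \<in> mats n (mat_sys d)" for c A
    using s that unfolding positive_functional_def by blast
  define R where "R Z = mat_of_blk n d (\<lambda>x y. if (x, y) \<in> Z then blk A x y else 0)" for Z
  have R: "R Z \<in> mats n (mat_sys d)" for Z unfolding R_def by (rule mat_of_blk_mats)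
  have "s (R Z) = (\<Sum>z\<in>Z. blk A (fst z) (snd z) * s (unit_blk n d (fst z) (snd z)))"
    if "finite Z" for Z
    using that
  proof (induction Z rule: finite_induct)
    case empty
    have "R {} = mats_smult (mat_sys d) 0 (R {})"
      by (intro eq_matI) (auto simp: R_def mats_smult_def mat_of_blk_def intro!: eq_matI)
    then have "s (R {}) = 0 * s (R {})" using smult[OF R] by metis
    then show ?case by simp
  next
    case (insert z Z)
    have R_insert: "R (insert z Z) = mats_add (mat_sys d) (R Z)
        (mats_smult (mat_sys d) (blk A (fst z) (snd z)) (unit_blk n d (fst z) (snd z)))"
      using insert(2)
      by (intro eq_matI) (auto simp: R_def mats_smult_def mats_add_def mat_of_blk_def unit_blk_def
          intro!: eq_matI)
    have "s (R (insert z Z)) = s (R Z) + blk A (fst z) (snd z) * s (unit_blk n d (fst z) (snd z))"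
    proof -
      have "mats_smult (mat_sys d) (blk A (fst z) (snd z)) (unit_blk n d (fst z) (snd z)) \<in> mats n (mat_sys d)"
        using unit_blk_mats[of n d "fst z" "snd z"] by (auto simp: mats_mat_sys_iff mats_smult_def)
      from add[OF R this] show ?thesis
        by (simp add: R_insert smult[OF unit_blk_mats])
    qed
    with insert show ?case by (simp add: add.commute)
  qed
  from this[of "ix n d \<times> ix n d"] have "s (R (ix n d \<times> ix n d))
      = (\<Sum>x\<in>ix n d. \<Sum>y\<in>ix n d. blk A x y * s (unit_blk n d x y))"
    by (simp add: sum.cartesian_product[of _ "ix n d" "ix n d"] split_def)
  moreover have "R (ix n d \<times> ix n d) = A"
  proof (rule mats_eqI[OF R A])
    fix x y assume "x \<in> ix n d" "y \<in> ix n d"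
    then show "blk (R (ix n d \<times> ix n d)) x y = blk A x y"
      unfolding R_def by (subst blk_mat_of_blk) auto
  qed
  ultimately show ?thesis by simp
qed

text \<open>
  The form of the density matrix at \<open>U\<close> is the value of \<open>s\<close> at the positive rank one matrix of the
  conjugate of \<open>U\<close>.
\<close>

lemma density_psd:
  assumes s: "positive_functional n d s"
  shows "(\<lambda>x y. s (unit_blk n d x y)) \<in> rank_one_cone (ix n d) UNIV"
proof (rule psd_imp_rank_one_cone)
  show "finite (ix n d)" by simp
  fix U :: "nat \<times> nat \<Rightarrow> complex"
  define V where "V x = cnj (U x)" for x
  let ?P = "mat_of_blk n d (\<lambda>x y. V x * cnj (V y))"
  have "0 \<le> s ?P" using s mat_of_blk_rank_one_pos unfolding positive_functional_def by blast
  also have "s ?P = (\<Sum>x\<in>ix n d. \<Sum>y\<in>ix n d. blk ?P x y * s (unit_blk n d x y))"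
    by (rule positive_functional_expand[OF s mat_of_blk_mats])
  also have "\<dots> = qform (ix n d) (\<lambda>x y. s (unit_blk n d x y)) U"
    unfolding qform_def by (intro sum.cong refl) (simp add: blk_mat_of_blk V_def)
  finally show "0 \<le> qform (ix n d) (\<lambda>x y. s (unit_blk n d x y)) U" .
qed

definition unflatten_vec :: "nat \<Rightarrow> complex Matrix.vec \<Rightarrow> nat \<times> nat \<Rightarrow> complex" where
  "unflatten_vec d v = (\<lambda>(i, a). vec_index v (i * d + a))"

text \<open>
  The least number of elementary tensors is at most \<open>k\<close> as soon as \<open>k\<close> of them suffice, because sums
  can be padded with zeros, and because some number of them (namely \<open>n\<close>) suffices.
\<close>

lemma schmidt_rank_le_iff:
  assumes v: "v \<in> carrier_vec (n * d)"
  shows "schmidt_rank n d v \<le> k \<longleftrightarrow> unflatten_vec d v \<in> schmidt_le n d k"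
proof -
  define P where "P r \<longleftrightarrow> (\<exists>x y. (\<forall>i<r. x i \<in> carrier_vec n \<and> y i \<in> carrier_vec d) \<and>
     v = finsum_vec TYPE(complex) (n * d) (\<lambda>i. vec_tensor (x i) (y i)) {..<r})" for r :: nat
  have tensor: "vec_tensor x y \<in> carrier_vec (n * d)"
    and tensor_ix: "j < n * d \<Longrightarrow> vec_index (vec_tensor x y) j = vec_index x (j div d) * vec_index y (j mod d)"
    if "x \<in> carrier_vec n" "y \<in> carrier_vec d" for x y j
    using that by (auto simp: vec_tensor_def)
  have P_iff: "P r \<longleftrightarrow> unflatten_vec d v \<in> schmidt_le n d r" for r
  proof
    assume "P r"
    then obtain x y where xy: "\<And>i. i < r \<Longrightarrow> x i \<in> carrier_vec n" "\<And>i. i < r \<Longrightarrow> y i \<in> carrier_vec d"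
      and v_eq: "v = finsum_vec TYPE(complex) (n * d) (\<lambda>i. vec_tensor (x i) (y i)) {..<r}"
      unfolding P_def by blast
    show "unflatten_vec d v \<in> schmidt_le n d r"
    proof (rule schmidt_leI[where u = "\<lambda>c. vec_index (x c)" and v = "\<lambda>c. vec_index (y c)"])
      fix i a assume ia: "i < n" "a < d"
      then have lt: "i * d + a < n * d" by (rule pair_index_less)
      have "vec_index v (i * d + a) = (\<Sum>c<r. vec_index (vec_tensor (x c) (y c)) (i * d + a))"
        unfolding v_eq by (rule index_finsum_vec) (use lt xy tensor in auto)
      also have "\<dots> = (\<Sum>c<r. vec_index (x c) i * vec_index (y c) a)"
        by (intro sum.cong refl) (simp add: tensor_ix xy lt div_mod_pair ia)
      finally show "unflatten_vec d v (i, a) = (\<Sum>c<r. vec_index (x c) i * vec_index (y c) a)"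
        by (simp add: unflatten_vec_def)
    qed
  next
    assume "unflatten_vec d v \<in> schmidt_le n d r"
    then obtain f g where fg: "\<And>i a. i < n \<Longrightarrow> a < d \<Longrightarrow> unflatten_vec d v (i, a) = (\<Sum>c<r. f c i * g c a)"
      by (rule schmidt_leE) (rule that)
    define x y where "x c = Matrix.vec n (f c)" and "y c = Matrix.vec d (g c)" for c
    have xy: "x c \<in> carrier_vec n" "y c \<in> carrier_vec d" for c by (simp_all add: x_def y_def)
    let ?F = "finsum_vec TYPE(complex) (n * d) (\<lambda>i. vec_tensor (x i) (y i)) {..<r}"
    have F: "?F \<in> carrier_vec (n * d)" by (rule finsum_vec_closed) (use xy tensor in auto)
    have "v = ?F"
    proof (rule eq_vecI)
      fix j assume "j < dim_vec ?F"
      then have j: "j < n * d" using F by simp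
      then have "0 < d" by (cases d) auto
      with j have ia: "j div d < n" "j mod d < d" by (auto simp: less_mult_imp_div_less)
      have "vec_index ?F j = (\<Sum>c<r. vec_index (vec_tensor (x c) (y c)) j)"
        by (rule index_finsum_vec) (use j xy tensor in auto)
      also have "\<dots> = (\<Sum>c<r. f c (j div d) * g c (j mod d))"
        using ia by (intro sum.cong refl) (simp add: tensor_ix xy j, simp add: x_def y_def)
      also have "\<dots> = vec_index v j" using fg[OF ia] by (simp add: unflatten_vec_def)
      finally show "vec_index v j = vec_index ?F j" ..
    qed (use v F in auto)
    show "P r" unfolding P_def
    proof (intro exI conjI allI impI)
      show "v = ?F" by fact
    qed (rule xy)+
  qed
  have rank: "schmidt_rank n d v = (LEAST r. P r)" by (simp add: schmidt_rank_def P_def)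
  have "P n" unfolding P_iff by (rule schmidt_le_full)
  then have "P (LEAST r. P r)" by (rule LeastI)
  moreover have "P k" if "P r" "r \<le> k" for r
    using that unfolding P_iff by (rule schmidt_le_mono)
  ultimately show ?thesis unfolding rank P_iff[symmetric] using Least_le[of P k] by blast
qed

text \<open>
  Positivity guarantees that the least number in the definition is taken over a nonempty set: \<open>\<rho>\<close> has
  some decomposition, and all vectors have Schmidt rank at most \<open>n\<close>.
\<close>

lemma schmidt_number_le_iff:
  assumes psd: "\<rho> \<in> rank_one_cone (ix n d) UNIV"
    and M: "M \<in> carrier_mat (n * d) (n * d)"
    and entries: "\<And>u v. u < n * d \<Longrightarrow> v < n * d \<Longrightarrow> M $$ (u, v) = \<rho> (u div d, u mod d) (v div d, v mod d)"
  shows "schmidt_number n d M \<le> k \<longleftrightarrow> \<rho> \<in> rank_one_cone (ix n d) (schmidt_le n d k)"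
proof -
  let ?S = "module_mat TYPE(complex) (n * d) (n * d)"
  define Q where "Q k \<longleftrightarrow> (\<exists>r U. (\<forall>i<r. U i \<in> carrier_vec (n * d) \<and> schmidt_rank n d (U i) \<le> k) \<and>
     M = (\<Oplus>\<^bsub>?S\<^esub>i\<in>{..<r::nat}. rank_one_mat (U i)))" for k
  have sum_ix: "(\<Oplus>\<^bsub>?S\<^esub>i\<in>{..<r::nat}. rank_one_mat (U i)) \<in> carrier_mat (n * d) (n * d)"
    "\<And>u v. u < n * d \<Longrightarrow> v < n * d \<Longrightarrow>
      (\<Oplus>\<^bsub>?S\<^esub>i\<in>{..<r::nat}. rank_one_mat (U i)) $$ (u, v) = (\<Sum>i<r. vec_index (U i) u * cnj (vec_index (U i) v))"
    if U: "\<And>i. i < r \<Longrightarrow> U i \<in> carrier_vec (n * d)" for r U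
  proof -
    have c: "rank_one_mat (U i) \<in> carrier_mat (n * d) (n * d)" if "i \<in> {..<r}" for i
      using U that by (auto simp: rank_one_mat_def)
    show "(\<Oplus>\<^bsub>?S\<^esub>i\<in>{..<r::nat}. rank_one_mat (U i)) \<in> carrier_mat (n * d) (n * d)"
      by (rule finsum_mat_closed) (use c in \<open>auto simp: module_mat_simps\<close>)
    fix u v assume uv: "u < n * d" "v < n * d"
    have "(\<Oplus>\<^bsub>?S\<^esub>i\<in>{..<r::nat}. rank_one_mat (U i)) $$ (u, v) = (\<Sum>i<r. rank_one_mat (U i) $$ (u, v))"
      by (rule finsum_mat_index) (use c uv in \<open>auto simp: module_mat_simps\<close>)
    also have "\<dots> = (\<Sum>i<r. vec_index (U i) u * cnj (vec_index (U i) v))"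
    proof (intro sum.cong refl)
      fix i assume "i \<in> {..<r}"
      then have "dim_vec (U i) = n * d" using U by auto
      then show "rank_one_mat (U i) $$ (u, v) = vec_index (U i) u * cnj (vec_index (U i) v)"
        using uv by (simp add: rank_one_mat_def)
    qed
    finally show "(\<Oplus>\<^bsub>?S\<^esub>i\<in>{..<r::nat}. rank_one_mat (U i)) $$ (u, v)
      = (\<Sum>i<r. vec_index (U i) u * cnj (vec_index (U i) v))" .
  qed
  have Q_iff: "Q k \<longleftrightarrow> \<rho> \<in> rank_one_cone (ix n d) (schmidt_le n d k)" for k
  proof
    assume "Q k"
    then obtain r U where U: "\<And>i. i < r \<Longrightarrow> U i \<in> carrier_vec (n * d)"
        "\<And>i. i < r \<Longrightarrow> schmidt_rank n d (U i) \<le> k"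
      and M_eq: "M = (\<Oplus>\<^bsub>?S\<^esub>i\<in>{..<r::nat}. rank_one_mat (U i))"
      unfolding Q_def by blast
    show "\<rho> \<in> rank_one_cone (ix n d) (schmidt_le n d k)"
    proof (rule rank_one_coneI[of r "\<lambda>l. unflatten_vec d (U l)"])
      show "unflatten_vec d (U l) \<in> schmidt_le n d k" if "l < r" for l
        using U[OF that] schmidt_rank_le_iff by blast
      fix x y assume "x \<in> ix n d" "y \<in> ix n d"
      then obtain i a j b where xy: "x = (i, a)" "y = (j, b)" "i < n" "j < n" "a < d" "b < d" by auto
      then have lt: "i * d + a < n * d" "j * d + b < n * d" by (auto intro: pair_index_less)
      have "\<rho> x y = M $$ (i * d + a, j * d + b)"
        using entries[OF lt] xy by (simp add: div_mod_pair)
      also have "\<dots> = (\<Sum>l<r. vec_index (U l) (i * d + a) * cnj (vec_index (U l) (j * d + b)))"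
        unfolding M_eq by (rule sum_ix(2)[OF U(1) lt])
      finally show "\<rho> x y = (\<Sum>l<r. unflatten_vec d (U l) x * cnj (unflatten_vec d (U l) y))"
        by (simp add: unflatten_vec_def xy)
    qed
  next
    assume "\<rho> \<in> rank_one_cone (ix n d) (schmidt_le n d k)"
    then obtain r :: nat and W where W: "\<And>l. l < r \<Longrightarrow> W l \<in> schmidt_le n d k"
      "\<And>x y. x \<in> ix n d \<Longrightarrow> y \<in> ix n d \<Longrightarrow> \<rho> x y = (\<Sum>l<r. W l x * cnj (W l y))"
      by (rule rank_one_coneE) (rule that)
    define U where "U l = Matrix.vec (n * d) (\<lambda>u. W l (u div d, u mod d))" for l
    have U: "U l \<in> carrier_vec (n * d)" for l by (simp add: U_def)
    have U_rank: "schmidt_rank n d (U l) \<le> k" if lr: "l < r" for l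
    proof -
      obtain f g where "\<And>i a. i < n \<Longrightarrow> a < d \<Longrightarrow> W l (i, a) = (\<Sum>c<k. f c i * g c a)"
        by (rule schmidt_leE[OF W(1)[OF lr]]) (rule that)
      then have "unflatten_vec d (U l) \<in> schmidt_le n d k"
        by (intro schmidt_leI[where u = f and v = g])
          (simp add: unflatten_vec_def U_def pair_index_less div_mod_pair)
      then show ?thesis using schmidt_rank_le_iff[OF U] by blast
    qed
    have M_eq: "M = (\<Oplus>\<^bsub>?S\<^esub>i\<in>{..<r::nat}. rank_one_mat (U i))"
    proof (rule eq_matI)
      note S = sum_ix[of r U, OF U]
      fix u v assume "u < dim_row (\<Oplus>\<^bsub>?S\<^esub>i\<in>{..<r::nat}. rank_one_mat (U i))"
        "v < dim_col (\<Oplus>\<^bsub>?S\<^esub>i\<in>{..<r::nat}. rank_one_mat (U i))"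
      then have uv: "u < n * d" "v < n * d" using S(1) by auto
      then have "0 < d" by (cases d) auto
      with uv have "(u div d, u mod d) \<in> ix n d" "(v div d, v mod d) \<in> ix n d"
        by (auto simp: less_mult_imp_div_less)
      then show "M $$ (u, v) = (\<Oplus>\<^bsub>?S\<^esub>i\<in>{..<r::nat}. rank_one_mat (U i)) $$ (u, v)"
        unfolding S(2)[OF uv] using uv by (simp add: entries W(2) U_def)
    qed (use sum_ix(1)[of r U, OF U] M in auto)
    show "Q k" unfolding Q_def
    proof (intro exI conjI allI impI)
      show "M = (\<Oplus>\<^bsub>?S\<^esub>i\<in>{..<r::nat}. rank_one_mat (U i))" by fact
    qed (rule U, rule U_rank)
  qed
  have num: "schmidt_number n d M = (LEAST k. Q k)" by (simp add: schmidt_number_def Q_def)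
  have mono: "Q k'" if "Q k" "k \<le> k'" for k k'
  proof -
    obtain r :: nat and W where W: "\<And>l. l < r \<Longrightarrow> W l \<in> schmidt_le n d k"
      "\<And>x y. x \<in> ix n d \<Longrightarrow> y \<in> ix n d \<Longrightarrow> \<rho> x y = (\<Sum>l<r. W l x * cnj (W l y))"
      by (rule rank_one_coneE[OF \<open>Q k\<close>[unfolded Q_iff]]) (rule that)
    then show ?thesis unfolding Q_iff
      using schmidt_le_mono[OF _ that(2)] by (intro rank_one_coneI[of r W]) auto
  qed
  have "UNIV = schmidt_le n d n" using schmidt_le_full by blast
  with psd have "Q n" unfolding Q_iff by simp
  then have "Q (LEAST k. Q k)" by (rule LeastI)
  then have "(LEAST k. Q k) \<le> k \<longleftrightarrow> Q k" using mono Least_le[of Q k] by blast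
  then show ?thesis unfolding num Q_iff .
qed

lemma k_separable_iff:
  assumes s: "positive_functional n d s"
  shows "k_separable n d k s \<longleftrightarrow>
    (\<lambda>x y. s (unit_blk n d x y)) \<in> rank_one_cone (ix n d) (schmidt_le n d k)"
proof -
  have "schmidt_number n d (density_mat n d s) \<le> k \<longleftrightarrow>
    (\<lambda>x y. s (unit_blk n d x y)) \<in> rank_one_cone (ix n d) (schmidt_le n d k)"
    by (rule schmidt_number_le_iff[OF density_psd[OF s]])
      (simp_all add: density_mat_def mat_tensor_unit_mats)
  with s show ?thesis by (simp add: k_separable_def)
qed

lemma blk_map_unit_blk:
  assumes \<phi>: "\<phi> \<in> mat_hom p m" and "x \<in> ix n p" "y \<in> ix n p" "x' \<in> ix n m" "y' \<in> ix n m"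
  shows "blk (map_mat \<phi> (unit_blk n p x y)) x' y'
    = (if fst x' = fst x \<and> fst y' = fst y then choi p \<phi> (snd x, snd x') (snd y, snd y') else 0)"
proof -
  have "blk (map_mat \<phi> (unit_blk n p x y)) x' y'
    = (\<Sum>a<p. \<Sum>b<p. blk (unit_blk n p x y) (fst x', a) (fst y', b) * choi p \<phi> (a, snd x') (b, snd y'))"
    by (rule blk_map_mat[OF \<phi> unit_blk_mats assms(4,5)])
  also have "\<dots> = (\<Sum>a<p. \<Sum>b<p. if b = snd y then if a = snd x then
      (if fst x' = fst x \<and> fst y' = fst y then choi p \<phi> (snd x, snd x') (snd y, snd y') else 0) else 0 else 0)"
    using assms(2-5) unfolding unit_blk_def
    by (intro sum.cong refl) (auto simp: blk_mat_of_blk prod_eq_iff)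
  also have "\<dots> = (if fst x' = fst x \<and> fst y' = fst y then choi p \<phi> (snd x, snd x') (snd y, snd y') else 0)"
    using assms(2,3) by auto
  finally show ?thesis .
qed

lemma positive_functional_comp:
  assumes \<phi>: "completely_positive (mat_sys p) (mat_sys m) \<phi>" and s: "positive_functional n m s" and n: "0 < n"
  shows "positive_functional n p (s \<circ> map_mat \<phi>)"
proof -
  have hom: "\<phi> \<in> mat_hom p m" and pos: "\<And>A. A \<in> pos_cone (mat_sys p) n \<Longrightarrow> map_mat \<phi> A \<in> pos_cone (mat_sys m) n"
    using \<phi> n unfolding completely_positive_def by blast+
  note h = hom[unfolded mat_hom_iff]
  have add: "map_mat \<phi> (mats_add (mat_sys p) A B) = mats_add (mat_sys m) (map_mat \<phi> A) (map_mat \<phi> B)"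
    if "A \<in> mats n (mat_sys p)" "B \<in> mats n (mat_sys p)" for A B
    using that h by (intro eq_matI) (auto simp: mats_mat_sys_iff mats_add_def)
  have smult: "map_mat \<phi> (mats_smult (mat_sys p) c A) = mats_smult (mat_sys m) c (map_mat \<phi> A)"
    if "A \<in> mats n (mat_sys p)" for A c
    using that h by (intro eq_matI) (auto simp: mats_mat_sys_iff mats_smult_def)
  show ?thesis
    using s pos map_mat_mats[OF hom] unfolding positive_functional_def by (simp add: add smult)
qed

text \<open>
  The density matrix of \<open>s \<circ> \<phi>^(n)\<close> is the sum of the compressions of the density matrix of \<open>s\<close> by the
  transposed Kraus matrices, which have rank at most \<open>k\<close>.
\<close>

lemma k_PEB_of_choi:
  assumes hom: "\<phi> \<in> mat_hom p m" and cp: "completely_positive (mat_sys p) (mat_sys m) \<phi>"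
    and choi: "choi p \<phi> \<in> rank_one_cone (ix p m) (schmidt_le p m k)"
  shows "k_PEB p m k \<phi>"
  unfolding k_PEB_def
proof (intro conjI allI impI hom)
  fix n :: nat and s assume n: "0 < n" and "is_state n m s"
  then have s: "positive_functional n m s" by (simp add: is_state_def)
  define S where "S x y = s (unit_blk n m x y)" for x y
  obtain r :: nat and V where V: "\<And>l. l < r \<Longrightarrow> V l \<in> schmidt_le p m k"
    "\<And>x y. x \<in> ix p m \<Longrightarrow> y \<in> ix p m \<Longrightarrow> choi p \<phi> x y = (\<Sum>l<r. V l x * cnj (V l y))"
    by (rule rank_one_coneE[OF choi]) (rule that)
  have "(\<lambda>x y. \<Sum>l\<in>{..<r}. compression m (\<lambda>z. V l (prod.swap z)) S x y)
      \<in> rank_one_cone (ix n p) (schmidt_le n p k)"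
  proof (rule rank_one_cone_sum)
    fix l assume "l \<in> {..<r}"
    then show "compression m (\<lambda>z. V l (prod.swap z)) S \<in> rank_one_cone (ix n p) (schmidt_le n p k)"
      using density_psd[OF s] schmidt_le_map_right[OF V(1)]
      by (intro compression_rank_one_cone[of _ _ _ UNIV]) (auto simp: S_def[abs_def])
  qed
  then have "(\<lambda>x y. (s \<circ> map_mat \<phi>) (unit_blk n p x y)) \<in> rank_one_cone (ix n p) (schmidt_le n p k)"
  proof (rule rank_one_cone_cong)
    fix x y assume xy': "x \<in> ix n p" "y \<in> ix n p"
    then obtain i a j b where xy: "x = (i, a)" "y = (j, b)" "i < n" "j < n" "a < p" "b < p" by auto
    have "(s \<circ> map_mat \<phi>) (unit_blk n p x y)
      = (\<Sum>x'\<in>ix n m. \<Sum>y'\<in>ix n m. blk (map_mat \<phi> (unit_blk n p x y)) x' y' * S x' y')"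
      unfolding S_def o_def
      by (rule positive_functional_expand[OF s map_mat_mats[OF hom unit_blk_mats]])
    also have "\<dots> = (\<Sum>i'<n. \<Sum>c<m. \<Sum>j'<n. \<Sum>d<m.
        if i' = i then if j' = j then choi p \<phi> (a, c) (b, d) * S (i, c) (j, d) else 0 else 0)"
      unfolding sum_ix by (intro sum.cong refl) (auto simp: blk_map_unit_blk[OF hom xy'[unfolded xy(1,2)]] xy)
    also have "\<dots> = (\<Sum>c<m. \<Sum>d<m. \<Sum>i'<n. \<Sum>j'<n.
        if i' = i then if j' = j then choi p \<phi> (a, c) (b, d) * S (i, c) (j, d) else 0 else 0)"
      unfolding sum.cartesian_product
      by (rule sum.reindex_bij_witness[of _ "\<lambda>(c, d, i', j'). (i', c, j', d)" "\<lambda>(i', c, j', d). (c, d, i', j')"]) auto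
    also have "\<dots> = (\<Sum>c<m. \<Sum>d<m. choi p \<phi> (a, c) (b, d) * S (i, c) (j, d))"
    proof -
      have "(\<Sum>i'<n. \<Sum>j'<n. if i' = i then if j' = j then z else 0 else 0) = z" for z :: complex
      proof -
        have "(\<Sum>i'<n. \<Sum>j'<n. if i' = i then if j' = j then z else 0 else 0)
          = (\<Sum>i'<n. if i' = i then \<Sum>j'<n. if j' = j then z else 0 else 0)"
          by (intro sum.cong refl) auto
        then show ?thesis using xy by simp
      qed
      then show ?thesis by simp
    qed
    also have "\<dots> = (\<Sum>c<m. \<Sum>d<m. \<Sum>l<r. S (i, c) (j, d) * V l (a, c) * cnj (V l (b, d)))"
      using xy by (simp add: V(2) sum_distrib_right sum_distrib_left mult_ac)
    also have "\<dots> = (\<Sum>l<r. \<Sum>c<m. \<Sum>d<m. S (i, c) (j, d) * V l (a, c) * cnj (V l (b, d)))"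
      unfolding sum.cartesian_product
      by (rule sum.reindex_bij_witness[of _ "\<lambda>(l, a, b). (a, b, l)" "\<lambda>(a, b, l). (l, a, b)"]) auto
    finally show "(s \<circ> map_mat \<phi>) (unit_blk n p x y) = (\<Sum>l<r. compression m (\<lambda>z. V l (prod.swap z)) S x y)"
      by (simp add: compression_def xy)
  qed
  then show "k_separable n p k (s \<circ> map_mat \<phi>)"
    using k_separable_iff[OF positive_functional_comp[OF cp s n]] by simp
qed

text \<open>
  Take \<open>n = m\<close> and for \<open>s\<close> the maximally entangled state. Then the density matrix of \<open>s \<circ> \<phi>^(m)\<close> is the
  Choi matrix of \<open>\<phi>\<close> with the two tensor factors interchanged, divided by \<open>m\<close>.
\<close>

lemma choi_of_k_PEB:
  assumes PEB: "k_PEB p m k \<phi>" and m: "0 < m"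
  shows "choi p \<phi> \<in> rank_one_cone (ix p m) (schmidt_le p m k)"
proof -
  have hom: "\<phi> \<in> mat_hom p m" using PEB by (simp add: k_PEB_def)
  define s where "s Y = (\<Sum>i<m. \<Sum>j<m. blk Y (i, i) (j, j)) / of_nat m" for Y
  have "positive_functional m m s"
    unfolding positive_functional_def
  proof (intro conjI ballI allI)
    fix A B assume AB: "A \<in> mats m (mat_sys m)" "B \<in> mats m (mat_sys m)"
    have "blk (mats_add (mat_sys m) A B) (i, i) (j, j) = blk A (i, i) (j, j) + blk B (i, i) (j, j)"
      if "i < m" "j < m" for i j
    proof -
      have "A \<in> carrier_mat m m" "A $$ (i, j) \<in> carrier_mat m m" "B $$ (i, j) \<in> carrier_mat m m"
        using AB that by (simp_all add: mats_mat_sys_iff)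
      then show ?thesis using that by (simp add: blk_def mats_add_def)
    qed
    then show "s (mats_add (mat_sys m) A B) = s A + s B"
      by (simp add: s_def sum.distrib add_divide_distrib)
  next
    fix c A assume A: "A \<in> mats m (mat_sys m)"
    have "blk (mats_smult (mat_sys m) c A) (i, i) (j, j) = c * blk A (i, i) (j, j)"
      if "i < m" "j < m" for i j
    proof -
      have "A \<in> carrier_mat m m" "A $$ (i, j) \<in> carrier_mat m m"
        using A that by (simp_all add: mats_mat_sys_iff)
      then show ?thesis using that by (simp add: blk_def mats_smult_def)
    qed
    then show "s (mats_smult (mat_sys m) c A) = c * s A"
      by (simp add: s_def sum_distrib_left)
  next
    fix A assume "A \<in> pos_cone (mat_sys m) m"
    then have "0 \<le> qform (ix m m) (blk A) (\<lambda>(i, a). if i = a then 1 else 0)"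
      unfolding pos_cone_mat_sys_iff by blast
    then show "0 \<le> s A" unfolding qform_diagonal_vector s_def by (simp add: less_eq_complex_def)
  qed
  moreover have "s (mat_tensor (mat_sys m) (1\<^sub>m m) (1\<^sub>m m)) = 1"
  proof -
    have "(\<Sum>i<m. \<Sum>j<m. blk (mat_tensor (mat_sys m) (1\<^sub>m m) (1\<^sub>m m)) (i, i) (j, j))
        = (\<Sum>i<m. \<Sum>j<m. if j = i then 1 else 0)"
      by (intro sum.cong refl) (auto simp: blk_def mat_tensor_def)
    then show ?thesis using m by (simp add: s_def)
  qed
  ultimately have "k_separable m p k (s \<circ> map_mat \<phi>)"
    using PEB m unfolding k_PEB_def is_state_def by blast
  then have "(\<lambda>x y. (s \<circ> map_mat \<phi>) (unit_blk m p x y)) \<in> rank_one_cone (ix m p) (schmidt_le m p k)"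
    using k_separable_iff by (metis k_separable_def)
  then have swapped: "(\<lambda>x y. choi p \<phi> (prod.swap x) (prod.swap y) / of_nat m) \<in> rank_one_cone (ix m p) (schmidt_le m p k)"
  proof (rule rank_one_cone_cong)
    fix x y assume xy': "x \<in> ix m p" "y \<in> ix m p"
    then obtain i a j b where xy: "x = (i, a)" "y = (j, b)" "i < m" "j < m" "a < p" "b < p" by auto
    have "(\<Sum>i'<m. \<Sum>j'<m. blk (map_mat \<phi> (unit_blk m p x y)) (i', i') (j', j'))
        = (\<Sum>i'<m. \<Sum>j'<m. if j' = j then if i' = i then choi p \<phi> (a, i) (b, j) else 0 else 0)"
      by (intro sum.cong refl) (auto simp: blk_map_unit_blk[OF hom xy'[unfolded xy(1,2)]] xy)
    also have "\<dots> = choi p \<phi> (a, i) (b, j)" using xy by simp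
    finally show "choi p \<phi> (prod.swap x) (prod.swap y) / of_nat m = (s \<circ> map_mat \<phi>) (unit_blk m p x y)"
      by (simp add: s_def xy)
  qed
  have "(\<lambda>x y. complex_of_real (real m) * (choi p \<phi> (prod.swap (prod.swap x)) (prod.swap (prod.swap y)) / of_nat m))
      \<in> rank_one_cone (ix p m) (schmidt_le p m k)"
    by (rule rank_one_cone_scale[OF rank_one_cone_schmidt_swap[OF swapped]]) (simp, erule schmidt_le_scale)
  then show ?thesis using m by simp
qed

section \<open>The six conditions and the Choi matrix\<close>

lemma bilinear_factor:
  fixes X :: "nat \<Rightarrow> nat \<Rightarrow> complex"
  shows "(\<Sum>a<p. \<Sum>b<p. X a b * (\<Sum>e<k. u e a * s e) * cnj (\<Sum>e<k. u e b * t e))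
    = (\<Sum>e<k. \<Sum>e'<k. (\<Sum>a<p. \<Sum>b<p. X a b * u e a * cnj (u e' b)) * s e * cnj (t e'))"
proof -
  have "(\<Sum>a<p. \<Sum>b<p. X a b * (\<Sum>e<k. u e a * s e) * cnj (\<Sum>e<k. u e b * t e))
    = (\<Sum>a<p. \<Sum>b<p. \<Sum>e<k. \<Sum>e'<k. X a b * u e a * cnj (u e' b) * s e * cnj (t e'))"
    by (simp only: cnj_sum complex_cnj_mult sum_distrib_left sum_distrib_right mult_ac)
  also have "\<dots> = (\<Sum>e<k. \<Sum>e'<k. \<Sum>a<p. \<Sum>b<p. X a b * u e a * cnj (u e' b) * s e * cnj (t e'))"
    unfolding sum.cartesian_product
    by (rule sum.reindex_bij_witness[of _ "\<lambda>(e, e', a, b). (a, b, e, e')" "\<lambda>(a, b, e, e'). (e, e', a, b)"]) auto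
  finally show ?thesis by (simp only: sum_distrib_right)
qed

text \<open>
  Factor \<open>V\<close> through \<open>C^k\<close>. The first factor compresses \<open>X\<close> to a positive semidefinite matrix \<open>G\<close> over
  \<open>M_k\<close>, as it tests \<open>X\<close> only on vectors of Schmidt rank at most \<open>k\<close>; the second one maps vectors from
  \<open>C^n \<otimes> C^k\<close>, all of which have Schmidt rank at most \<open>k\<close>.
\<close>

lemma compression_schmidt_cone:
  assumes X: "\<And>U. U \<in> schmidt_le n p k \<Longrightarrow> 0 \<le> qform (ix n p) X U"
    and V: "V \<in> schmidt_le p m k"
  shows "compression p V X \<in> rank_one_cone (ix n m) (schmidt_le n m k)"
proof -
  obtain u w where uw: "\<And>a c. a < p \<Longrightarrow> c < m \<Longrightarrow> V (a, c) = (\<Sum>e<k. u e a * w e c)"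
    by (rule schmidt_leE[OF V]) (rule that)
  define G where "G = compression p (\<lambda>(a, e). u e a) X"
  have "G \<in> rank_one_cone (ix n k) UNIV"
  proof (rule psd_imp_rank_one_cone)
    fix \<xi>
    have "(\<lambda>(j, b). \<Sum>e<k. cnj (u e b) * \<xi> (j, e)) \<in> schmidt_le n p k"
      by (rule schmidt_leI[where u = "\<lambda>e j. \<xi> (j, e)" and v = "\<lambda>e b. cnj (u e b)"])
        (simp add: mult.commute)
    then show "0 \<le> qform (ix n k) G \<xi>" by (simp add: G_def qform_compression X)
  qed simp
  then have "compression k (\<lambda>(e, c). w e c) G \<in> rank_one_cone (ix n m) (schmidt_le n m k)"
  proof (rule compression_rank_one_cone)
    fix W :: "nat \<times> nat \<Rightarrow> complex"
    show "(\<lambda>(i, c). \<Sum>a<k. (case (a, c) of (e, c) \<Rightarrow> w e c) * W (i, a)) \<in> schmidt_le n m k"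
      by (rule schmidt_leI[where u = "\<lambda>e i. W (i, e)" and v = w]) (simp add: mult.commute)
  qed
  then show ?thesis
  proof (rule rank_one_cone_cong)
    fix x y assume "x \<in> ix n m" "y \<in> ix n m"
    then show "compression p V X x y = compression k (\<lambda>(e, c). w e c) G x y"
      by (auto simp: compression_def G_def uw bilinear_factor simp del: cnj_sum)
  qed
qed

lemma mat_hom_OMIN_OMAX:
  "LinearCombinations.module_hom class_ring (OMIN k (mat_sys p)) T
     = LinearCombinations.module_hom class_ring (mat_sys p) T"
  "LinearCombinations.module_hom class_ring S (OMAX k (mat_sys m))
     = LinearCombinations.module_hom class_ring S (mat_sys m)"
  by (simp_all add: module_hom_def OMIN_def OMAX_def)

lemma OMIN_OMAX_completely_positive_of_choi:
  assumes k: "0 < k" "k \<le> p" "k \<le> m" and hom: "\<phi> \<in> mat_hom p m"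
    and choi: "choi p \<phi> \<in> rank_one_cone (ix p m) (schmidt_le p m k)"
  shows "completely_positive (OMIN k (mat_sys p)) (OMAX k (mat_sys m)) \<phi>"
  unfolding completely_positive_def mat_hom_OMIN_OMAX
proof (intro conjI allI impI ballI hom)
  fix n X assume "X \<in> pos_cone (OMIN k (mat_sys p)) n"
  then have X: "X \<in> mats n (mat_sys p)" "\<And>U. U \<in> schmidt_le n p k \<Longrightarrow> 0 \<le> qform (ix n p) (blk X) U"
    by (simp_all add: OMIN_mat_sys_iff[OF k(2)])
  obtain r :: nat and V where V: "\<And>l. l < r \<Longrightarrow> V l \<in> schmidt_le p m k"
    "\<And>x y. x \<in> ix p m \<Longrightarrow> y \<in> ix p m \<Longrightarrow> choi p \<phi> x y = (\<Sum>l<r. V l x * cnj (V l y))"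
    by (rule rank_one_coneE[OF choi]) (rule that)
  have "(\<lambda>x y. \<Sum>l\<in>{..<r}. compression p (V l) (blk X) x y) \<in> rank_one_cone (ix n m) (schmidt_le n m k)"
    by (intro rank_one_cone_sum compression_schmidt_cone X V) simp_all
  then have "blk (map_mat \<phi> X) \<in> rank_one_cone (ix n m) (schmidt_le n m k)"
    by (rule rank_one_cone_cong) (rule blk_map_mat_kraus[OF hom X(1) _ _ V(2)])
  then show "map_mat \<phi> X \<in> pos_cone (OMAX k (mat_sys m)) n"
    by (simp add: OMAX_mat_sys_iff[OF k(1,3)] map_mat_mats[OF hom X(1)])
qed

lemma mat_sys_cone_subset_OMIN:
  assumes "k \<le> p" "X \<in> pos_cone (mat_sys p) n"
  shows "X \<in> pos_cone (OMIN k (mat_sys p)) n"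
  using assms by (simp add: OMIN_mat_sys_iff pos_cone_mat_sys_iff)

lemma OMAX_cone_subset_mat_sys:
  assumes "0 < k" "k \<le> m" "Y \<in> pos_cone (OMAX k (mat_sys m)) n"
  shows "Y \<in> pos_cone (mat_sys m) n"
  using assms qform_nonneg_of_rank_one_cone by (auto simp: OMAX_mat_sys_iff pos_cone_mat_sys_iff)

lemma completely_positive_OMIN_domain:
  assumes "k \<le> p" "completely_positive (OMIN k (mat_sys p)) T \<phi>"
  shows "completely_positive (mat_sys p) T \<phi>"
  using assms mat_sys_cone_subset_OMIN unfolding completely_positive_def mat_hom_OMIN_OMAX by blast

lemma completely_positive_OMAX_codomain:
  assumes "0 < k" "k \<le> m" "completely_positive S (OMAX k (mat_sys m)) \<phi>"
  shows "completely_positive S (mat_sys m) \<phi>"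
  using assms OMAX_cone_subset_mat_sys unfolding completely_positive_def mat_hom_OMIN_OMAX by blast

text \<open>
  By the bipolar theorem it suffices to pair the Choi matrix with a matrix \<open>G\<close> that is nonnegative on
  vectors of Schmidt rank at most \<open>k\<close>. With the tensor factors interchanged and transposed, \<open>G\<close> becomes an
  element \<open>X\<close> of \<open>M_m(OMIN_k(M_p))^+\<close>, and the pairing is the form of \<open>\<phi>^(m)(X)\<close> at the
  maximally entangled vector.
\<close>

lemma choi_of_OMIN_completely_positive:
  assumes k: "k \<le> p" "k \<le> m" and m: "0 < m"
    and cp: "completely_positive (OMIN k (mat_sys p)) (mat_sys m) \<phi>"
  shows "choi p \<phi> \<in> rank_one_cone (ix p m) (schmidt_le p m k)"
proof (rule schmidt_cone_bipolar[OF k(2)])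
  have hom: "\<phi> \<in> mat_hom p m"
    using cp unfolding completely_positive_def mat_hom_OMIN_OMAX by blast
  have kp: "k_positive m (mat_sys p) (mat_sys m) \<phi>"
    by (rule completely_positive_k_positive[OF completely_positive_OMIN_domain[OF k(1) cp] m])
  show "choi p \<phi> y x = cnj (choi p \<phi> x y)" if "x \<in> ix p m" "y \<in> ix p m" for x y
    by (rule hermitian_of_qform_nonneg[OF _ choi_psd[OF kp] that]) simp
  fix G :: "nat \<times> nat \<Rightarrow> nat \<times> nat \<Rightarrow> complex"
  assume G: "\<And>U. U \<in> schmidt_le p m k \<Longrightarrow> 0 \<le> qform (ix p m) G U"
  define X where "X = mat_of_blk m p (\<lambda>x y. G (prod.swap y) (prod.swap x))"
  have Xm: "X \<in> mats m (mat_sys p)" unfolding X_def by (rule mat_of_blk_mats)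
  have "0 \<le> qform (ix m p) (blk X) U" if "U \<in> schmidt_le m p k" for U
  proof -
    have "qform (ix m p) (blk X) U
      = (\<Sum>i<m. \<Sum>a<p. \<Sum>j<m. \<Sum>b<p. U (j, b) * G (b, j) (a, i) * cnj (U (i, a)))"
      unfolding qform_def sum_ix X_def by (intro sum.cong refl) (simp add: blk_mat_of_blk)
    also have "\<dots> = (\<Sum>b<p. \<Sum>j<m. \<Sum>a<p. \<Sum>i<m. U (j, b) * G (b, j) (a, i) * cnj (U (i, a)))"
      unfolding sum.cartesian_product
      by (rule sum.reindex_bij_witness[of _ "\<lambda>(b, j, a, i). (i, a, j, b)" "\<lambda>(i, a, j, b). (b, j, a, i)"]) auto
    also have "\<dots> = qform (ix p m) G (\<lambda>x. cnj (U (prod.swap x)))"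
      unfolding qform_def sum_ix by simp
    finally show ?thesis using G[OF schmidt_le_cnj[OF schmidt_le_swap[OF that]]] by simp
  qed
  then have "X \<in> pos_cone (OMIN k (mat_sys p)) m"
    using Xm by (simp add: OMIN_mat_sys_iff[OF k(1)])
  then have "map_mat \<phi> X \<in> pos_cone (mat_sys m) m"
    using cp m unfolding completely_positive_def by blast
  then have "0 \<le> qform (ix m m) (blk (map_mat \<phi> X)) (\<lambda>(i, c). if i = c then 1 else 0)"
    unfolding pos_cone_mat_sys_iff by blast
  also have "\<dots> = (\<Sum>i<m. \<Sum>j<m. blk (map_mat \<phi> X) (i, i) (j, j))"
    by (rule qform_diagonal_vector)
  also have "\<dots> = (\<Sum>i<m. \<Sum>j<m. \<Sum>a<p. \<Sum>b<p. G (b, j) (a, i) * choi p \<phi> (a, i) (b, j))"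
    by (simp add: blk_map_mat[OF hom Xm]) (simp add: X_def blk_mat_of_blk)
  also have "\<dots> = (\<Sum>x\<in>ix p m. \<Sum>y\<in>ix p m. G x y * choi p \<phi> y x)"
    unfolding sum_ix
    unfolding sum.cartesian_product
    by (rule sum.reindex_bij_witness[of _ "\<lambda>(b, j, a, i). (i, j, a, b)" "\<lambda>(i, j, a, b). (b, j, a, i)"]) auto
  finally show "0 \<le> Re (\<Sum>x\<in>ix p m. \<Sum>y\<in>ix p m. G x y * choi p \<phi> y x)"
    by (simp only: less_eq_complex_def zero_complex.sel)
qed

text \<open>
  The Choi matrix is the image of the positive matrix \<open>(E_ij) \<in> M_p(M_p)\<close>.
\<close>

lemma choi_of_OMAX_completely_positive:
  assumes k: "0 < k" "k \<le> m" and p: "0 < p"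
    and cp: "completely_positive (mat_sys p) (OMAX k (mat_sys m)) \<phi>"
  shows "choi p \<phi> \<in> rank_one_cone (ix p m) (schmidt_le p m k)"
proof -
  have hom: "\<phi> \<in> mat_hom p m"
    using cp unfolding completely_positive_def mat_hom_OMIN_OMAX by blast
  define \<omega> :: "nat \<times> nat \<Rightarrow> complex" where "\<omega> = (\<lambda>(i, a). if i = a then 1 else 0)"
  define P where "P = mat_of_blk p p (\<lambda>x y. \<omega> x * cnj (\<omega> y))"
  have P: "P \<in> pos_cone (mat_sys p) p" unfolding P_def by (rule mat_of_blk_rank_one_pos)
  have Pm: "P \<in> mats p (mat_sys p)" unfolding P_def by (rule mat_of_blk_mats)
  have "map_mat \<phi> P \<in> pos_cone (OMAX k (mat_sys m)) p"
    using cp p P unfolding completely_positive_def by blast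
  then have "blk (map_mat \<phi> P) \<in> rank_one_cone (ix p m) (schmidt_le p m k)"
    by (simp add: OMAX_mat_sys_iff[OF k])
  then show ?thesis
  proof (rule rank_one_cone_cong)
    fix x y assume xy': "x \<in> ix p m" "y \<in> ix p m"
    then obtain i c j d where xy: "x = (i, c)" "y = (j, d)" "i < p" "j < p" "c < m" "d < m" by auto
    have "blk (map_mat \<phi> P) x y
      = (\<Sum>a<p. \<Sum>b<p. if b = j then if a = i then choi p \<phi> x y else 0 else 0)"
      unfolding blk_map_mat[OF hom Pm xy'] unfolding P_def
      by (intro sum.cong refl) (use xy in \<open>auto simp: blk_mat_of_blk \<omega>_def\<close>)
    also have "\<dots> = choi p \<phi> x y" using xy by simp
    finally show "choi p \<phi> x y = blk (map_mat \<phi> P) x y" ..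
  qed
qed

lemma mat_adjoint_mat:
  fixes A :: "complex mat"
  assumes A: "A \<in> carrier_mat p m"
  shows mat_adjoint_carrier: "mat_adjoint A \<in> carrier_mat m p"
    and mat_adjoint_index: "c < m \<Longrightarrow> a < p \<Longrightarrow> mat_adjoint A $$ (c, a) = cnj (A $$ (a, c))"
  using A by (auto simp: mat_adjoint_def mat_of_rows_def)

lemma mult_index:
  fixes A B :: "complex mat"
  assumes "A \<in> carrier_mat n p" "B \<in> carrier_mat p n'" "i < n" "j < n'"
  shows "(A * B) $$ (i, j) = (\<Sum>a<p. A $$ (i, a) * B $$ (a, j))"
  using assms by (simp add: scalar_prod_def lessThan_atLeast0)

lemma mult_three_index:
  fixes P X Q :: "complex mat"
  assumes P: "P \<in> carrier_mat n p" and X: "X \<in> carrier_mat p p'" and Q: "Q \<in> carrier_mat p' n'"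
    and ij: "i < n" "j < n'"
  shows "(P * X * Q) $$ (i, j) = (\<Sum>a<p. \<Sum>b<p'. P $$ (i, a) * X $$ (a, b) * Q $$ (b, j))"
proof -
  have "(P * X * Q) $$ (i, j) = (\<Sum>b<p'. (\<Sum>a<p. P $$ (i, a) * X $$ (a, b)) * Q $$ (b, j))"
    unfolding mult_index[OF mult_carrier_mat[OF P X] Q ij]
    by (intro sum.cong refl) (simp add: mult_index[OF P X ij(1)])
  also have "\<dots> = (\<Sum>a<p. \<Sum>b<p'. P $$ (i, a) * X $$ (a, b) * Q $$ (b, j))"
    unfolding sum_distrib_right by (rule sum.swap)
  finally show ?thesis .
qed

text \<open>
  A zero term is appended so that the number of terms is positive.
\<close>

lemma choi_cone_indexed:
  assumes "choi p \<phi> \<in> rank_one_cone (ix p m) (schmidt_le p m k)"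
  obtains q :: nat and V where "0 < q" and "\<And>l. l \<in> {1..q} \<Longrightarrow> V l \<in> schmidt_le p m k"
    and "\<And>x y. x \<in> ix p m \<Longrightarrow> y \<in> ix p m \<Longrightarrow> choi p \<phi> x y = (\<Sum>l\<in>{1..q}. V l x * cnj (V l y))"
proof -
  obtain r :: nat and U where U: "\<And>l. l < r \<Longrightarrow> U l \<in> schmidt_le p m k"
    "\<And>x y. x \<in> ix p m \<Longrightarrow> y \<in> ix p m \<Longrightarrow> choi p \<phi> x y = (\<Sum>l<r. U l x * cnj (U l y))"
    by (rule rank_one_coneE[OF assms]) (rule that)
  define V where "V l = (if l = Suc r then (\<lambda>_. 0) else U (l - 1))" for l
  show thesis
  proof (rule that[of "Suc r" V])
    show "V l \<in> schmidt_le p m k" if "l \<in> {1..Suc r}" for l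
      using that U(1) by (auto simp: V_def schmidt_le_zero)
    show "choi p \<phi> x y = (\<Sum>l\<in>{1..Suc r}. V l x * cnj (V l y))" if "x \<in> ix p m" "y \<in> ix p m" for x y
      using U(2)[OF that] by (simp add: sum.atLeast1_atMost_eq V_def del: sum.cl_ivl_Suc)
  qed simp
qed

lemma mat_hom_kraus:
  assumes hom: "\<phi> \<in> mat_hom p m" and X: "X \<in> carrier_mat p p" and cd: "c < m" "d < m"
    and choi: "\<And>x y. x \<in> ix p m \<Longrightarrow> y \<in> ix p m \<Longrightarrow> choi p \<phi> x y = (\<Sum>l\<in>L. V l x * cnj (V l y))"
  shows "\<phi> X $$ (c, d) = (\<Sum>l\<in>L. \<Sum>a<p. \<Sum>b<p. X $$ (a, b) * V l (a, c) * cnj (V l (b, d)))"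
proof -
  have "\<phi> X $$ (c, d) = (\<Sum>a<p. \<Sum>b<p. \<Sum>l\<in>L. X $$ (a, b) * V l (a, c) * cnj (V l (b, d)))"
    using cd by (simp add: mat_hom_expand[OF hom X cd] choi sum_distrib_left mult.assoc)
  also have "\<dots> = (\<Sum>l\<in>L. \<Sum>a<p. \<Sum>b<p. X $$ (a, b) * V l (a, c) * cnj (V l (b, d)))"
    unfolding sum.cartesian_product
    by (rule sum.reindex_bij_witness[of _ "\<lambda>(l, a, b). (a, b, l)" "\<lambda>(a, b, l). (l, a, b)"]) auto
  finally show ?thesis .
qed

lemma choi_cone_of_sum:
  assumes "\<And>x y. x \<in> ix p m \<Longrightarrow> y \<in> ix p m \<Longrightarrow> choi p \<phi> x y = (\<Sum>l\<in>L. H l x y)"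
    and "\<And>l. l \<in> L \<Longrightarrow> H l \<in> rank_one_cone (ix p m) (schmidt_le p m k)"
  shows "choi p \<phi> \<in> rank_one_cone (ix p m) (schmidt_le p m k)"
  by (rule rank_one_cone_cong[OF rank_one_cone_sum[OF assms(2)] assms(1)])

definition factors_through :: "nat \<Rightarrow> nat \<Rightarrow> nat \<Rightarrow> (complex mat \<Rightarrow> complex mat) \<Rightarrow> bool" where
  "factors_through p m k \<phi> \<longleftrightarrow> (\<exists>q::nat. \<exists>\<psi> :: nat \<Rightarrow> complex mat \<Rightarrow> complex mat. \<exists>M :: nat \<Rightarrow> complex mat.
     0 < q \<and>
     (\<forall>l\<in>{1..q}. completely_positive (mat_sys p) (mat_sys k) (\<psi> l) \<and> M l \<in> carrier_mat m k) \<and>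
     (\<forall>X \<in> carrier_mat p p. \<phi> X =
        (\<Oplus>\<^bsub>module_mat TYPE(complex) m m\<^esub>l\<in>{1..q}. M l * \<psi> l X * mat_adjoint (M l))))"

definition low_rank_kraus :: "nat \<Rightarrow> nat \<Rightarrow> nat \<Rightarrow> (complex mat \<Rightarrow> complex mat) \<Rightarrow> bool" where
  "low_rank_kraus p m k \<phi> \<longleftrightarrow> (\<exists>s::nat. \<exists>A :: nat \<Rightarrow> complex mat.
     0 < s \<and>
     (\<forall>l\<in>{1..s}. A l \<in> carrier_mat p m \<and> vec_space.rank p (A l) \<le> k) \<and>
     (\<forall>X \<in> carrier_mat p p. \<phi> X =
        (\<Oplus>\<^bsub>module_mat TYPE(complex) m m\<^esub>l\<in>{1..s}. mat_adjoint (A l) * X * A l)))"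

text \<open>
  The vectors in a decomposition of the Choi matrix are the entrywise conjugates of the matrices \<open>A_l\<close>.
\<close>

lemma low_rank_kraus_iff:
  assumes hom: "\<phi> \<in> mat_hom p m"
  shows "low_rank_kraus p m k \<phi> \<longleftrightarrow> choi p \<phi> \<in> rank_one_cone (ix p m) (schmidt_le p m k)"
proof
  have entry: "mat_adjoint A * X * A \<in> carrier_mat m m"
    "c < m \<Longrightarrow> d < m \<Longrightarrow> (mat_adjoint A * X * A) $$ (c, d)
      = (\<Sum>a<p. \<Sum>b<p. X $$ (a, b) * cnj (A $$ (a, c)) * A $$ (b, d))"
    if A: "A \<in> carrier_mat p m" and X: "X \<in> carrier_mat p p" for A X :: "complex mat" and c d
  proof -
    note adj = mat_adjoint_carrier[OF A]
    show "mat_adjoint A * X * A \<in> carrier_mat m m" using adj A X by simp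
    show "(mat_adjoint A * X * A) $$ (c, d)
      = (\<Sum>a<p. \<Sum>b<p. X $$ (a, b) * cnj (A $$ (a, c)) * A $$ (b, d))" if "c < m" "d < m"
      using that by (simp add: mult_three_index[OF adj X A that] mat_adjoint_index[OF A] mult_ac)
  qed
  {
    assume "low_rank_kraus p m k \<phi>"
    then obtain s :: nat and A where A: "\<And>l. l \<in> {1..s} \<Longrightarrow> A l \<in> carrier_mat p m"
      "\<And>l. l \<in> {1..s} \<Longrightarrow> vec_space.rank p (A l) \<le> k"
      and \<phi>: "\<And>X. X \<in> carrier_mat p p \<Longrightarrow> \<phi> X =
        (\<Oplus>\<^bsub>module_mat TYPE(complex) m m\<^esub>l\<in>{1..s}. mat_adjoint (A l) * X * A l)"
      unfolding low_rank_kraus_def by blast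
    define V where "V l = (\<lambda>x. cnj ((\<lambda>(a, c). A l $$ (a, c)) x))" for l
    have V: "V l \<in> schmidt_le p m k" if "l \<in> {1..s}" for l
      unfolding V_def by (intro schmidt_le_cnj factorization_if_rank_le A that)
    show "choi p \<phi> \<in> rank_one_cone (ix p m) (schmidt_le p m k)"
    proof (rule choi_cone_of_sum)
      fix l assume "l \<in> {1..s}"
      then show "(\<lambda>x y. V l x * cnj (V l y)) \<in> rank_one_cone (ix p m) (schmidt_le p m k)"
        by (intro rank_one_mem_cone V)
    next
      fix x y assume "x \<in> ix p m" "y \<in> ix p m"
      then obtain a c b d where xy: "x = (a, c)" "y = (b, d)" "a < p" "b < p" "c < m" "d < m" by auto
      let ?E = "unit_mat p a b"
      have "choi p \<phi> x y = (\<Sum>l\<in>{1..s}. (mat_adjoint (A l) * ?E * A l) $$ (c, d))"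
        unfolding choi_def xy fst_conv snd_conv \<phi>[OF unit_mat_carrier]
        by (rule finsum_mat_index) (use A entry unit_mat_carrier xy in \<open>auto simp: module_mat_simps\<close>)
      also have "\<dots> = (\<Sum>l\<in>{1..s}. V l x * cnj (V l y))"
      proof (intro sum.cong refl)
        fix l assume l: "l \<in> {1..s}"
        have "(mat_adjoint (A l) * ?E * A l) $$ (c, d)
          = (\<Sum>a'<p. \<Sum>b'<p. ?E $$ (a', b') * cnj (A l $$ (a', c)) * A l $$ (b', d))"
          by (rule entry(2)[OF A(1)[OF l] unit_mat_carrier xy(5,6)])
        also have "\<dots> = (\<Sum>a'<p. \<Sum>b'<p. if b' = b then if a' = a then V l x * cnj (V l y) else 0 else 0)"
          by (intro sum.cong refl) (auto simp: unit_mat_def V_def xy)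
        also have "\<dots> = V l x * cnj (V l y)" using xy by simp
        finally show "(mat_adjoint (A l) * ?E * A l) $$ (c, d) = V l x * cnj (V l y)" .
      qed
      finally show "choi p \<phi> x y = (\<Sum>l\<in>{1..s}. V l x * cnj (V l y))" .
    qed
  }
  assume "choi p \<phi> \<in> rank_one_cone (ix p m) (schmidt_le p m k)"
  then obtain q :: nat and V where q: "0 < q" and V: "\<And>l. l \<in> {1..q} \<Longrightarrow> V l \<in> schmidt_le p m k"
    and choi: "\<And>x y. x \<in> ix p m \<Longrightarrow> y \<in> ix p m \<Longrightarrow> choi p \<phi> x y = (\<Sum>l\<in>{1..q}. V l x * cnj (V l y))"
    by (rule choi_cone_indexed) (rule that)
  define A where "A l = Matrix.mat p m (\<lambda>x. cnj (V l x))" for l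
  have A: "A l \<in> carrier_mat p m" for l by (simp add: A_def)
  have rank: "vec_space.rank p (A l) \<le> k" if l: "l \<in> {1..q}" for l
  proof -
    obtain u v where "\<And>a c. a < p \<Longrightarrow> c < m \<Longrightarrow> cnj (V l (a, c)) = (\<Sum>e<k. u e a * v e c)"
      by (rule schmidt_leE[OF schmidt_le_cnj[OF V[OF l]]]) (rule that)
    then show ?thesis by (intro rank_le_if_factorization[OF A]) (simp add: A_def)
  qed
  have "\<phi> X = (\<Oplus>\<^bsub>module_mat TYPE(complex) m m\<^esub>l\<in>{1..q}. mat_adjoint (A l) * X * A l)"
    if X: "X \<in> carrier_mat p p" for X
  proof -
    let ?R = "\<Oplus>\<^bsub>module_mat TYPE(complex) m m\<^esub>l\<in>{1..q}. mat_adjoint (A l) * X * A l"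
    have R: "?R \<in> carrier_mat m m"
      by (rule finsum_mat_closed) (use entry(1)[OF A X] in \<open>auto simp: module_mat_simps\<close>)
    have \<phi>X: "\<phi> X \<in> carrier_mat m m" using hom X by (simp add: mat_hom_iff)
    show ?thesis
    proof (rule eq_matI)
      fix c d assume "c < dim_row ?R" "d < dim_col ?R"
      then have cd: "c < m" "d < m" using R by auto
      have "?R $$ (c, d) = (\<Sum>l\<in>{1..q}. (mat_adjoint (A l) * X * A l) $$ (c, d))"
        by (rule finsum_mat_index) (use entry(1)[OF A X] cd in \<open>auto simp: module_mat_simps\<close>)
      also have "\<dots> = (\<Sum>l\<in>{1..q}. \<Sum>a<p. \<Sum>b<p. X $$ (a, b) * V l (a, c) * cnj (V l (b, d)))"
        by (intro sum.cong refl) (simp add: entry(2)[OF A X cd], simp add: A_def cd)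
      also have "\<dots> = \<phi> X $$ (c, d)" by (rule mat_hom_kraus[OF hom X cd choi, symmetric])
      finally show "\<phi> X $$ (c, d) = ?R $$ (c, d)" ..
    qed (use R \<phi>X in auto)
  qed
  then show "low_rank_kraus p m k \<phi>" unfolding low_rank_kraus_def using q A rank by blast
qed

text \<open>
  The Choi matrix of \<open>X \<mapsto> M \<psi>(X) M\<^sup>*\<close> is the compression of that of \<open>\<psi>\<close> by the transpose of \<open>M\<close>,
  so its vectors are images of vectors of \<open>C^p \<otimes> C^k\<close> and have Schmidt rank at most \<open>k\<close>. Conversely, a vector \<open>\<Sum> u_e \<otimes> w_e\<close> with \<open>k\<close>
  terms yields \<open>\<psi>\<close> from the \<open>u_e\<close> and \<open>M\<close> from the \<open>w_e\<close>.
\<close>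

lemma factors_through_iff:
  assumes hom: "\<phi> \<in> mat_hom p m" and k: "0 < k"
  shows "factors_through p m k \<phi> \<longleftrightarrow> choi p \<phi> \<in> rank_one_cone (ix p m) (schmidt_le p m k)"
proof
  have entry: "M * Y * mat_adjoint M \<in> carrier_mat m m"
    "c < m \<Longrightarrow> d < m \<Longrightarrow> (M * Y * mat_adjoint M) $$ (c, d)
      = (\<Sum>e<k. \<Sum>e'<k. Y $$ (e, e') * M $$ (c, e) * cnj (M $$ (d, e')))"
    if M: "M \<in> carrier_mat m k" and Y: "Y \<in> carrier_mat k k" for M Y :: "complex mat" and c d
  proof -
    note adj = mat_adjoint_carrier[OF M]
    show "M * Y * mat_adjoint M \<in> carrier_mat m m" using adj M Y by simp
    show "(M * Y * mat_adjoint M) $$ (c, d)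
      = (\<Sum>e<k. \<Sum>e'<k. Y $$ (e, e') * M $$ (c, e) * cnj (M $$ (d, e')))" if "c < m" "d < m"
      using that by (simp add: mult_three_index[OF M Y adj that] mat_adjoint_index[OF M] mult_ac)
  qed
  {
    assume "factors_through p m k \<phi>"
    then obtain q :: nat and \<psi> and M where cp: "\<And>l. l \<in> {1..q} \<Longrightarrow> completely_positive (mat_sys p) (mat_sys k) (\<psi> l)"
      and M: "\<And>l. l \<in> {1..q} \<Longrightarrow> M l \<in> carrier_mat m k"
      and \<phi>: "\<And>X. X \<in> carrier_mat p p \<Longrightarrow> \<phi> X =
        (\<Oplus>\<^bsub>module_mat TYPE(complex) m m\<^esub>l\<in>{1..q}. M l * \<psi> l X * mat_adjoint (M l))"
      unfolding factors_through_def by blast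
    have \<psi>c: "\<psi> l X \<in> carrier_mat k k" if "l \<in> {1..q}" "X \<in> carrier_mat p p" for l X
      using cp[OF that(1)] that(2) unfolding completely_positive_def mat_hom_iff by blast
    define V where "V l = (\<lambda>(e, c). M l $$ (c, e))" for l
    show "choi p \<phi> \<in> rank_one_cone (ix p m) (schmidt_le p m k)"
    proof (rule choi_cone_of_sum)
      fix l assume l: "l \<in> {1..q}"
      have "choi p (\<psi> l) \<in> rank_one_cone (ix p k) UNIV"
        by (rule psd_imp_rank_one_cone[OF _ choi_psd[OF completely_positive_k_positive[OF cp[OF l] k]]]) simp
      then show "compression k (V l) (choi p (\<psi> l)) \<in> rank_one_cone (ix p m) (schmidt_le p m k)"
      proof (rule compression_rank_one_cone)
        fix W :: "nat \<times> nat \<Rightarrow> complex"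
        show "(\<lambda>(i, c). \<Sum>a<k. V l (a, c) * W (i, a)) \<in> schmidt_le p m k"
          by (rule schmidt_leI[where u = "\<lambda>e i. W (i, e)" and v = "\<lambda>e c. V l (e, c)"]) (simp add: mult.commute)
      qed
    next
      fix x y assume "x \<in> ix p m" "y \<in> ix p m"
      then obtain a c b d where xy: "x = (a, c)" "y = (b, d)" "a < p" "b < p" "c < m" "d < m" by auto
      have "choi p \<phi> x y = (\<Sum>l\<in>{1..q}. (M l * \<psi> l (unit_mat p a b) * mat_adjoint (M l)) $$ (c, d))"
        unfolding choi_def xy fst_conv snd_conv \<phi>[OF unit_mat_carrier]
        by (rule finsum_mat_index) (use M entry \<psi>c unit_mat_carrier xy in \<open>auto simp: module_mat_simps\<close>)
      also have "\<dots> = (\<Sum>l\<in>{1..q}. compression k (V l) (choi p (\<psi> l)) x y)"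
        by (intro sum.cong refl)
          (simp add: entry(2)[OF M \<psi>c[OF _ unit_mat_carrier] xy(5,6)] compression_def V_def choi_def xy)
      finally show "choi p \<phi> x y = (\<Sum>l\<in>{1..q}. compression k (V l) (choi p (\<psi> l)) x y)" .
    qed
  }
  assume "choi p \<phi> \<in> rank_one_cone (ix p m) (schmidt_le p m k)"
  then obtain q :: nat and V where q: "0 < q" and V: "\<And>l. l \<in> {1..q} \<Longrightarrow> V l \<in> schmidt_le p m k"
    and choi: "\<And>x y. x \<in> ix p m \<Longrightarrow> y \<in> ix p m \<Longrightarrow> choi p \<phi> x y = (\<Sum>l\<in>{1..q}. V l x * cnj (V l y))"
    by (rule choi_cone_indexed) (rule that)
  have "\<forall>l. \<exists>u w. l \<in> {1..q} \<longrightarrow> (\<forall>a<p. \<forall>c<m. V l (a, c) = (\<Sum>e<k. u e a * w e c))"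
    using V unfolding schmidt_le_def by blast
  then obtain u w where uw: "\<And>l a c. l \<in> {1..q} \<Longrightarrow> a < p \<Longrightarrow> c < m \<Longrightarrow> V l (a, c) = (\<Sum>e<k. u l e a * w l e c)"
    by metis
  define \<psi> where "\<psi> l = compress_mat p k (\<lambda>(a, e). u l e a)" for l
  define M where "M l = Matrix.mat m k (\<lambda>(c, e). w l e c)" for l
  have M: "M l \<in> carrier_mat m k" for l by (simp add: M_def)
  have \<psi>c: "\<psi> l X \<in> carrier_mat k k" for l X by (simp add: \<psi>_def compress_mat_def)
  have cp: "completely_positive (mat_sys p) (mat_sys k) (\<psi> l)" for l
    unfolding \<psi>_def by (rule completely_positive_compress_mat)
  have "\<phi> X = (\<Oplus>\<^bsub>module_mat TYPE(complex) m m\<^esub>l\<in>{1..q}. M l * \<psi> l X * mat_adjoint (M l))"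
    if X: "X \<in> carrier_mat p p" for X
  proof -
    let ?R = "\<Oplus>\<^bsub>module_mat TYPE(complex) m m\<^esub>l\<in>{1..q}. M l * \<psi> l X * mat_adjoint (M l)"
    have R: "?R \<in> carrier_mat m m"
      by (rule finsum_mat_closed) (use entry(1)[OF M \<psi>c] in \<open>auto simp: module_mat_simps\<close>)
    have \<phi>X: "\<phi> X \<in> carrier_mat m m" using hom X by (simp add: mat_hom_iff)
    show ?thesis
    proof (rule eq_matI)
      fix c d assume "c < dim_row ?R" "d < dim_col ?R"
      then have cd: "c < m" "d < m" using R by auto
      have "?R $$ (c, d) = (\<Sum>l\<in>{1..q}. (M l * \<psi> l X * mat_adjoint (M l)) $$ (c, d))"
        by (rule finsum_mat_index) (use entry(1)[OF M \<psi>c] cd in \<open>auto simp: module_mat_simps\<close>)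
      also have "\<dots> = (\<Sum>l\<in>{1..q}. \<Sum>e<k. \<Sum>e'<k.
          (\<Sum>a<p. \<Sum>b<p. X $$ (a, b) * u l e a * cnj (u l e' b)) * w l e c * cnj (w l e' d))"
        by (intro sum.cong refl) (simp add: entry(2)[OF M \<psi>c cd], simp add: M_def \<psi>_def compress_mat_def cd)
      also have "\<dots> = (\<Sum>l\<in>{1..q}. \<Sum>a<p. \<Sum>b<p. X $$ (a, b) * V l (a, c) * cnj (V l (b, d)))"
        unfolding bilinear_factor[symmetric] by (intro sum.cong refl) (simp add: uw cd)
      also have "\<dots> = \<phi> X $$ (c, d)" by (rule mat_hom_kraus[OF hom X cd choi, symmetric])
      finally show "\<phi> X $$ (c, d) = ?R $$ (c, d)" ..
    qed (use R \<phi>X in auto)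
  qed
  then show "factors_through p m k \<phi>" unfolding factors_through_def using q cp M by blast
qed

theorem theorem6p9:
  fixes p m k :: nat and \<phi> :: "complex mat \<Rightarrow> complex mat"
  assumes "0 < p" and "0 < m" and "0 < k" and "k \<le> min p m"
    and "\<phi> \<in> LinearCombinations.module_hom class_ring (mat_sys p) (mat_sys m)"
  shows
    "(completely_positive (OMIN k (mat_sys p)) (mat_sys m) \<phi> \<longleftrightarrow> k_PEB p m k \<phi>) \<and>
     (completely_positive (OMIN k (mat_sys p)) (mat_sys m) \<phi> \<longleftrightarrow>
        completely_positive (mat_sys p) (OMAX k (mat_sys m)) \<phi>) \<and>
     (completely_positive (OMIN k (mat_sys p)) (mat_sys m) \<phi> \<longleftrightarrow>
        (\<exists>q::nat. \<exists>\<psi> :: nat \<Rightarrow> complex mat \<Rightarrow> complex mat. \<exists>M :: nat \<Rightarrow> complex mat.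
           0 < q \<and>
           (\<forall>l\<in>{1..q}. completely_positive (mat_sys p) (mat_sys k) (\<psi> l) \<and> M l \<in> carrier_mat m k) \<and>
           (\<forall>X \<in> carrier_mat p p. \<phi> X =
              (\<Oplus>\<^bsub>module_mat TYPE(complex) m m\<^esub>l\<in>{1..q}. M l * \<psi> l X * mat_adjoint (M l))))) \<and>
     (completely_positive (OMIN k (mat_sys p)) (mat_sys m) \<phi> \<longleftrightarrow>
        (\<exists>s::nat. \<exists>A :: nat \<Rightarrow> complex mat.
           0 < s \<and>
           (\<forall>l\<in>{1..s}. A l \<in> carrier_mat p m \<and> vec_space.rank p (A l) \<le> k) \<and>
           (\<forall>X \<in> carrier_mat p p. \<phi> X =
              (\<Oplus>\<^bsub>module_mat TYPE(complex) m m\<^esub>l\<in>{1..s}. mat_adjoint (A l) * X * A l)))) \<and>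
     (completely_positive (OMIN k (mat_sys p)) (mat_sys m) \<phi> \<longleftrightarrow>
        completely_positive (OMIN k (mat_sys p)) (OMAX k (mat_sys m)) \<phi>)"
proof -
  have k: "k \<le> p" "k \<le> m" using assms(4) by simp_all
  note hom = assms(5)
  let ?C = "choi p \<phi> \<in> rank_one_cone (ix p m) (schmidt_le p m k)"
  have vi: "completely_positive (OMIN k (mat_sys p)) (OMAX k (mat_sys m)) \<phi>" if ?C
    by (rule OMIN_OMAX_completely_positive_of_choi[OF assms(3) k hom that])
  have iii: "completely_positive (mat_sys p) (OMAX k (mat_sys m)) \<phi>"
    if "completely_positive (OMIN k (mat_sys p)) (OMAX k (mat_sys m)) \<phi>"
    by (rule completely_positive_OMIN_domain[OF k(1) that])
  have i: "completely_positive (OMIN k (mat_sys p)) (mat_sys m) \<phi>"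
    if "completely_positive (OMIN k (mat_sys p)) (OMAX k (mat_sys m)) \<phi>"
    by (rule completely_positive_OMAX_codomain[OF assms(3) k(2) that])
  have C_of_iii: ?C if "completely_positive (mat_sys p) (OMAX k (mat_sys m)) \<phi>"
    by (rule choi_of_OMAX_completely_positive[OF assms(3) k(2) assms(1) that])
  have C_of_i: ?C if "completely_positive (OMIN k (mat_sys p)) (mat_sys m) \<phi>"
    by (rule choi_of_OMIN_completely_positive[OF k assms(2) that])
  have ii: "k_PEB p m k \<phi>" if ?C
    by (rule k_PEB_of_choi[OF hom completely_positive_OMIN_domain[OF k(1) i[OF vi[OF that]]] that])
  have C_of_ii: ?C if "k_PEB p m k \<phi>" by (rule choi_of_k_PEB[OF that assms(2)])
  note iv = factors_through_iff[OF hom assms(3), unfolded factors_through_def]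
  note v = low_rank_kraus_iff[OF hom, of k, unfolded low_rank_kraus_def]
  show ?thesis unfolding iv v using vi iii i C_of_iii C_of_i ii C_of_ii by blast
qed

end
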